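(* Let $\mathcal M$ be a matrix class over $\mathbb F_2$. Then $\mathcal M$ has bounded twin-width if and only if it is parity-minor free, i.e. there is a $0,1$-matrix that is not a parity minor of any matrix of $\mathcal M$.
   Context: A matrix with row set $R$ and column set $C$ is identified with the ordered binary structure on $R\uplus C$ with a unary relation marking rows, a total order extending the row and column orders with rows before columns, and a binary relation $E(r,c)$ holding iff $r\in R$, $c\in C$ and the entry at $(r,c)$ is $1$. Twin-width: a contraction sequence is a sequence of partitions of the domain from singletons to a single part, each obtained from the previous one by merging two parts; distinct parts $X,Y$ are red-adjacent if there are $u,u'\in X$, $v,v'\in Y$ with $(u,v)$ and $(u',v')$ of different atomic types (which unary relations contain each element and which binary relations contain $(u,v)$ and $(v,u)$); the twin-width is the least $d$ for which some contraction sequence has every part red-adjacent to at most $d$ others at every step. A matrix class is a set of matrices closed under taking submatrices. A deletion removes a row or column; a sum replaces two consecutive rows (resp. columns) by their entrywise sum modulo $2$. A parity minor of $M$ is any matrix obtained from $M$ by a finite sequence of deletions and sums. *)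

theory Defs
  imports
    "HOL-Library.Z2"
    "Jordan_Normal_Form.DL_Submatrix"
begin

text \<open>The types \<open>'i\<close> and \<open>'j\<close> index the unary and the binary relation symbols.\<close>

record ('a, 'i, 'j) binary_structure =
  points :: "'a set"
  unary  :: "'i \<Rightarrow> 'a \<Rightarrow> bool"
  binary :: "'j \<Rightarrow> 'a \<Rightarrow> 'a \<Rightarrow> bool"

definition atomic_type ::
    "('a, 'i, 'j) binary_structure \<Rightarrow> 'a \<Rightarrow> 'a \<Rightarrow> 'i set \<times> 'i set \<times> 'j set \<times> 'j set" where
  "atomic_type S u v =
     ({i. unary S i u}, {i. unary S i v}, {j. binary S j u v}, {j. binary S j v u})"

definition red_adjacent :: "('a, 'i, 'j) binary_structure \<Rightarrow> 'a set \<Rightarrow> 'a set \<Rightarrow> bool" where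
  "red_adjacent S X Y \<longleftrightarrow>
     X \<noteq> Y \<and> (\<exists>u\<in>X. \<exists>u'\<in>X. \<exists>v\<in>Y. \<exists>v'\<in>Y. atomic_type S u v \<noteq> atomic_type S u' v')"

definition merges_to :: "'a set set \<Rightarrow> 'a set set \<Rightarrow> bool" where
  "merges_to P Q \<longleftrightarrow> (\<exists>X\<in>P. \<exists>Y\<in>P. X \<noteq> Y \<and> Q = insert (X \<union> Y) (P - {X, Y}))"

text \<open>
  The final partition is the one with the single part \<open>V\<close>. The empty set has only the empty
  partition; removing \<open>{}\<close> from \<open>{V}\<close> covers this degenerate case.
\<close>

definition contraction_sequence :: "'a set \<Rightarrow> 'a set set list \<Rightarrow> bool" where
  "contraction_sequence V Ps \<longleftrightarrow>
     Ps \<noteq> [] \<and> hd Ps = (\<lambda>v. {v}) ` V \<and> successively merges_to Ps \<and> last Ps = {V} - {{}}"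

definition red_degree :: "('a, 'i, 'j) binary_structure \<Rightarrow> 'a set set \<Rightarrow> 'a set \<Rightarrow> nat" where
  "red_degree S P X = card {Y \<in> P. red_adjacent S X Y}"

text \<open>
  Meaningful for structures with finitely many points only: then a contraction sequence exists
  and \<open>card\<close> in the red degree is applied to finite sets.
\<close>

definition twin_width :: "('a, 'i, 'j) binary_structure \<Rightarrow> nat" where
  "twin_width S =
     (LEAST d. \<exists>Ps. contraction_sequence (points S) Ps \<and>
                    (\<forall>P\<in>set Ps. \<forall>X\<in>P. red_degree S P X \<le> d))"

datatype unary_symbol = Is_Row
datatype binary_symbol = Order | Entry

text \<open>
  The ordered row and column sets are, up to order isomorphism, initial segments of the natural
  numbers. In their disjoint union rows are tagged with \<open>Inl\<close> and columns with \<open>Inr\<close>.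
\<close>

fun row_column_le :: "nat + nat \<Rightarrow> nat + nat \<Rightarrow> bool" where
  "row_column_le (Inl r) (Inl r') \<longleftrightarrow> r \<le> r'"
| "row_column_le (Inl r) (Inr c) \<longleftrightarrow> True"
| "row_column_le (Inr c) (Inl r) \<longleftrightarrow> False"
| "row_column_le (Inr c) (Inr c') \<longleftrightarrow> c \<le> c'"

fun entry_rel :: "bit mat \<Rightarrow> nat + nat \<Rightarrow> nat + nat \<Rightarrow> bool" where
  "entry_rel A (Inl r) (Inr c) \<longleftrightarrow> r < dim_row A \<and> c < dim_col A \<and> A $$ (r, c) = 1"
| "entry_rel A _ _ \<longleftrightarrow> False"

definition matrix_structure ::
    "bit mat \<Rightarrow> (nat + nat, unary_symbol, binary_symbol) binary_structure" where
  "matrix_structure A =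
     \<lparr> points = {..<dim_row A} <+> {..<dim_col A},
       unary = (\<lambda>s. case s of Is_Row \<Rightarrow> isl),
       binary = (\<lambda>s. case s of Order \<Rightarrow> row_column_le | Entry \<Rightarrow> entry_rel A) \<rparr>"

definition matrix_class :: "bit mat set \<Rightarrow> bool" where
  "matrix_class \<M> \<longleftrightarrow> (\<forall>A\<in>\<M>. \<forall>I J. submatrix A I J \<in> \<M>)"

definition bounded_twin_width :: "bit mat set \<Rightarrow> bool" where
  "bounded_twin_width \<M> \<longleftrightarrow> (\<exists>d. \<forall>A\<in>\<M>. twin_width (matrix_structure A) \<le> d)"

definition delete_row :: "nat \<Rightarrow> 'a mat \<Rightarrow> 'a mat" where
  "delete_row i A = submatrix A (- {i}) UNIV"

definition delete_col :: "nat \<Rightarrow> 'a mat \<Rightarrow> 'a mat" where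
  "delete_col j A = submatrix A UNIV (- {j})"

definition sum_rows :: "nat \<Rightarrow> 'a::plus mat \<Rightarrow> 'a mat" where
  "sum_rows i A = mat (dim_row A - 1) (dim_col A) (\<lambda>(r, c).
     if r < i then A $$ (r, c)
     else if r = i then A $$ (i, c) + A $$ (Suc i, c)
     else A $$ (Suc r, c))"

definition sum_cols :: "nat \<Rightarrow> 'a::plus mat \<Rightarrow> 'a mat" where
  "sum_cols j A = mat (dim_row A) (dim_col A - 1) (\<lambda>(r, c).
     if c < j then A $$ (r, c)
     else if c = j then A $$ (r, j) + A $$ (r, Suc j)
     else A $$ (r, Suc c))"

inductive parity_step :: "bit mat \<Rightarrow> bit mat \<Rightarrow> bool" where
  delete_row: "i < dim_row A \<Longrightarrow> parity_step A (delete_row i A)"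
| delete_col: "j < dim_col A \<Longrightarrow> parity_step A (delete_col j A)"
| sum_rows: "Suc i < dim_row A \<Longrightarrow> parity_step A (sum_rows i A)"
| sum_cols: "Suc j < dim_col A \<Longrightarrow> parity_step A (sum_cols j A)"

definition parity_minor :: "bit mat \<Rightarrow> bit mat \<Rightarrow> bool" where
  "parity_minor N A \<longleftrightarrow> parity_step\<^sup>*\<^sup>* A N"

definition parity_minor_free :: "bit mat set \<Rightarrow> bool" where
  "parity_minor_free \<M> \<longleftrightarrow> (\<exists>N. \<forall>A\<in>\<M>. \<not> parity_minor N A)"

end

theory Submission
  imports Defs "HOL-Library.Disjoint_Sets"
begin

text \<open>
  If every \<open>N\<close> is a parity minor of the class, take \<open>N\<close> to be a large grid of identity blocks. In a
  contraction sequence of bounded red degree stop when a part first spans a whole group of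
  consecutive rows (or columns). The order makes every part that meets this group red-adjacent to
  the spanning part, so the group meets few parts, and on some column group its rows have few
  distinct traces. This bounds the number of distinct sums of rows, a contradiction.

  Conversely, merge consecutive rows or columns into intervals as long as every interval has, after
  ignoring a bounded number of intervals on the other side, boundedly many distinct lines. Lines
  that agree on all simple zones then form the parts of a contraction sequence of bounded red
  degree. If the merging gets stuck, the Marcus-Tardos theorem, applied to the zones in which
  differences of rows have their first nonzero entry, yields a large grid of zones each containing
  many distinct row sums, and linear algebra over \<open>F\<^sub>2\<close> realises any matrix on such a grid.
\<close>

text \<open>Many distinct rows in each zone do not suffice to realise every matrix, because sums of
  rows over F_2 may collapse. What counts in a zone is the number of distinct row sums: once it
  exceeds n * 2^t, counting yields t sets of rows that are independent on all n column groups
  simultaneously, and each column group can then be solved by itself. Differences of rows supply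
  such sums: if s of them have their first nonzero entries in s different blocks, they form a
  triangular matrix. A block with at least s traces could hold all the variety of a part in a single
  point of the grid problem; such blocks are therefore skipped when "first" is determined and count
  on their own, and this is why poorness of a part lets k intervals be ignored. A zone is called
  complex only if it is rich in both directions. This is symmetric and monotone, so rows and columns
  disregard the same zones, and a coarser division has a coarser partition.\<close>

declare add_bit_eq_xor [simp del] mult_bit_eq_and [simp del] sum_of_bool_eq [simp del]

subsection \<open>The Marcus-Tardos theorem\<close>

text \<open>All pairs are compared rather than neighbours, because blocks may be empty. Blocks need
  not be intervals or cover anything; the lines in the gaps are those that a parity minor
  deletes.\<close>

definition ordered_blocks :: "nat \<Rightarrow> (nat \<Rightarrow> nat set) \<Rightarrow> bool" where
  "ordered_blocks t X \<longleftrightarrow> (\<forall>i j. i < j \<longrightarrow> j < t \<longrightarrow> (\<forall>a\<in>X i. \<forall>b\<in>X j. a < b))"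

lemma ordered_blocksD:
  assumes "ordered_blocks t X" "i < j" "j < t" "a \<in> X i" "b \<in> X j"
  shows "a < b"
  using assms(1)[unfolded ordered_blocks_def, rule_format, OF assms(2-5)] .

lemma ordered_blocks_mono:
  assumes "ordered_blocks n X" and "m \<le> n"
  shows "ordered_blocks m X"
  unfolding ordered_blocks_def
proof (intro allI impI ballI)
  fix i j a b
  assume "i < j" "j < m" "a \<in> X i" "b \<in> X j"
  with assms(2) show "a < b" by (intro ordered_blocksD[OF assms(1), of i j a b]) linarith+
qed

lemma ordered_blocks_disjoint:
  assumes "ordered_blocks t X" "i < t" "j < t" "i \<noteq> j"
  shows "X i \<inter> X j = {}"
proof -
  have "a \<noteq> b" if "a \<in> X i" "b \<in> X j" for a b
    using ordered_blocksD[OF assms(1), of i j a b] ordered_blocksD[OF assms(1), of j i b a]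
      assms(2-4) that by linarith
  then show ?thesis by blast
qed

lemma ordered_blocks_vimage:
  assumes "ordered_blocks t X" and "mono f"
  shows "ordered_blocks t (\<lambda>i. f -` X i)"
  unfolding ordered_blocks_def
proof (intro allI impI ballI)
  fix i j a b
  assume ij: "i < j" "j < t" and ab: "a \<in> f -` X i" "b \<in> f -` X j"
  have "f a < f b" using ordered_blocksD[OF assms(1) ij] ab by (simp add: vimage_def)
  then show "a < b" using monoD[OF assms(2), of b a] by linarith
qed

text \<open>The grid minor of the Marcus-Tardos theorem: all cells of a t by t division contain a
  point, without fixing where the blocks end.\<close>

definition has_grid :: "nat \<Rightarrow> (nat \<times> nat) set \<Rightarrow> bool" where
  "has_grid t P \<longleftrightarrow> (\<exists>X Y. ordered_blocks t X \<and> ordered_blocks t Y \<and>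
     (\<forall>i<t. \<forall>j<t. P \<inter> X i \<times> Y j \<noteq> {}))"

lemma has_grid_mono:
  assumes "has_grid n P" and "m \<le> n"
  shows "has_grid m P"
proof -
  from assms(1) obtain X Y where XY: "ordered_blocks n X" "ordered_blocks n Y"
    and ne: "\<forall>i<n. \<forall>j<n. P \<inter> X i \<times> Y j \<noteq> {}" unfolding has_grid_def by blast
  have "\<forall>i<m. \<forall>j<m. P \<inter> X i \<times> Y j \<noteq> {}"
    using ne assms(2) by (meson order_less_le_trans)
  then show ?thesis unfolding has_grid_def using XY ordered_blocks_mono assms(2) by blast
qed

lemma has_grid_converse: "has_grid t (P\<inverse>) \<longleftrightarrow> has_grid t P"
proof -
  have *: "has_grid t (Q\<inverse>)" if "has_grid t Q" for Q
  proof -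
    from that obtain X Y where "ordered_blocks t X" "ordered_blocks t Y"
      "\<forall>i<t. \<forall>j<t. Q \<inter> X i \<times> Y j \<noteq> {}" unfolding has_grid_def by blast
    moreover from this(3) have "\<forall>i<t. \<forall>j<t. Q\<inverse> \<inter> Y i \<times> X j \<noteq> {}" by fast
    ultimately show ?thesis unfolding has_grid_def by blast
  qed
  show ?thesis using *[of P] *[of "P\<inverse>"] by auto
qed

lemma ordered_enumeration:
  fixes S :: "nat set"
  assumes "finite S" and "t \<le> card S"
  shows "\<exists>f. (\<forall>i<t. f i \<in> S) \<and> (\<forall>i j. i < j \<longrightarrow> j < t \<longrightarrow> f i < f j)"
proof -
  let ?xs = "sorted_list_of_set S"
  have "length ?xs = card S" by simp
  moreover have "sorted_wrt (<) ?xs" by simp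
  ultimately show ?thesis using assms
    by (intro exI[of _ "\<lambda>i. ?xs ! i"])
       (metis length_sorted_list_of_set nth_mem order_less_le_trans set_sorted_list_of_set
         sorted_wrt_nth_less)
qed

text \<open>Pigeonhole in one column of w by w blocks: a block is wide if at least t of its columns
  are nonempty, and there are only 2^w sets of nonempty columns. Beyond t * 2^w wide blocks, more
  than t share such a set, and their rows with t of the common columns form a grid.\<close>

lemma wide_blocks_bound:
  fixes P :: "(nat \<times> nat) set"
  assumes no: "\<not> has_grid t P" and t: "0 < t" and w: "0 < w"
  shows "card {i. i < n \<and> t \<le> card {c \<in> {w * j..<w * Suc j}. \<exists>r. r div w = i \<and> (r, c) \<in> P}}
           \<le> t * 2 ^ w" (is "card ?B \<le> _")
proof (rule ccontr)
  assume large: "\<not> card ?B \<le> t * 2 ^ w"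
  define cols where "cols i = {c \<in> {w * j..<w * Suc j}. \<exists>r. r div w = i \<and> (r, c) \<in> P}" for i
  have fin: "finite ?B" by simp
  have im: "cols ` ?B \<subseteq> Pow {w * j..<w * Suc j}" by (auto simp: cols_def)
  define B where "B = ?B"
  define U where "U = Pow {w * j..<w * Suc j}"
  have U: "finite U" "card U = 2 ^ w" "cols ` B \<subseteq> U"
    using im unfolding U_def B_def by (simp_all add: card_Pow)
  obtain S where S: "t < card {i \<in> B. cols i = S}"
  proof (rule ccontr)
    assume "\<not> thesis"
    have le: "card {i \<in> B. cols i = S} \<le> t" for S
      by (rule leI) (use \<open>\<not> thesis\<close> that in blast)
    have "B \<subseteq> (\<Union>S\<in>U. {i \<in> B. cols i = S})" using U(3) by blast
    then have "card B \<le> card (\<Union>S\<in>U. {i \<in> B. cols i = S})"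
      by (rule card_mono[rotated]) (simp add: U(1) B_def)
    also have "\<dots> \<le> (\<Sum>S\<in>U. card {i \<in> B. cols i = S})" by (rule card_UN_le[OF U(1)])
    also have "\<dots> \<le> (\<Sum>S\<in>U. t)" by (intro sum_mono le)
    also have "\<dots> = t * 2 ^ w" using U by simp
    finally show False using large by (simp add: B_def)
  qed
  then have "{i \<in> B. cols i = S} \<noteq> {}" by (metis card.empty not_less_zero)
  then obtain i0 where i0: "i0 \<in> ?B" "cols i0 = S" unfolding B_def by blast
  have "t \<le> card (cols i0)" using i0(1) unfolding cols_def by blast
  then have cS: "t \<le> card S" "finite S" using i0(2) by (auto simp: cols_def)
  obtain f where f: "\<And>i. i < t \<Longrightarrow> f i \<in> {i \<in> B. cols i = S}" "\<And>i j. i < j \<Longrightarrow> j < t \<Longrightarrow> f i < f j"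
    using ordered_enumeration[of "{i \<in> B. cols i = S}" t] S fin
    by (force simp: B_def)
  obtain g where g: "\<And>i. i < t \<Longrightarrow> g i \<in> S" "\<And>i j. i < j \<Longrightarrow> j < t \<Longrightarrow> g i < g j"
    using ordered_enumeration[of S t] cS by blast
  have "ordered_blocks t (\<lambda>i. {r. r div w = f i})" unfolding ordered_blocks_def
    using f(2) by (metis div_le_mono leD leI mem_Collect_eq)
  moreover have "ordered_blocks t (\<lambda>i. {g i})" unfolding ordered_blocks_def using g(2) by auto
  moreover have "P \<inter> {r. r div w = f i} \<times> {g k} \<noteq> {}" if "i < t" "k < t" for i k
  proof -
    have "g k \<in> cols (f i)" using f(1)[OF that(1)] g(1)[OF that(2)] by blast
    then show ?thesis unfolding cols_def by blast
  qed
  ultimately show False using no unfolding has_grid_def by blast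
qed

lemma block_card_le:
  fixes Q :: "(nat \<times> nat) set"
  assumes "Q \<subseteq> A \<times> B" "finite A" "finite B" "card (fst ` Q) \<le> k" "card (snd ` Q) \<le> k"
  shows "card Q \<le> k * k"
proof -
  have fin: "finite Q" using assms by (meson finite_SigmaI finite_subset)
  have "card Q \<le> card (fst ` Q \<times> snd ` Q)"
    by (intro card_mono) (use fin in \<open>auto intro: rev_image_eqI\<close>)
  then show ?thesis using assms(4,5) mult_le_mono by (force simp: card_cartesian_product)
qed

text \<open>A grid among the blocks is a grid among the points, so the recursion passes to Q, whose
  side is shorter by the factor w = t^2. Wide and tall blocks number O(n), and every other block has
  at most (t - 1)^2 points; that (t - 1)^2 is below w keeps the recursion linear.\<close>

lemma Marcus_Tardos_step:
  fixes P :: "(nat \<times> nat) set" and t n :: nat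
  defines "w \<equiv> t * t"
  assumes t: "0 < t" and P: "P \<subseteq> {..<w * n} \<times> {..<w * n}" and no: "\<not> has_grid t P"
  defines "Q \<equiv> (\<lambda>(r, c). (r div w, c div w)) ` P"
  shows "card P \<le> (t - 1) * (t - 1) * card Q + 2 * n * (t * 2 ^ w) * (w * w)"
    and "Q \<subseteq> {..<n} \<times> {..<n}" and "\<not> has_grid t Q"
proof -
  have w: "0 < w" using t by (simp add: w_def)
  have divw: "r div w = i \<longleftrightarrow> r \<in> {w * i..<w * Suc i}" for r i
  proof
    assume "r div w = i"
    then show "r \<in> {w * i..<w * Suc i}"
      using w dividend_less_times_div[of w r] by (auto simp: times_div_less_eq_dividend)
  qed (auto intro: div_nat_eqI simp: mult.commute)
  show Qn: "Q \<subseteq> {..<n} \<times> {..<n}" using P by (auto simp: Q_def less_mult_imp_div_less mult.commute)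
  show "\<not> has_grid t Q"
  proof
    assume "has_grid t Q"
    then obtain X Y where XY: "ordered_blocks t X" "ordered_blocks t Y"
      "\<forall>i<t. \<forall>j<t. Q \<inter> X i \<times> Y j \<noteq> {}" unfolding has_grid_def by blast
    have "mono (\<lambda>r. r div w)" by (simp add: div_le_mono monoI)
    note vim = ordered_blocks_vimage[OF _ this]
    have "\<forall>i<t. \<forall>j<t. P \<inter> (\<lambda>r. r div w) -` X i \<times> (\<lambda>r. r div w) -` Y j \<noteq> {}"
      using XY(3) unfolding Q_def by fastforce
    then show False using no vim[OF XY(1)] vim[OF XY(2)] unfolding has_grid_def by blast
  qed
  define blk where "blk z = P \<inter> {w * fst z..<w * Suc (fst z)} \<times> {w * snd z..<w * Suc (snd z)}" for z
  have finP: "finite P" using P by (meson finite_SigmaI finite_lessThan finite_subset)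
  have finQ: "finite Q" using finP by (simp add: Q_def)
  define W where "W = {z \<in> Q. t \<le> card (snd ` blk z)}"
  define T where "T = {z \<in> Q. t \<le> card (fst ` blk z)}"
  have blk_le: "card (blk z) \<le> w * w" for z
  proof -
    have "card (blk z) \<le> card ({w * fst z..<w * Suc (fst z)} \<times> {w * snd z..<w * Suc (snd z)})"
      by (intro card_mono) (auto simp: blk_def)
    then show ?thesis by (simp add: card_cartesian_product)
  qed
  have W: "card W \<le> n * (t * 2 ^ w)"
  proof -
    have "W \<subseteq> (\<Union>j<n. (\<lambda>i. (i, j)) `
      {i. i < n \<and> t \<le> card {c \<in> {w * j..<w * Suc j}. \<exists>r. r div w = i \<and> (r, c) \<in> P}})"
    proof
      fix z assume "z \<in> W"
      obtain i j where z: "z = (i, j)" by force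
      have "snd ` blk (i, j) = {c \<in> {w * j..<w * Suc j}. \<exists>r. r div w = i \<and> (r, c) \<in> P}"
        unfolding blk_def divw by (auto intro: rev_image_eqI)
      then have "t \<le> card {c \<in> {w * j..<w * Suc j}. \<exists>r. r div w = i \<and> (r, c) \<in> P}"
        using \<open>z \<in> W\<close> by (metis (lifting) W_def mem_Collect_eq z)
      moreover have "i < n" "j < n" using \<open>z \<in> W\<close> Qn by (auto simp: W_def z)
      ultimately show "z \<in> (\<Union>j<n. (\<lambda>i. (i, j)) `
        {i. i < n \<and> t \<le> card {c \<in> {w * j..<w * Suc j}. \<exists>r. r div w = i \<and> (r, c) \<in> P}})"
        unfolding z by blast
    qed
    then have "card W \<le> card (\<Union>j<n. (\<lambda>i. (i, j)) ` {i. i < n \<and> t \<le> card {c \<in> {w * j..<w * Suc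
        j}. \<exists>r. r div w = i \<and> (r, c) \<in> P}})"
      by (intro card_mono) auto
    also have "\<dots> \<le> (\<Sum>j<n. card ((\<lambda>i. (i, j)) ` {i. i < n \<and> t \<le> card {c \<in> {w * j..<w * Suc j}.
        \<exists>r. r div w = i \<and> (r, c) \<in> P}}))"
      by (intro card_UN_le) simp
    also have "\<dots> \<le> (\<Sum>j<n. t * 2 ^ w)"
    proof (rule sum_mono)
      fix j
      have "card ((\<lambda>i. (i, j)) ` {i. i < n \<and> t \<le> card {c \<in> {w * j..<w * Suc j}. \<exists>r. r div w = i
          \<and> (r, c) \<in> P}}) \<le> card {i. i < n \<and> t \<le> card {c \<in> {w * j..<w * Suc j}. \<exists>r. r div w = i
          \<and> (r, c) \<in> P}}"
        by (rule card_image_le) simp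
      also have "\<dots> \<le> t * 2 ^ w" by (rule wide_blocks_bound[OF no t w])
      finally show "card ((\<lambda>i. (i, j)) ` {i. i < n \<and> t \<le> card {c \<in> {w * j..<w * Suc j}. \<exists>r. r
          div w = i \<and> (r, c) \<in> P}}) \<le> t * 2 ^ w" .
    qed
    finally show ?thesis by simp
  qed
  have T: "card T \<le> n * (t * 2 ^ w)"
  proof -
    have no': "\<not> has_grid t (P\<inverse>)" using no by (simp add: has_grid_converse)
    have "T \<subseteq> (\<Union>j<n. (\<lambda>i. (j, i)) `
      {i. i < n \<and> t \<le> card {c \<in> {w * j..<w * Suc j}. \<exists>r. r div w = i \<and> (r, c) \<in> P\<inverse>}})"
    proof
      fix z assume "z \<in> T"
      obtain i j where z: "z = (j, i)" by force
      have "fst ` blk (j, i) = {c \<in> {w * j..<w * Suc j}. \<exists>r. r div w = i \<and> (r, c) \<in> P\<inverse>}"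
        unfolding blk_def divw by (auto intro: rev_image_eqI)
      then have "t \<le> card {c \<in> {w * j..<w * Suc j}. \<exists>r. r div w = i \<and> (r, c) \<in> P\<inverse>}"
        using \<open>z \<in> T\<close> by (metis (lifting) T_def mem_Collect_eq z)
      moreover have "i < n" "j < n" using \<open>z \<in> T\<close> Qn by (auto simp: T_def z)
      ultimately show "z \<in> (\<Union>j<n. (\<lambda>i. (j, i)) `
        {i. i < n \<and> t \<le> card {c \<in> {w * j..<w * Suc j}. \<exists>r. r div w = i \<and> (r, c) \<in> P\<inverse>}})"
        unfolding z by blast
    qed
    then have "card T \<le> card (\<Union>j<n. (\<lambda>i. (j, i)) ` {i. i < n \<and> t \<le> card {c \<in> {w * j..<w * Suc
        j}. \<exists>r. r div w = i \<and> (r, c) \<in> P\<inverse>}})"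
      by (intro card_mono) auto
    also have "\<dots> \<le> (\<Sum>j<n. card ((\<lambda>i. (j, i)) ` {i. i < n \<and> t \<le> card {c \<in> {w * j..<w * Suc j}.
        \<exists>r. r div w = i \<and> (r, c) \<in> P\<inverse>}}))"
      by (intro card_UN_le) simp
    also have "\<dots> \<le> (\<Sum>j<n. t * 2 ^ w)"
    proof (rule sum_mono)
      fix j
      have "card ((\<lambda>i. (j, i)) ` {i. i < n \<and> t \<le> card {c \<in> {w * j..<w * Suc j}. \<exists>r. r div w = i
          \<and> (r, c) \<in> P\<inverse>}}) \<le> card {i. i < n \<and> t \<le> card {c \<in> {w * j..<w * Suc j}. \<exists>r. r div w = i
          \<and> (r, c) \<in> P\<inverse>}}"
        by (rule card_image_le) simp
      also have "\<dots> \<le> t * 2 ^ w" by (rule wide_blocks_bound[OF no' t w])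
      finally show "card ((\<lambda>i. (j, i)) ` {i. i < n \<and> t \<le> card {c \<in> {w * j..<w * Suc j}. \<exists>r. r
          div w = i \<and> (r, c) \<in> P\<inverse>}}) \<le> t * 2 ^ w" .
    qed
    finally show ?thesis by simp
  qed
  have small: "card (blk z) \<le> (t - 1) * (t - 1)" if "z \<in> Q - (W \<union> T)" for z
    by (rule block_card_le[of _ "{w * fst z..<w * Suc (fst z)}" "{w * snd z..<w * Suc (snd z)}"])
       (use that in \<open>auto simp: W_def T_def blk_def\<close>)
  have "P \<subseteq> (\<Union>z\<in>Q. blk z)"
  proof
    fix p assume p: "p \<in> P"
    obtain r c where rc: "p = (r, c)" by force
    have "r \<in> {w * (r div w)..<w * Suc (r div w)}" "c \<in> {w * (c div w)..<w * Suc (c div w)}"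
      using divw by blast+
    then have "p \<in> blk (r div w, c div w)" using p by (simp add: blk_def rc)
    moreover have "(r div w, c div w) \<in> Q" using p by (force simp: Q_def rc)
    ultimately show "p \<in> (\<Union>z\<in>Q. blk z)" by blast
  qed
  then have "card P \<le> card (\<Union>z\<in>Q. blk z)"
    by (intro card_mono) (use finQ finP in \<open>auto simp: blk_def\<close>)
  also have "\<dots> \<le> (\<Sum>z\<in>Q. card (blk z))" by (rule card_UN_le[OF finQ])
  also have "\<dots> = (\<Sum>z\<in>Q - (W \<union> T). card (blk z)) + (\<Sum>z\<in>W \<union> T. card (blk z))"
    by (rule sum.subset_diff) (use finQ in \<open>auto simp: W_def T_def\<close>)
  also have "\<dots> \<le> (\<Sum>z\<in>Q - (W \<union> T). (t - 1) * (t - 1)) + (\<Sum>z\<in>W \<union> T. w * w)"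
    by (intro add_mono sum_mono small blk_le)
  also have "\<dots> \<le> (t - 1) * (t - 1) * card Q + (2 * n * (t * 2 ^ w)) * (w * w)"
  proof -
    have "card (Q - (W \<union> T)) \<le> card Q" by (simp add: card_mono finQ)
    moreover have "card (W \<union> T) \<le> 2 * n * (t * 2 ^ w)"
      using card_Un_le[of W T] W T by linarith
    ultimately have "card (Q - (W \<union> T)) * ((t - 1) * (t - 1)) + card (W \<union> T) * (w * w)
        \<le> card Q * ((t - 1) * (t - 1)) + 2 * n * (t * 2 ^ w) * (w * w)"
      by (intro add_mono mult_le_mono1)
    then show ?thesis by (simp only: sum_constant of_nat_id mult.commute[of "card Q"])
  qed
  finally show "card P \<le> (t - 1) * (t - 1) * card Q + 2 * n * (t * 2 ^ w) * (w * w)" .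
qed

lemma Marcus_Tardos_power:
  fixes P :: "(nat \<times> nat) set" and t :: nat
  defines "w \<equiv> t * t"
  assumes t: "0 < t" and P: "P \<subseteq> {..<w ^ e} \<times> {..<w ^ e}" and no: "\<not> has_grid t P"
  shows "card P \<le> (2 * (t * 2 ^ w) * (w * w) + 1) * w ^ e"
  using P no
proof (induction e arbitrary: P)
  case 0
  then have "card P \<le> card {(0::nat, 0::nat)}" by (intro card_mono) auto
  then show ?case by simp
next
  case (Suc e)
  let ?D = "2 * (t * 2 ^ w) * (w * w)"
  let ?Q = "(\<lambda>(r, c). (r div w, c div w)) ` P"
  have P': "P \<subseteq> {..<w * w ^ e} \<times> {..<w * w ^ e}" using Suc.prems(1) by simp
  note st = Marcus_Tardos_step[OF t P'[unfolded w_def] Suc.prems(2), folded w_def]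
  have "card ?Q \<le> (?D + 1) * w ^ e" using Suc.IH st(2,3) by blast
  then have "card P \<le> (t - 1) * (t - 1) * ((?D + 1) * w ^ e) + w ^ e * ?D"
    by (intro order_trans[OF st(1)] add_mono mult_le_mono2) (simp_all add: mult_ac)
  also have "\<dots> \<le> ((t - 1) * (t - 1) + 1) * ((?D + 1) * w ^ e)" by (simp add: algebra_simps)
  \<comment> \<open>The induction closes because (t - 1)^2 + 1 is at most w = t^2.\<close>
  also have "\<dots> \<le> w * ((?D + 1) * w ^ e)"
  proof (rule mult_le_mono1)
    obtain u where "t = Suc u" using t gr0_conv_Suc by blast
    then show "(t - 1) * (t - 1) + 1 \<le> w" by (simp add: w_def)
  qed
  finally show ?case by (simp add: algebra_simps)
qed

theorem Marcus_Tardos: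
  assumes "0 < t"
  obtains C :: nat where
    "\<And>n P. \<lbrakk>P \<subseteq> {..<n} \<times> {..<n}; C * n < card P\<rbrakk> \<Longrightarrow> has_grid t P"
proof -
  \<comment> \<open>With t + 1 in place of t the base w exceeds 1 even for t = 1, so n can be
    rounded up to a power of w at the cost of a factor w.\<close>
  define t' where "t' = t + 1"
  define w where "w = t' * t'"
  define D where "D = 2 * (t' * 2 ^ w) * (w * w) + 1"
  have w1: "2 \<le> w" using assms mult_le_mono[of 2 t' 2 t'] by (simp add: w_def t'_def)
  show ?thesis
  proof (rule that[of "D * w"])
    fix n and P :: "(nat \<times> nat) set"
    assume P: "P \<subseteq> {..<n} \<times> {..<n}" and large: "D * w * n < card P"
    have "n \<noteq> 0" using P large by (cases "n = 0") auto
    then obtain e where e: "w ^ e \<le> n" "n < w ^ Suc e"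
      using ex_power_ivl1[OF w1, of n] by auto
    show "has_grid t P"
    proof (rule ccontr)
      assume "\<not> has_grid t P"
      then have "\<not> has_grid t' P" using has_grid_mono[of t' P t] by (auto simp: t'_def)
      moreover have "P \<subseteq> {..<w ^ Suc e} \<times> {..<w ^ Suc e}" using P e(2) by fastforce
      ultimately have "card P \<le> D * w ^ Suc e"
        using Marcus_Tardos_power[of t' P "Suc e"] unfolding D_def w_def t'_def by simp
      also have "\<dots> \<le> D * w * n" using e(1) by simp
      finally show False using large by simp
    qed
  qed
qed

subsection \<open>Realising patterns by linear algebra\<close>

lemma bit_add_self [simp]: "a + a = 0" for a :: bit
  by (cases a) simp_all

text \<open>Induction on t: some vector is orthogonal to all earlier \<open>v i\<close> but not to
  the new one, and a multiple of it corrects the last coordinate. In matrix terms, independent rows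
  define a surjective map.\<close>

lemma independent_imp_dual_solution:
  fixes v :: "nat \<Rightarrow> 'b \<Rightarrow> 'a::field"
  assumes J: "finite J"
    and "\<forall>u. (\<exists>i<t. u i \<noteq> 0) \<longrightarrow> (\<exists>c\<in>J. (\<Sum>i<t. u i * v i c) \<noteq> 0)"
  shows "\<exists>y. \<forall>i<t. (\<Sum>c\<in>J. v i c * y c) = n i"
  using assms(2)
proof (induction t arbitrary: n)
  case 0
  then show ?case by simp
next
  case (Suc t)
  define p where "p i y = (\<Sum>c\<in>J. v i c * y c)" for i y
  have IH: "\<exists>y. \<forall>i<t. p i y = n i" for n
    unfolding p_def
  proof (rule Suc.IH, intro allI impI)
    fix u :: "nat \<Rightarrow> 'a"
    assume "\<exists>i<t. u i \<noteq> 0"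
    then have "\<exists>i<Suc t. (u(t := 0)) i \<noteq> 0" by (auto intro: less_SucI)
    with Suc.prems have "\<exists>c\<in>J. (\<Sum>i<Suc t. (u(t := 0)) i * v i c) \<noteq> 0" by blast
    then show "\<exists>c\<in>J. (\<Sum>i<t. u i * v i c) \<noteq> 0" by simp
  qed
  obtain e where e: "\<And>l i. i < t \<Longrightarrow> p i (e l) = (if i = l then 1 else 0)"
    using IH[of "\<lambda>i. if i = l then 1 else 0" for l] by metis
  \<comment> \<open>These coefficients subtract from \<open>v t\<close> its components along the
    \<open>v i\<close>, read off by the dual vectors \<open>e i\<close>; independence gives a
    coordinate c0 at which the result is nonzero.\<close>
  define u where "u i = (if i = t then 1 else - p t (e i))" for i
  have "\<exists>i<Suc t. u i \<noteq> 0" by (intro exI[of _ t]) (simp add: u_def)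
  with Suc.prems obtain c0 where c0: "c0 \<in> J" "(\<Sum>i<Suc t. u i * v i c0) \<noteq> 0" by blast
  \<comment> \<open>The unit vector at c0 made orthogonal to the first t vectors. Its product with
    \<open>v t\<close> is exactly the nonzero combination at c0.\<close>
  define z where "z c = (if c = c0 then 1 else 0) - (\<Sum>l<t. v l c0 * e l c)" for c
  have pz: "p i z = v i c0 - (\<Sum>l<t. v l c0 * p i (e l))" for i
  proof -
    have "p i z = (\<Sum>c\<in>J. v i c * (if c = c0 then 1 else 0)) - (\<Sum>c\<in>J. \<Sum>l<t. v l c0 * (v i c * e l
        c))"
      unfolding p_def z_def
      by (simp add: right_diff_distrib sum_subtractf sum_distrib_left mult.left_commute)
    also have "(\<Sum>c\<in>J. v i c * (if c = c0 then 1 else 0)) = v i c0"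
      using J c0(1) by (simp add: if_distrib[of "\<lambda>x. _ * x"] sum.delta' cong: if_cong)
    also have "(\<Sum>c\<in>J. \<Sum>l<t. v l c0 * (v i c * e l c)) = (\<Sum>l<t. v l c0 * p i (e l))"
      unfolding p_def by (subst sum.swap) (simp add: sum_distrib_left)
    finally show ?thesis .
  qed
  have z0: "p i z = 0" if "i < t" for i
    unfolding pz using e[OF that] that
    by (simp add: if_distrib[of "\<lambda>x. _ * x"] sum.delta' cong: if_cong)
  have zt: "p t z \<noteq> 0"
    using c0(2) unfolding pz u_def by (simp add: sum_negf mult.commute)
  obtain y0 where y0: "\<forall>i<t. p i y0 = n i" using IH by blast
  define a where "a = (n t - p t y0) / p t z"
  have lin: "p i (\<lambda>c. y0 c + a * z c) = p i y0 + a * p i z" for i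
    unfolding p_def by (simp add: distrib_left sum.distrib sum_distrib_left mult.left_commute)
  have "p i (\<lambda>c. y0 c + a * z c) = n i" if "i < Suc t" for i
  proof (cases "i < t")
    case True
    then show ?thesis unfolding lin using y0 z0 by simp
  next
    case False
    then have "i = t" using that by simp
    have "p i (\<lambda>c. y0 c + a * z c) = p t y0 + a * p t z" using lin \<open>i = t\<close> by simp
    then show ?thesis using zt \<open>i = t\<close> by (simp add: a_def)
  qed
  then show ?case unfolding p_def by (intro exI[of _ "\<lambda>c. y0 c + a * z c"]) simp
qed

section \<open>Independent row sums by counting cosets\<close>

definition row_sum :: "(nat \<Rightarrow> 'b \<Rightarrow> bit) \<Rightarrow> nat set \<Rightarrow> 'b \<Rightarrow> bit" where
  "row_sum e x c = (\<Sum>r\<in>x. e r c)"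

text \<open>Sets of rows under symmetric difference form a vector space over F_2, on which
  \<open>row_sum\<close> is linear.\<close>

lemma row_sum_sym_diff:
  assumes "finite x" "finite y"
  shows "row_sum e ((x - y) \<union> (y - x)) c = row_sum e x c + row_sum e y c"
proof -
  have x: "row_sum e x c = row_sum e (x - y) c + row_sum e (x \<inter> y) c" if "finite x" for x y
    unfolding row_sum_def using sum.Int_Diff[OF that, of "\<lambda>r. e r c" y] by (simp add: add.commute)
  have "row_sum e ((x - y) \<union> (y - x)) c = row_sum e (x - y) c + row_sum e (y - x) c"
    unfolding row_sum_def using assms by (intro sum.union_disjoint) auto
  also have "\<dots> = row_sum e (x - y) c + row_sum e (y - x) c + (row_sum e (x \<inter> y) c + row_sum e (x
      \<inter> y) c)"
    by (simp only: bit_add_self add_0_right)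
  also have "\<dots> = row_sum e x c + row_sum e y c"
    unfolding x[OF assms(1), of y] x[OF assms(2), of x] by (simp only: Int_commute[of y x] add_ac)
  finally show ?thesis .
qed

definition separated :: "(nat \<Rightarrow> 'b \<Rightarrow> bit) \<Rightarrow> nat \<Rightarrow> nat set \<Rightarrow> 'b set \<Rightarrow> bool" where
  "separated e m F J \<longleftrightarrow> (\<exists>xs. (\<forall>l<m. xs l \<subseteq> F) \<and>
     (\<forall>l<m. \<forall>l'<m. l \<noteq> l' \<longrightarrow> (\<exists>c\<in>J. row_sum e (xs l) c \<noteq> row_sum e (xs l') c)))"

text \<open>The sets \<open>xs l\<close> lie in distinct cosets of the kernel of \<open>row_sum e\<close> restricted to \<open>J\<close>.\<close>

lemma separated_fibre_card:
  assumes "finite F" and "separated e m F J"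
  shows "m * card {x \<in> Pow F. \<forall>c\<in>J. row_sum e x c = w c} \<le> 2 ^ card F"
proof -
  obtain xs where xs: "\<And>l. l < m \<Longrightarrow> xs l \<subseteq> F"
    and sep: "\<And>l l'. l < m \<Longrightarrow> l' < m \<Longrightarrow> l \<noteq> l' \<Longrightarrow>
      \<exists>c\<in>J. row_sum e (xs l) c \<noteq> row_sum e (xs l') c"
    using assms(2) unfolding separated_def by blast
  define D where "D = {x \<in> Pow F. \<forall>c\<in>J. row_sum e x c = w c}"
  define g where "g = (\<lambda>(l, x). (xs l - x) \<union> (x - xs l))"
  have fin: "finite x" if "x \<subseteq> F" for x using that assms(1) by (rule finite_subset)
  have sum_g: "row_sum e (g (l, x)) c = row_sum e (xs l) c + w c" if "l < m" "x \<in> D" "c \<in> J" for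
      l x c
    using that fin[OF xs] fin[of x] unfolding g_def D_def by (simp add: row_sum_sym_diff)
  \<comment> \<open>Translating the fibre by \<open>xs l\<close> shifts its row sums on J by those
    of \<open>xs l\<close>, so the translates for different l are disjoint inside
    \<open>Pow F\<close>.\<close>
  have "inj_on g ({..<m} \<times> D)"
  proof (rule inj_onI, clarify)
    fix l x l' x'
    assume l: "l < m" "l' < m" and x: "x \<in> D" "x' \<in> D" and eq: "g (l, x) = g (l', x')"
    have "row_sum e (xs l) c = row_sum e (xs l') c" if "c \<in> J" for c
      using sum_g[OF l(1) x(1) that] sum_g[OF l(2) x(2) that] eq by simp
    then have "l = l'" using sep[OF l] by blast
    moreover from this eq have "x = x'" unfolding g_def by auto
    ultimately show "l = l' \<and> x = x'" by simp
  qed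
  moreover have "g ` ({..<m} \<times> D) \<subseteq> Pow F"
    using xs unfolding g_def D_def by force
  ultimately have "card ({..<m} \<times> D) \<le> card (Pow F)"
    using assms(1) by (intro card_inj_on_le) auto
  then show ?thesis using assms(1) by (simp add: card_cartesian_product card_Pow D_def)
qed

text \<open>The sets are chosen one after another. A candidate for \<open>x k\<close> is bad if on
  some \<open>J j\<close> its row sum equals one of the 2^k sums of earlier sets; each such fibre
  makes up at most 1/m of \<open>Pow (F k)\<close>, so n * 2^k of them cannot exhaust it. One choice
  thus serves all column groups at once.\<close>

lemma exists_independent_row_sums:
  assumes fin: "\<And>i. i < t \<Longrightarrow> finite (F i)"
    and sep: "\<And>i j. \<lbrakk>i < t; j < n\<rbrakk> \<Longrightarrow> separated e m (F i) (J j)"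
    and m: "n * 2 ^ t < m"
  shows "k \<le> t \<Longrightarrow> \<exists>x. (\<forall>i<k. x i \<subseteq> F i) \<and> (\<forall>j<n. \<forall>u. (\<exists>i<k. u i \<noteq> 0) \<longrightarrow>
    (\<exists>c\<in>J j. (\<Sum>i<k. u i * row_sum e (x i) c) \<noteq> 0))"
proof (induction k)
  case 0
  then show ?case by simp
next
  case (Suc k)
  have k: "k < t" "k \<le> t" using Suc.prems by simp_all
  obtain x where x: "\<forall>i<k. x i \<subseteq> F i"
    and ind: "\<forall>j<n. \<forall>u. (\<exists>i<k. u i \<noteq> 0) \<longrightarrow>
      (\<exists>c\<in>J j. (\<Sum>i<k. u i * row_sum e (x i) c) \<noteq> 0)"
    using Suc.IH[OF k(2)] by (elim exE conjE)
  note k = k(1)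
  define B where "B j s = {z \<in> Pow (F k). \<forall>c\<in>J j. row_sum e z c = (\<Sum>i\<in>s. row_sum e (x i) c)}"
      for j s
  have finB: "finite (B j s)" for j s unfolding B_def using fin[OF k] by simp
  have B: "m * card (B j s) \<le> 2 ^ card (F k)" if "j < n" for j s
    unfolding B_def by (rule separated_fibre_card[OF fin[OF k] sep[OF k that]])
  let ?I = "{..<n} \<times> Pow {..<k}"
  have "m * card (\<Union>(j, s)\<in>?I. B j s) \<le> m * (\<Sum>(j, s)\<in>?I. card (B j s))"
    by (intro mult_le_mono2) (use card_UN_le[of ?I "\<lambda>(j, s). B j s"] in \<open>simp add:
        case_prod_unfold\<close>)
  also have "\<dots> = (\<Sum>(j, s)\<in>?I. m * card (B j s))" by (simp add: sum_distrib_left case_prod_unfold)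
  also have "\<dots> \<le> (\<Sum>(j, s)\<in>?I. 2 ^ card (F k))" by (intro sum_mono) (use B in auto)
  also have "\<dots> = n * 2 ^ k * 2 ^ card (F k)" by (simp add: card_cartesian_product card_Pow)
  also have "\<dots> < m * 2 ^ card (F k)"
  proof -
    have "n * 2 ^ k \<le> n * (2::nat) ^ t" using k by (intro mult_le_mono2 power_increasing) auto
    then have "n * 2 ^ k < m" using m by linarith
    then show ?thesis by (rule mult_strict_right_mono) simp
  qed
  finally have "card (\<Union>(j, s)\<in>?I. B j s) < card (Pow (F k))"
    using fin[OF k] by (simp add: card_Pow)
  moreover have "finite (\<Union>(j, s)\<in>?I. B j s)" by (auto simp: finB)
  ultimately have "\<not> Pow (F k) \<subseteq> (\<Union>(j, s)\<in>?I. B j s)"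
    using card_mono[of "\<Union>(j, s)\<in>?I. B j s" "Pow (F k)"] by (meson not_less)
  then obtain z where z: "z \<in> Pow (F k)" "z \<notin> (\<Union>(j, s)\<in>?I. B j s)" by blast
  have new: "\<exists>c\<in>J j. row_sum e z c \<noteq> (\<Sum>i\<in>s. row_sum e (x i) c)" if "j < n" "s \<subseteq> {..<k}" for j s
    using z that unfolding B_def by blast
  show ?case
  proof (intro exI[of _ "x(k := z)"] conjI allI impI)
    fix i assume "i < Suc k"
    then show "(x(k := z)) i \<subseteq> F i" using x z(1) by (auto simp: less_Suc_eq)
  next
    fix j and u :: "nat \<Rightarrow> bit"
    assume j: "j < n" and u: "\<exists>i<Suc k. u i \<noteq> 0"
    have split: "(\<Sum>i<Suc k. u i * row_sum e ((x(k := z)) i) c)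
      = (\<Sum>i<k. u i * row_sum e (x i) c) + u k * row_sum e z c" for c by simp
    show "\<exists>c\<in>J j. (\<Sum>i<Suc k. u i * row_sum e ((x(k := z)) i) c) \<noteq> 0"
    proof (cases "u k = 0")
      case True
      then have "\<exists>i<k. u i \<noteq> 0" using u by (metis less_Suc_eq)
      with ind j have "\<exists>c\<in>J j. (\<Sum>i<k. u i * row_sum e (x i) c) \<noteq> 0" by simp
      then show ?thesis using True unfolding split by simp
    next
      case False
      have eq: "(\<Sum>i<k. u i * row_sum e (x i) c) = (\<Sum>i\<in>{i. i < k \<and> u i = 1}. row_sum e (x i) c)"
          for c
        by (rule sum.mono_neutral_cong_right) auto
      obtain c where c: "c \<in> J j"
        "row_sum e z c \<noteq> (\<Sum>i\<in>{i. i < k \<and> u i = 1}. row_sum e (x i) c)"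
        using new[OF j, of "{i. i < k \<and> u i = 1}"] by blast
      have "a + b \<noteq> 0" if "b \<noteq> a" for a b :: bit
        using that by (metis add.assoc add_0_left add_0_right bit_add_self)
      then have "(\<Sum>i<Suc k. u i * row_sum e ((x(k := z)) i) c) \<noteq> 0"
        unfolding split eq using c(2) False by simp
      then show ?thesis using c(1) by blast
    qed
  qed
qed

text \<open>Since the row sets are independent on every \<open>J j\<close>, the column sets can be
  found for each j separately; over F_2 a solution vector is the indicator of a set of
  columns.\<close>

theorem separated_imp_all_patterns:
  assumes fin: "\<And>i. i < t \<Longrightarrow> finite (F i)" "\<And>j. j < n \<Longrightarrow> finite (J j)"
    and sep: "\<And>i j. \<lbrakk>i < t; j < n\<rbrakk> \<Longrightarrow> separated e m (F i) (J j)"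
    and m: "n * 2 ^ t < m"
  shows "\<exists>x y. (\<forall>i<t. x i \<subseteq> F i) \<and> (\<forall>j<n. y j \<subseteq> J j) \<and>
    (\<forall>i<t. \<forall>j<n. (\<Sum>r\<in>x i. \<Sum>c\<in>y j. e r c) = N i j)"
proof -
  have "\<exists>x. (\<forall>i<t. x i \<subseteq> F i) \<and> (\<forall>j<n. \<forall>u. (\<exists>i<t. u i \<noteq> 0) \<longrightarrow>
      (\<exists>c\<in>J j. (\<Sum>i<t. u i * row_sum e (x i) c) \<noteq> 0))"
    by (rule exists_independent_row_sums[of t F n e m J t]) (simp_all add: fin sep m)
  then obtain x where x: "\<forall>i<t. x i \<subseteq> F i"
    and ind: "\<forall>j<n. \<forall>u. (\<exists>i<t. u i \<noteq> 0) \<longrightarrow>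
      (\<exists>c\<in>J j. (\<Sum>i<t. u i * row_sum e (x i) c) \<noteq> 0)"
    by (elim exE conjE)
  have "\<exists>y. \<forall>i<t. (\<Sum>c\<in>J j. row_sum e (x i) c * y c) = N i j" if "j < n" for j
    by (rule independent_imp_dual_solution[OF fin(2)[OF that] ind[THEN spec, THEN mp, OF that]])
  then have "\<forall>j. \<exists>y. j < n \<longrightarrow> (\<forall>i<t. (\<Sum>c\<in>J j. row_sum e (x i) c * y c) = N i j)" by blast
  from choice[OF this] obtain y
    where y: "\<forall>j. j < n \<longrightarrow> (\<forall>i<t. (\<Sum>c\<in>J j. row_sum e (x i) c * y j c) = N i j)" by (elim exE)
  have "(\<Sum>r\<in>x i. \<Sum>c\<in>{c \<in> J j. y j c = 1}. e r c) = N i j" if "i < t" "j < n" for i j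
  proof -
    have "(\<Sum>r\<in>x i. \<Sum>c\<in>{c \<in> J j. y j c = 1}. e r c) = (\<Sum>c\<in>{c \<in> J j. y j c = 1}. row_sum e (x i) c)"
      unfolding row_sum_def by (rule sum.swap)
    also have "\<dots> = (\<Sum>c\<in>J j. row_sum e (x i) c * y j c)"
      by (rule sum.mono_neutral_cong_left) (use fin(2)[OF that(2)] in auto)
    also have "\<dots> = N i j" using y that by blast
    finally show ?thesis .
  qed
  then show ?thesis using x by (intro exI[of _ x] exI[of _ "\<lambda>j. {c \<in> J j. y j c = 1}"]) auto
qed

subsection \<open>Rich divisions\<close>

lemma ordered_blocks_subset:
  assumes "ordered_blocks t X" and "\<And>i. i < t \<Longrightarrow> Y i \<subseteq> X i"
  shows "ordered_blocks t Y"
  unfolding ordered_blocks_def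
proof (intro allI impI ballI)
  fix i j a b
  assume ij: "i < j" "j < t" and "a \<in> Y i" "b \<in> Y j"
  then have "a \<in> X i" "b \<in> X j" using assms(2)[of i] assms(2)[of j] by auto
  then show "a < b" by (rule ordered_blocksD[OF assms(1) ij])
qed

definition row_trace :: "('a \<Rightarrow> 'b \<Rightarrow> bit) \<Rightarrow> 'b set \<Rightarrow> 'a \<Rightarrow> 'b set" where
  "row_trace e Y r = {c \<in> Y. e r c = 1}"

lemma row_trace_eq_iff: "row_trace e Y r = row_trace e Y r' \<longleftrightarrow> (\<forall>c\<in>Y. e r c = e r' c)"
proof -
  have "a = b \<longleftrightarrow> (a = 1 \<longleftrightarrow> b = 1)" for a b :: bit by (cases a; cases b) simp_all
  then show ?thesis unfolding row_trace_def by blast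
qed

text \<open>Column block \<open>b\<close> is fresh if a difference of two rows in \<open>X\<close> has its first nonzero entry
  there, where the blocks in \<open>H\<close> are ignored.\<close>

definition fresh_block ::
    "(nat \<Rightarrow> nat \<Rightarrow> bit) \<Rightarrow> nat set \<Rightarrow> (nat \<Rightarrow> nat) \<Rightarrow> nat set \<Rightarrow> nat set \<Rightarrow> nat \<Rightarrow> bool" where
  "fresh_block e D g X H b \<longleftrightarrow> (\<exists>r\<in>X. \<exists>r'\<in>X.
     (\<forall>c\<in>D. g c < b \<longrightarrow> g c \<notin> H \<longrightarrow> e r c = e r' c) \<and> (\<exists>c\<in>D. g c = b \<and> e r c \<noteq> e r' c))"

text \<open>Such a block separates X by single rows and so counts as a success by itself; on every
  other block X has fewer than s traces.\<close>

definition heavy_blocks ::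
    "(nat \<Rightarrow> nat \<Rightarrow> bit) \<Rightarrow> nat set \<Rightarrow> (nat \<Rightarrow> nat) \<Rightarrow> nat \<Rightarrow> nat set \<Rightarrow> nat set" where
  "heavy_blocks e D g s X = {b \<in> g ` D. s \<le> card (row_trace e {c \<in> D. g c = b} ` X)}"

text \<open>Discard the heavy blocks, at most k in number if the claim fails. The first remaining
  block in which two rows differ is fresh, so a row is determined on the rest by its traces on at
  most k fresh blocks, each with fewer than s values; that leaves at most s^k traces.\<close>

lemma many_fresh_or_heavy_blocks:
  assumes D: "finite D" and X: "finite X" and s: "0 < s"
    and rich: "\<And>Z. \<lbrakk>Z \<subseteq> D; card (g ` Z) \<le> k\<rbrakk> \<Longrightarrow> s ^ k < card (row_trace e (D - Z) ` X)"
  shows "k < card {b \<in> g ` D. b \<in> heavy_blocks e D g s X \<or>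
    fresh_block e D g X (heavy_blocks e D g s X) b}"
proof (rule ccontr)
  define H where "H = heavy_blocks e D g s X"
  define O' where "O' = {b \<in> g ` D. b \<notin> H \<and> fresh_block e D g X H b}"
  assume "\<not> ?thesis"
  then have le: "card {b \<in> g ` D. b \<in> H \<or> fresh_block e D g X H b} \<le> k" by (simp add: H_def)
  have Hsub: "H \<subseteq> g ` D" by (auto simp: H_def heavy_blocks_def)
  have fin: "finite {b \<in> g ` D. b \<in> H \<or> fresh_block e D g X H b}" using D by simp
  have cH: "card H \<le> k" and cO: "card O' \<le> k" and finO: "finite O'"
  proof -
    have "H \<subseteq> {b \<in> g ` D. b \<in> H \<or> fresh_block e D g X H b}" using Hsub by blast
    then show "card H \<le> k" using le card_mono[OF fin] le_trans by blast
    have "O' \<subseteq> {b \<in> g ` D. b \<in> H \<or> fresh_block e D g X H b}" unfolding O'_def by blast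
    then show "card O' \<le> k" "finite O'" using le card_mono[OF fin] le_trans finite_subset[OF _ fin]
      by blast+
  qed
  define Z where "Z = {c \<in> D. g c \<in> H}"
  have "g ` Z \<subseteq> H" by (auto simp: Z_def)
  then have "card (g ` Z) \<le> k"
    using cH card_mono[of H "g ` Z"] finite_subset[OF Hsub] D by (meson finite_imageI le_trans)
  then have large: "s ^ k < card (row_trace e (D - Z) ` X)" by (intro rich) (auto simp: Z_def)
  define f where "f r = restrict (\<lambda>b. row_trace e {c \<in> D. g c = b} r) O'" for r
  have key: "e r c = e r' c" if r: "r \<in> X" "r' \<in> X" and f: "f r = f r'" and c: "c \<in> D - Z" for r
      r' c
  proof (rule ccontr)
    assume "e r c \<noteq> e r' c"
    define S where "S = {c \<in> D - Z. e r c \<noteq> e r' c}"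
    have "c \<in> S" using c \<open>e r c \<noteq> e r' c\<close> by (simp add: S_def)
    then obtain c0 where c0: "c0 \<in> S" and min: "\<And>c. c \<in> S \<Longrightarrow> g c0 \<le> g c"
      using ex_has_least_nat[of "\<lambda>c. c \<in> S" c g] by blast
    have "e r c = e r' c" if "c \<in> D" "g c < g c0" "g c \<notin> H" for c
    proof (rule ccontr)
      assume "e r c \<noteq> e r' c"
      then have "c \<in> S" using that by (simp add: S_def Z_def)
      then show False using min[of c] that by simp
    qed
    moreover have "\<exists>c\<in>D. g c = g c0 \<and> e r c \<noteq> e r' c" using c0 by (auto simp: S_def)
    ultimately have "fresh_block e D g X H (g c0)"
      unfolding fresh_block_def by (intro bexI[OF _ r(1)] bexI[OF _ r(2)] conjI ballI impI)
    then have "g c0 \<in> O'" using c0 unfolding O'_def S_def Z_def by blast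
    then have "row_trace e {c \<in> D. g c = g c0} r = row_trace e {c \<in> D. g c = g c0} r'"
      using fun_cong[OF f, of "g c0"] by (simp add: f_def)
    then show False using c0 unfolding row_trace_eq_iff by (auto simp: S_def)
  qed
  have "card (row_trace e (D - Z) ` X) \<le> card (f ` X)"
  proof -
    have "row_trace e (D - Z) ` X \<subseteq> (\<lambda>u. row_trace e (D - Z) (SOME r. r \<in> X \<and> f r = u)) ` f ` X"
    proof
      fix w assume "w \<in> row_trace e (D - Z) ` X"
      then obtain r where r: "r \<in> X" "w = row_trace e (D - Z) r" by blast
      define r' where "r' = (SOME r'. r' \<in> X \<and> f r' = f r)"
      have r': "r' \<in> X \<and> f r' = f r" unfolding r'_def by (rule someI[of _ r]) (use r in simp)
      then have "w = row_trace e (D - Z) r'"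
        unfolding r(2) row_trace_eq_iff using key[of r r'] r(1) by simp
      then show "w \<in> (\<lambda>u. row_trace e (D - Z) (SOME r. r \<in> X \<and> f r = u)) ` f ` X"
        using r(1) unfolding r'_def by blast
    qed
    then show ?thesis
      by (meson X card_image_le card_mono finite_imageI le_trans)
  qed
  also have "\<dots> \<le> card (\<Pi>\<^sub>E b\<in>O'. row_trace e {c \<in> D. g c = b} ` X)"
    by (intro card_mono finite_PiE finO) (auto simp: f_def X)
  also have "\<dots> = (\<Prod>b\<in>O'. card (row_trace e {c \<in> D. g c = b} ` X))" by (rule card_PiE[OF finO])
  also have "\<dots> \<le> (\<Prod>b\<in>O'. s)"
    by (intro prod_mono) (auto simp: O'_def H_def heavy_blocks_def not_le)
  also have "\<dots> \<le> s ^ k" using cO s by (simp add: power_increasing)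
  finally show False using large by simp
qed

lemma obtain_distinct_values:
  assumes "finite X" and "s \<le> card (f ` X)"
  shows "\<exists>r. (\<forall>l<s. r l \<in> X) \<and> (\<forall>l<s. \<forall>l'<s. l \<noteq> l' \<longrightarrow> f (r l) \<noteq> f (r l'))"
proof -
  obtain S where S: "S \<subseteq> f ` X" "card S = s" "finite S"
    using obtain_subset_with_card_n[OF assms(2)] by blast
  obtain b where b: "bij_betw b {0..<s} S" using ex_bij_betw_nat_finite[OF S(3)] S(2) by blast
  have "\<exists>r. r \<in> X \<and> f r = b l" if "l < s" for l
  proof -
    have "b l \<in> S" using bij_betwE[OF b] that by simp
    then have "b l \<in> f ` X" by (rule subsetD[OF S(1)])
    then show ?thesis by (rule imageE) (intro exI conjI, assumption, simp)
  qed
  then have "\<forall>l. \<exists>r. l < s \<longrightarrow> r \<in> X \<and> f r = b l" by simp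
  from choice[OF this] obtain r where r: "\<forall>l. l < s \<longrightarrow> r l \<in> X \<and> f (r l) = b l" by (elim exE)
  have "f (r l) \<noteq> f (r l')" if "l < s" "l' < s" "l \<noteq> l'" for l l'
    using r that bij_betw_imp_inj_on[OF b] by (auto simp: inj_on_eq_iff)
  then show ?thesis using r by (intro exI[of _ r]) simp
qed

lemma separated_heavy:
  assumes "finite X" and "X \<subseteq> F" and "Y \<subseteq> J" and "s \<le> card (row_trace e Y ` X)"
  shows "separated e s F J"
proof -
  obtain r where r: "\<forall>l<s. r l \<in> X"
    and d: "\<forall>l<s. \<forall>l'<s. l \<noteq> l' \<longrightarrow> row_trace e Y (r l) \<noteq> row_trace e Y (r l')"
    using obtain_distinct_values[OF assms(1,4)] by (elim exE conjE)
  have "\<exists>c\<in>J. row_sum e {r l} c \<noteq> row_sum e {r l'} c" if "l < s" "l' < s" "l \<noteq> l'" for l l'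
  proof -
    have "\<not> (\<forall>c\<in>Y. e (r l) c = e (r l') c)" using d that by (simp add: row_trace_eq_iff[symmetric])
    then show ?thesis using assms(3) by (auto simp: row_sum_def)
  qed
  then show ?thesis unfolding separated_def
    by (intro exI[of _ "\<lambda>l. {r l}"]) (use r assms(2) in auto)
qed

text \<open>Over F_2 the row sum of the pair \<open>r l\<close>, \<open>r' l\<close> is the
  difference of the two rows. In the columns \<open>c l\<close> these differences form a triangular
  matrix with ones on the diagonal, so no two coincide.\<close>

lemma separated_triangular:
  assumes r: "\<And>l. l < s \<Longrightarrow> r l \<in> F \<and> r' l \<in> F"
    and c: "\<And>l. l < s \<Longrightarrow> c l \<in> J \<and> e (r l) (c l) \<noteq> e (r' l) (c l)"
    and eq: "\<And>l l'. \<lbrakk>l < l'; l' < s\<rbrakk> \<Longrightarrow> e (r l') (c l) = e (r' l') (c l)"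
  shows "separated e s F J"
proof -
  have sum: "row_sum e {r l, r' l} d = e (r l) d + e (r' l) d" if "l < s" for l d
    using c[OF that] by (cases "r l = r' l") (auto simp: row_sum_def)
  have sep: "row_sum e {r l, r' l} (c l) \<noteq> row_sum e {r l', r' l'} (c l)" if "l < l'" "l' < s"
      for l l'
  proof -
    have "a + b = 1" if "a \<noteq> b" for a b :: bit using that by (cases a; cases b) simp_all
    then have "row_sum e {r l, r' l} (c l) = 1" using sum[of l] c[of l] that by simp
    moreover have "row_sum e {r l', r' l'} (c l) = 0" using sum[of l'] eq[OF that] that by simp
    ultimately show ?thesis by simp
  qed
  have "\<exists>d\<in>J. row_sum e {r l, r' l} d \<noteq> row_sum e {r l', r' l'} d"
    if "l < s" "l' < s" "l \<noteq> l'" for l l'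
  proof (cases "l < l'")
    case True
    then show ?thesis using sep[OF True that(2)] c[OF that(1)] by blast
  next
    case False
    then have "l' < l" using that by simp
    then show ?thesis using sep[OF \<open>l' < l\<close> that(1)] c[OF that(2)] by metis
  qed
  then show ?thesis unfolding separated_def
    by (intro exI[of _ "\<lambda>l. {r l, r' l}"]) (use r in auto)
qed

lemma ordered_blocks_vimage_subset:
  assumes "ordered_blocks t X" and "mono f"
  shows "ordered_blocks t (\<lambda>i. {r \<in> R. f r \<in> X i})"
  by (rule ordered_blocks_subset[OF ordered_blocks_vimage[OF assms]]) auto

lemma ordered_blocks_group:
  assumes "ordered_blocks m X" and "n * s \<le> m"
  shows "ordered_blocks n (\<lambda>j. \<Union>l<s. X (j * s + l))"
  unfolding ordered_blocks_def
proof (intro allI impI ballI)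
  fix i j a b
  assume ij: "i < j" "j < n" and a: "a \<in> (\<Union>l<s. X (i * s + l))" and b: "b \<in> (\<Union>l<s. X (j * s + l))"
  obtain l l' where l: "l < s" "a \<in> X (i * s + l)" and l': "l' < s" "b \<in> X (j * s + l')"
    using a b by blast
  have "i * s + l < Suc i * s" using l(1) by simp
  also have "\<dots> \<le> j * s" using ij(1) by (intro mult_le_mono1) simp
  finally have 1: "i * s + l < j * s + l'" by simp
  have "j * s + l' < Suc j * s" using l'(1) by simp
  also have "\<dots> \<le> n * s" using ij(2) by (intro mult_le_mono1) simp
  finally have 2: "j * s + l' < m" using assms(2) by simp
  show "a < b" by (rule ordered_blocksD[OF assms(1) 1 2 l(2) l'(2)])
qed

text \<open>Points (j, b) mark the intervals b that are fresh or heavy for part j, and a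
  Marcus-Tardos grid groups them. In a zone of t by n groups, one heavy interval separates s single
  rows; without one, the s column blocks of the group hold fresh intervals whose row differences are
  triangular.\<close>

theorem rich_division_imp_patterns:
  fixes t n :: nat
  obtains k q :: nat where
    "\<And>(e :: nat \<Rightarrow> nat \<Rightarrow> bit) R D (h :: nat \<Rightarrow> nat) (g :: nat \<Rightarrow> nat) m N.
      \<lbrakk>finite R; finite D; mono h; mono g; 0 < m; g ` D \<subseteq> {..<3 * m};
       \<And>j Z. \<lbrakk>j < m; Z \<subseteq> D; card (g ` Z) \<le> k\<rbrakk> \<Longrightarrow> q < card (row_trace e (D - Z) ` {r \<in> R. h r = j})\<rbrakk>
      \<Longrightarrow> \<exists>x y. ordered_blocks t x \<and> ordered_blocks n y \<and> (\<forall>i<t. x i \<subseteq> R) \<and> (\<forall>j<n. y j \<subseteq> D) \<and>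
          (\<forall>i<t. \<forall>j<n. (\<Sum>r\<in>x i. \<Sum>c\<in>y j. e r c) = N i j)"
proof -
  \<comment> \<open>The number of distinct row sums that \<open>separated_imp_all_patterns\<close>
    asks for.\<close>
  define s where "s = n * 2 ^ t + 1"
  \<comment> \<open>Each of the n column groups uses s blocks of the grid, one for each row
    difference; the final 1 makes T positive.\<close>
  define T where "T = t + n * s + 1"
  have "0 < T" by (simp add: T_def)
  then obtain C where C: "\<And>n P. \<lbrakk>P \<subseteq> {..<n} \<times> {..<n}; C * n < card P\<rbrakk> \<Longrightarrow> has_grid T P"
    using Marcus_Tardos by blast
  \<comment> \<open>The columns occupy up to 3 * m intervals, so Marcus-Tardos is applied in a
    square of side 3 * m, and each of the m parts must contribute more than 3 * C points.\<close>
  define k where "k = 3 * C"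
  show ?thesis
  proof (rule that[of k "s ^ k"])
    fix e :: "nat \<Rightarrow> nat \<Rightarrow> bit" and R D :: "nat set" and h g :: "nat \<Rightarrow> nat" and m
      and N :: "nat \<Rightarrow> nat \<Rightarrow> bit"
    assume fin: "finite R" "finite D" and mono: "mono h" "mono g" and m: "0 < m"
      and gD: "g ` D \<subseteq> {..<3 * m}"
      and rich: "\<And>j Z. \<lbrakk>j < m; Z \<subseteq> D; card (g ` Z) \<le> k\<rbrakk> \<Longrightarrow>
        s ^ k < card (row_trace e (D - Z) ` {r \<in> R. h r = j})"
    have s: "0 < s" by (simp add: s_def)
    define X where "X j = {r \<in> R. h r = j}" for j
    have finX: "finite (X j)" for j using fin by (simp add: X_def)
    define H where "H j = heavy_blocks e D g s (X j)" for j
    define one where "one j = {b \<in> g ` D. b \<in> H j \<or> fresh_block e D g (X j) (H j) b}" for j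
    have one: "k < card (one j)" if "j < m" for j
      unfolding one_def H_def
      by (rule many_fresh_or_heavy_blocks[OF fin(2) finX s]) (use rich[OF that] in \<open>simp add:
          X_def\<close>)
    define P where "P = (SIGMA j:{..<m}. one j)"
    have "P \<subseteq> {..<3 * m} \<times> {..<3 * m}" using gD by (auto simp: P_def one_def)
    moreover have "C * (3 * m) < card P"
    proof -
      have "card P = (\<Sum>j<m. card (one j))"
        unfolding P_def using fin by (intro card_SigmaI) (auto simp: one_def)
      also have "\<dots> \<ge> (\<Sum>j<m. k + 1)" by (intro sum_mono) (use one in force)
      finally have "m * (3 * C) + m \<le> card P" by (simp add: k_def algebra_simps)
      moreover have "C * (3 * m) = m * (3 * C)" by simp
      ultimately show ?thesis using m by linarith
    qed
    ultimately have "has_grid T P" by (rule C)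
    then obtain G J where G: "ordered_blocks T G" and J: "ordered_blocks T J"
      and grid: "\<forall>i<T. \<forall>j<T. P \<inter> G i \<times> J j \<noteq> {}" unfolding has_grid_def by (elim exE conjE)
    define F where "F i = {r \<in> R. h r \<in> G i}" for i
    define B where "B j = (\<Union>l<s. J (j * s + l))" for j
    define K where "K j = {c \<in> D. g c \<in> B j}" for j
    have F: "ordered_blocks t F" unfolding F_def
      by (rule ordered_blocks_vimage_subset[OF ordered_blocks_mono[OF G] mono(1)]) (simp add: T_def)
    have K: "ordered_blocks n K" unfolding K_def B_def
      by (rule ordered_blocks_vimage_subset[OF ordered_blocks_group[OF J] mono(2)]) (simp add:
          T_def)
    have sep: "separated e s (F i) (K j)" if ij: "i < t" "j < n" for i j
    proof (cases "\<exists>a b. a \<in> G i \<and> b \<in> B j \<and> a < m \<and> b \<in> H a")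
      case True
      then obtain a b where ab: "a \<in> G i" "b \<in> B j" "b \<in> H a" by blast
      show ?thesis
        by (rule separated_heavy[of "X a" _ "{c \<in> D. g c = b}"])
           (use ab finX in \<open>auto simp: X_def F_def K_def H_def heavy_blocks_def\<close>)
    next
      case False
      have pick: "\<exists>a b r r' c. a < m \<and> a \<in> G i \<and> b \<in> J (j * s + l) \<and> r \<in> X a \<and> r' \<in> X a \<and>
        (\<forall>c\<in>D. g c < b \<longrightarrow> g c \<notin> H a \<longrightarrow> e r c = e r' c) \<and> c \<in> D \<and> g c = b \<and> e r c \<noteq> e r' c"
        if l: "l < s" for l
      proof -
        have "j * s + l < Suc j * s" using l by simp
        also have "\<dots> \<le> n * s" using ij(2) by (intro mult_le_mono1) simp
        finally have "j * s + l < T" by (simp add: T_def)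
        moreover have "i < T" using ij by (simp add: T_def)
        ultimately obtain a b where ab: "(a, b) \<in> P" "a \<in> G i" "b \<in> J (j * s + l)"
          using grid by blast
        have "b \<in> B j" using ab(3) l by (auto simp: B_def)
        then have "fresh_block e D g (X a) (H a) b"
          using False ab by (auto simp: P_def one_def)
        then show ?thesis using ab unfolding fresh_block_def P_def by blast
      qed
      then have "\<forall>l. \<exists>a b r r' c. l < s \<longrightarrow> a < m \<and> a \<in> G i \<and> b \<in> J (j * s + l) \<and> r \<in> X a \<and> r' \<in> X a \<and>
        (\<forall>c\<in>D. g c < b \<longrightarrow> g c \<notin> H a \<longrightarrow> e r c = e r' c) \<and> c \<in> D \<and> g c = b \<and> e r c \<noteq> e r' c"
        by blast
      then obtain a b r r' c where w: "\<And>l. l < s \<Longrightarrow> a l < m \<and> a l \<in> G i \<and> b l \<in> J (j * s + l) \<and>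
        r l \<in> X (a l) \<and> r' l \<in> X (a l) \<and>
        (\<forall>c\<in>D. g c < b l \<longrightarrow> g c \<notin> H (a l) \<longrightarrow> e (r l) c = e (r' l) c) \<and>
        c l \<in> D \<and> g (c l) = b l \<and> e (r l) (c l) \<noteq> e (r' l) (c l)"
        by metis
      have bB: "b l \<in> B j" if "l < s" for l using w[OF that] that by (auto simp: B_def)
      show ?thesis
      proof (rule separated_triangular[of s r _ r' c])
        show "r l \<in> F i \<and> r' l \<in> F i" if "l < s" for l
          using w[OF that] by (simp add: F_def X_def)
        show "c l \<in> K j \<and> e (r l) (c l) \<noteq> e (r' l) (c l)" if "l < s" for l
          using w[OF that] bB[OF that] by (simp add: K_def)
        show "e (r l') (c l) = e (r' l') (c l)" if l: "l < l'" "l' < s" for l l'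
        proof -
          have ls: "l < s" using l by simp
          have "j * s + l' < Suc j * s" using l by simp
          also have "\<dots> \<le> n * s" using ij(2) by (intro mult_le_mono1) simp
          finally have T': "j * s + l' < T" by (simp add: T_def)
          have "b l < b l'"
            by (rule ordered_blocksD[OF J _ T', of "j * s + l"]) (use w[OF ls] w[OF l(2)] l in auto)
          \<comment> \<open>No interval in \<open>B j\<close> is heavy for a part in
            \<open>G i\<close>. So \<open>b l\<close> is not among the intervals ignored for the
            pair l', whose rows must agree there because \<open>b l < b l'\<close>.\<close>
          moreover have "b l \<notin> H (a l')" using False bB[OF ls] w[OF l(2)] by blast
          ultimately show ?thesis using w[OF l(2)] w[OF ls] by metis
        qed
      qed
    qed
    have "\<exists>x y. (\<forall>i<t. x i \<subseteq> F i) \<and> (\<forall>j<n. y j \<subseteq> K j) \<and>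
      (\<forall>i<t. \<forall>j<n. (\<Sum>r\<in>x i. \<Sum>c\<in>y j. e r c) = N i j)"
      by (rule separated_imp_all_patterns[OF _ _ sep]) (use fin in \<open>auto simp: F_def K_def s_def\<close>)
    then obtain x y where xy: "\<forall>i<t. x i \<subseteq> F i" "\<forall>j<n. y j \<subseteq> K j"
      "\<forall>i<t. \<forall>j<n. (\<Sum>r\<in>x i. \<Sum>c\<in>y j. e r c) = N i j" by (elim exE conjE)
    have "ordered_blocks t x" by (rule ordered_blocks_subset[OF F]) (use xy in simp)
    moreover have "ordered_blocks n y" by (rule ordered_blocks_subset[OF K]) (use xy in simp)
    moreover have "\<forall>i<t. x i \<subseteq> R" "\<forall>j<n. y j \<subseteq> D"
      using xy(1,2) by (fastforce simp: F_def K_def)+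
    ultimately show "\<exists>x y. ordered_blocks t x \<and> ordered_blocks n y \<and> (\<forall>i<t. x i \<subseteq> R) \<and>
      (\<forall>j<n. y j \<subseteq> D) \<and> (\<forall>i<t. \<forall>j<n. (\<Sum>r\<in>x i. \<Sum>c\<in>y j. e r c) = N i j)"
      using xy(3) by (intro exI conjI)
  qed
qed

subsection \<open>Parity minors as block sums\<close>

definition block_sums :: "bit mat \<Rightarrow> bit mat \<Rightarrow> (nat \<Rightarrow> nat set) \<Rightarrow> (nat \<Rightarrow> nat set) \<Rightarrow> bool" where
  "block_sums A N x y \<longleftrightarrow>
     ordered_blocks (dim_row N) x \<and> ordered_blocks (dim_col N) y \<and>
     (\<forall>i<dim_row N. x i \<subseteq> {..<dim_row A}) \<and> (\<forall>j<dim_col N. y j \<subseteq> {..<dim_col A}) \<and>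
     (\<forall>i<dim_row N. \<forall>j<dim_col N. N $$ (i, j) = (\<Sum>r\<in>x i. \<Sum>c\<in>y j. A $$ (r, c)))"

lemma ordered_blocks_UN:
  assumes "ordered_blocks t x" and "ordered_blocks n X" and "\<And>i. i < t \<Longrightarrow> x i \<subseteq> {..<n}"
  shows "ordered_blocks t (\<lambda>i. \<Union>r\<in>x i. X r)"
  unfolding ordered_blocks_def
proof (intro allI impI ballI)
  fix i j a b
  assume ij: "i < j" "j < t" and a: "a \<in> (\<Union>r\<in>x i. X r)" and b: "b \<in> (\<Union>r\<in>x j. X r)"
  obtain r s where r: "r \<in> x i" "a \<in> X r" and s: "s \<in> x j" "b \<in> X s" using a b by blast
  have "r < s" by (rule ordered_blocksD[OF assms(1) ij r(1) s(1)])
  moreover have "s < n" using assms(3)[OF ij(2)] s(1) by blast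
  ultimately show "a < b" by (rule ordered_blocksD[OF assms(2) _ _ r(2) s(2)])
qed

lemma sum_UN_blocks:
  assumes "ordered_blocks n X" and "x \<subseteq> {..<n}" and "\<And>r. r < n \<Longrightarrow> finite (X r)"
  shows "sum f (\<Union>r\<in>x. X r) = (\<Sum>r\<in>x. sum f (X r))"
proof (rule sum.UNION_disjoint)
  show "finite x" using assms(2) finite_subset by blast
  show "\<forall>r\<in>x. finite (X r)" using assms(2,3) by auto
  show "\<forall>r\<in>x. \<forall>s\<in>x. r \<noteq> s \<longrightarrow> X r \<inter> X s = {}"
    using assms(2) ordered_blocks_disjoint[OF assms(1)] by (simp add: subset_iff)
qed

lemma block_sums_trans:
  assumes "block_sums A B X Y" and "block_sums B N x y"
  shows "block_sums A N (\<lambda>i. \<Union>r\<in>x i. X r) (\<lambda>j. \<Union>c\<in>y j. Y c)"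
proof -
  have X: "ordered_blocks (dim_row B) X" "\<forall>r<dim_row B. X r \<subseteq> {..<dim_row A}"
    and Y: "ordered_blocks (dim_col B) Y" "\<forall>c<dim_col B. Y c \<subseteq> {..<dim_col A}"
    and B: "\<forall>r<dim_row B. \<forall>c<dim_col B. B $$ (r, c) = (\<Sum>r\<in>X r. \<Sum>c\<in>Y c. A $$ (r, c))"
    using assms(1) unfolding block_sums_def by simp_all
  have x: "ordered_blocks (dim_row N) x" "\<forall>i<dim_row N. x i \<subseteq> {..<dim_row B}"
    and y: "ordered_blocks (dim_col N) y" "\<forall>j<dim_col N. y j \<subseteq> {..<dim_col B}"
    and N: "\<forall>i<dim_row N. \<forall>j<dim_col N. N $$ (i, j) = (\<Sum>r\<in>x i. \<Sum>c\<in>y j. B $$ (r, c))"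
    using assms(2) unfolding block_sums_def by simp_all
  have finX: "finite (X r)" if "r < dim_row B" for r
    using X(2) that finite_subset finite_lessThan by metis
  have finY: "finite (Y c)" if "c < dim_col B" for c
    using Y(2) that finite_subset finite_lessThan by metis
  have sum: "N $$ (i, j) = (\<Sum>r\<in>(\<Union>r\<in>x i. X r). \<Sum>c\<in>(\<Union>c\<in>y j. Y c). A $$ (r, c))"
    if ij: "i < dim_row N" "j < dim_col N" for i j
  proof -
    have xi: "x i \<subseteq> {..<dim_row B}" and yj: "y j \<subseteq> {..<dim_col B}" using x y ij by auto
    have "(\<Sum>r\<in>(\<Union>r\<in>x i. X r). \<Sum>c\<in>(\<Union>c\<in>y j. Y c). A $$ (r, c))
      = (\<Sum>r\<in>x i. \<Sum>r'\<in>X r. \<Sum>c\<in>y j. \<Sum>c'\<in>Y c. A $$ (r', c'))"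
      by (simp add: sum_UN_blocks[OF X(1) xi finX] sum_UN_blocks[OF Y(1) yj finY])
    also have "\<dots> = (\<Sum>r\<in>x i. \<Sum>c\<in>y j. \<Sum>r'\<in>X r. \<Sum>c'\<in>Y c. A $$ (r', c'))"
      by (intro sum.cong refl sum.swap)
    also have "\<dots> = (\<Sum>r\<in>x i. \<Sum>c\<in>y j. B $$ (r, c))"
      using xi yj B by (intro sum.cong refl) (simp add: subset_iff)
    finally show ?thesis using N ij by simp
  qed
  show ?thesis
    unfolding block_sums_def
  proof (intro conjI allI impI)
    show "ordered_blocks (dim_row N) (\<lambda>i. \<Union>r\<in>x i. X r)"
      by (rule ordered_blocks_UN[OF x(1) X(1)]) (use x(2) in simp)
    show "ordered_blocks (dim_col N) (\<lambda>j. \<Union>c\<in>y j. Y c)"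
      by (rule ordered_blocks_UN[OF y(1) Y(1)]) (use y(2) in simp)
    show "(\<Union>r\<in>x i. X r) \<subseteq> {..<dim_row A}" if "i < dim_row N" for i
      using that x(2) X(2) by (fastforce simp: subset_iff)
    show "(\<Union>c\<in>y j. Y c) \<subseteq> {..<dim_col A}" if "j < dim_col N" for j
      using that y(2) Y(2) by (fastforce simp: subset_iff)
  qed (rule sum)
qed

section \<open>Parity operations as block sums\<close>

lemma pick_Compl_singleton: "pick (- {i}) r = (if r < i then r else Suc r)"
proof (induction r)
  case 0
  show ?case
    by (cases "i = 0") (auto intro!: Least_equality)
next
  case (Suc r)
  have "pick (- {i}) (Suc r) = (LEAST a. a \<noteq> i \<and> pick (- {i}) r < a)" by simp
  also have "\<dots> = (if Suc r < i then Suc r else Suc (Suc r))"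
    unfolding Suc by (auto intro!: Least_equality split: if_splits)
  finally show ?case .
qed

lemma delete_row_altdef:
  assumes "i < dim_row A"
  shows "delete_row i A = mat (dim_row A - 1) (dim_col A) (\<lambda>(r, c). A $$ (if r < i then r else
      Suc r, c))"
proof -
  have "{k. k < dim_row A \<and> k \<in> - {i}} = {..<dim_row A} - {i}" by auto
  then have "card {k. k < dim_row A \<and> k \<in> - {i}} = dim_row A - 1" using assms by simp
  then show ?thesis
    unfolding delete_row_def submatrix_def by (simp add: pick_Compl_singleton pick_UNIV)
qed

lemma delete_col_altdef:
  assumes "j < dim_col A"
  shows "delete_col j A = mat (dim_row A) (dim_col A - 1) (\<lambda>(r, c). A $$ (r, if c < j then c
      else Suc c))"
proof -
  have "{k. k < dim_col A \<and> k \<in> - {j}} = {..<dim_col A} - {j}" by auto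
  then have "card {k. k < dim_col A \<and> k \<in> - {j}} = dim_col A - 1" using assms by simp
  then show ?thesis
    unfolding delete_col_def submatrix_def by (simp add: pick_Compl_singleton pick_UNIV)
qed

lemma parity_step_imp_block_sums:
  assumes "parity_step A B"
  shows "\<exists>x y. block_sums A B x y"
  using assms
proof cases
  case (delete_row i)
  have "block_sums A B (\<lambda>r. {if r < i then r else Suc r}) (\<lambda>c. {c})"
    unfolding block_sums_def delete_row(1) delete_row_altdef[OF delete_row(2)] ordered_blocks_def
    using delete_row(2) by auto
  then show ?thesis by blast
next
  case (delete_col j)
  have "block_sums A B (\<lambda>r. {r}) (\<lambda>c. {if c < j then c else Suc c})"
    unfolding block_sums_def delete_col(1) delete_col_altdef[OF delete_col(2)] ordered_blocks_def
    using delete_col(2) by auto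
  then show ?thesis by blast
next
  case (sum_rows i)
  have "block_sums A B (\<lambda>r. if r < i then {r} else if r = i then {i, Suc i} else {Suc r}) (\<lambda>c. {c})"
    unfolding block_sums_def sum_rows(1) sum_rows_def ordered_blocks_def
    using sum_rows(2) by auto
  then show ?thesis by blast
next
  case (sum_cols j)
  have "block_sums A B (\<lambda>r. {r}) (\<lambda>c. if c < j then {c} else if c = j then {j, Suc j} else {Suc c})"
    unfolding block_sums_def sum_cols(1) sum_cols_def ordered_blocks_def
    using sum_cols(2) by auto
  then show ?thesis by blast
qed

lemma block_sums_refl: "block_sums A A (\<lambda>r. {r}) (\<lambda>c. {c})"
  unfolding block_sums_def ordered_blocks_def by simp

lemma parity_minor_imp_block_sums:
  assumes "parity_minor N A"
  shows "\<exists>x y. block_sums A N x y"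
  using assms unfolding parity_minor_def
proof (induction rule: rtranclp_induct)
  case base
  show ?case using block_sums_refl by blast
next
  case (step B N)
  then obtain x y x' y' where "block_sums A B x y" "block_sums B N x' y'"
    using parity_step_imp_block_sums by metis
  from block_sums_trans[OF this] show ?case by blast
qed

lemma parity_step_transpose:
  assumes "parity_step A B"
  shows "parity_step (transpose_mat A) (transpose_mat B)"
  using assms
proof cases
  case (delete_row i)
  have "transpose_mat B = delete_col i (transpose_mat A)"
    using delete_row(2) by (intro eq_matI) (simp_all add: delete_row(1) delete_row_altdef
        delete_col_altdef)
  then show ?thesis using parity_step.delete_col[of i "transpose_mat A"] delete_row(2) by simp
next
  case (delete_col j)
  have "transpose_mat B = delete_row j (transpose_mat A)"
    using delete_col(2) by (intro eq_matI) (simp_all add: delete_col(1) delete_row_altdef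
        delete_col_altdef)
  then show ?thesis using parity_step.delete_row[of j "transpose_mat A"] delete_col(2) by simp
next
  case (sum_rows i)
  have "transpose_mat B = sum_cols i (transpose_mat A)"
    using sum_rows(2) by (intro eq_matI) (simp_all add: sum_rows(1) sum_rows_def sum_cols_def)
  then show ?thesis using parity_step.sum_cols[of i "transpose_mat A"] sum_rows(2) by simp
next
  case (sum_cols j)
  have "transpose_mat B = sum_rows j (transpose_mat A)"
    using sum_cols(2) by (intro eq_matI) (simp_all add: sum_cols(1) sum_rows_def sum_cols_def)
  then show ?thesis using parity_step.sum_rows[of j "transpose_mat A"] sum_cols(2) by simp
qed

lemma parity_minor_transpose:
  assumes "parity_minor N A"
  shows "parity_minor (transpose_mat N) (transpose_mat A)"
  using assms unfolding parity_minor_def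
  by (induction rule: rtranclp_induct) (auto intro: parity_step_transpose
      rtranclp.rtrancl_into_rtrancl)

lemma parity_minor_trans: "parity_minor N B \<Longrightarrow> parity_minor B A \<Longrightarrow> parity_minor N A"
  unfolding parity_minor_def by simp

section \<open>From block sums back to parity operations\<close>

lemma strict_mono_enumeration_id:
  fixes f :: "nat \<Rightarrow> nat"
  assumes mono: "\<And>i j. i < j \<Longrightarrow> j < m \<Longrightarrow> f i < f j" and im: "f ` {..<m} = {..<n}"
  shows "m = n \<and> (\<forall>i<m. f i = i)"
proof -
  have "inj_on f {..<m}" by (rule linorder_inj_onI) (use mono in force)+
  then have mn: "m = n" using card_image im by fastforce
  have "f i = i" if "i < m" for i
    using that
  proof (induction i rule: less_induct)
    case (less i)
    show ?case
    proof (rule ccontr)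
      assume ne: "f i \<noteq> i"
      have "f i \<ge> i"
      proof (rule ccontr)
        assume "\<not> i \<le> f i"
        then have "f (f i) = f i" "f (f i) < f i" using less.IH[of "f i"] mono[of "f i" i]
            less.prems by auto
        then show False by simp
      qed
      then have "i < f i" using ne by simp
      have "i \<in> f ` {..<m}" using im mn less.prems by simp
      then obtain k where k: "k < m" "f k = i" by auto
      show False
      proof (cases k i rule: linorder_cases)
        case less
        then show ?thesis using less.IH[OF less k(1)] k by simp
      next
        case equal
        then show ?thesis using k ne by simp
      next
        case greater
        then show ?thesis using mono[OF greater k(1)] k \<open>i < f i\<close> by simp
      qed
    qed
  qed
  then show ?thesis using mn by blast
qed

lemma ordered_blocks_unique:
  "\<lbrakk>ordered_blocks t X; i < t; j < t; a \<in> X i; a \<in> X j\<rbrakk> \<Longrightarrow> i = j"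
  using ordered_blocks_disjoint[of t X i j] by fastforce

lemma ordered_blocks_image:
  assumes "ordered_blocks t X"
    and "\<And>i j a b. \<lbrakk>i < j; j < t; a \<in> X i; b \<in> X j; a < b\<rbrakk> \<Longrightarrow> f a < f b"
  shows "ordered_blocks t (\<lambda>i. f ` X i)"
  unfolding ordered_blocks_def
proof (intro allI impI ballI)
  fix i j a b
  assume ij: "i < j" "j < t" and "a \<in> f ` X i" "b \<in> f ` X j"
  then obtain a' b' where a: "a' \<in> X i" "a = f a'" and b: "b' \<in> X j" "b = f b'" by blast
  show "a < b" unfolding a(2) b(2)
    by (rule assms(2)[OF ij a(1) b(1) ordered_blocksD[OF assms(1) ij a(1) b(1)]])
qed

text \<open>Induction on the number of rows. An uncovered row is deleted. If all rows are covered
  and a block contains a < b, the order of the blocks puts a + 1 into the same block, so rows a and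
  a + 1 can be added. Otherwise the blocks are singletons that list all rows in order, and the
  result is A itself.\<close>

lemma parity_minor_row_sums:
  assumes "ordered_blocks m X" and "\<And>i. i < m \<Longrightarrow> X i \<subseteq> {..<dim_row A}" and "\<And>i. i < m \<Longrightarrow> X i \<noteq> {}"
  shows "parity_minor (mat m (dim_col A) (\<lambda>(i, c). \<Sum>r\<in>X i. A $$ (r, c))) A"
  using assms
proof (induction "dim_row A" arbitrary: A X rule: less_induct)
  case less
  note ord = less.prems(1) and sub = less.prems(2) and ne = less.prems(3)
  have fin: "finite (X i)" if "i < m" for i using sub[OF that] finite_subset by blast
  \<comment> \<open>f renumbers the rows of A as rows of B. It has to be increasing only across
    different blocks, since adding two rows identifies two indices of one block.\<close>
  have reduce: ?case
    if B: "parity_step A B" "dim_row B < dim_row A" "dim_col B = dim_col A"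
      and sum: "\<And>i c. i < m \<Longrightarrow> c < dim_col A \<Longrightarrow> (\<Sum>k\<in>f ` X i. B $$ (k, c)) = (\<Sum>r\<in>X i. A $$ (r, c))"
      and f: "\<And>i j a b. \<lbrakk>i < j; j < m; a \<in> X i; b \<in> X j; a < b\<rbrakk> \<Longrightarrow> f a < f b"
      and fB: "\<And>i a. i < m \<Longrightarrow> a \<in> X i \<Longrightarrow> f a < dim_row B" for B f
  proof -
    have "parity_minor (mat m (dim_col B) (\<lambda>(i, c). \<Sum>r\<in>f ` X i. B $$ (r, c))) B"
      by (rule less.hyps[OF B(2) ordered_blocks_image[OF ord f]]) (use fB ne in auto)
    moreover have "mat m (dim_col B) (\<lambda>(i, c). \<Sum>r\<in>f ` X i. B $$ (r, c))
      = mat m (dim_col A) (\<lambda>(i, c). \<Sum>r\<in>X i. A $$ (r, c))"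
      by (rule eq_matI) (simp_all add: B(3) sum)
    ultimately show ?thesis using B(1) unfolding parity_minor_def
      by (metis converse_rtranclp_into_rtranclp)
  qed
  consider (uncovered) u where "u < dim_row A" "\<And>i. i < m \<Longrightarrow> u \<notin> X i"
    | (double) i a b where "i < m" "a \<in> X i" "b \<in> X i" "a < b"
        "\<And>u. u < dim_row A \<Longrightarrow> \<exists>i<m. u \<in> X i"
    | (single) "\<And>u. u < dim_row A \<Longrightarrow> \<exists>i<m. u \<in> X i"
        "\<And>i a b. \<lbrakk>i < m; a \<in> X i; b \<in> X i\<rbrakk> \<Longrightarrow> a = b"
    by (metis linorder_neqE_nat)
  then show ?case
  proof cases
    case uncovered
    let ?f = "\<lambda>k. if k < u then k else k - 1"
    have inj: "inj_on ?f (X i)" if "i < m" for i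
    proof (rule linorder_inj_onI)
      fix a b assume "a < b" "a \<in> X i" "b \<in> X i"
      then have "a \<noteq> u" "b \<noteq> u" using uncovered(2)[OF that] by auto
      then show "?f a \<noteq> ?f b" using \<open>a < b\<close> by auto
    qed (rule linear)
    have val: "?f a < dim_row A - 1 \<and> delete_row u A $$ (?f a, c) = A $$ (a, c)"
      if "i < m" "a \<in> X i" "c < dim_col A" for i a c
    proof -
      have "a \<noteq> u" "a < dim_row A" using uncovered(2)[OF that(1)] that(2) sub[OF that(1)] by auto
      then show ?thesis using that(3) uncovered(1) by (auto simp: delete_row_altdef)
    qed
    show ?thesis
    proof (rule reduce[of "delete_row u A" ?f])
      show "parity_step A (delete_row u A)" by (rule parity_step.delete_row[OF uncovered(1)])
      show "dim_row (delete_row u A) < dim_row A" "dim_col (delete_row u A) = dim_col A"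
        using uncovered(1) by (simp_all add: delete_row_altdef)
      show "(\<Sum>k\<in>?f ` X i. delete_row u A $$ (k, c)) = (\<Sum>r\<in>X i. A $$ (r, c))"
        if "i < m" "c < dim_col A" for i c
        unfolding sum.reindex[OF inj[OF that(1)]] o_def
        by (rule sum.cong[OF refl]) (use val that in blast)
      show "?f a < ?f b" if "i < j" "j < m" "a \<in> X i" "b \<in> X j" "a < b" for i j a b
      proof -
        have "a \<noteq> u" "b \<noteq> u" using uncovered(2)[of i] uncovered(2)[of j] that by auto
        then show ?thesis using that(5) by auto
      qed
      show "?f a < dim_row (delete_row u A)" if "i < m" "a \<in> X i" for i a
      proof -
        have "a \<noteq> u" "a < dim_row A" using uncovered(2)[OF that(1)] that(2) sub[OF that(1)] by auto
        then show ?thesis using uncovered(1) by (auto simp: delete_row_altdef)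
      qed
    qed
  next
    case double
    have bA: "b < dim_row A" using sub[OF double(1)] double(3) by auto
    then have sa: "Suc a < dim_row A" using double(4) by simp
    obtain i' where i': "i' < m" "Suc a \<in> X i'" using double(5)[OF sa] by blast
    have "i' = i"
    proof (cases i' i rule: linorder_cases)
      case less
      then show ?thesis using ordered_blocksD[OF ord less double(1) i'(2) double(2)] by simp
    next
      case greater
      then show ?thesis using ordered_blocksD[OF ord greater i'(1) double(3) i'(2)] double(4) by
          simp
    qed
    then have Sa: "Suc a \<in> X i" using i' by simp
    have block_a: "j = i" if "j < m" "a \<in> X j \<or> Suc a \<in> X j" for j
      using ordered_blocks_unique[OF ord that(1) double(1)] that(2) double(2) Sa by blast
    let ?f = "\<lambda>k. if k \<le> a then k else k - 1"
    show ?thesis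
    proof (rule reduce[of "sum_rows a A" ?f])
      show "parity_step A (sum_rows a A)" by (rule parity_step.sum_rows[OF sa])
      show "dim_row (sum_rows a A) < dim_row A" "dim_col (sum_rows a A) = dim_col A"
        using sa by (simp_all add: sum_rows_def)
      show fB: "?f x < dim_row (sum_rows a A)" if "j < m" "x \<in> X j" for j x
      proof -
        have "x < dim_row A" using sub[OF that(1)] that(2) by auto
        then show ?thesis using sa by (auto simp: sum_rows_def)
      qed
      show "(\<Sum>k\<in>?f ` X j. sum_rows a A $$ (k, c)) = (\<Sum>r\<in>X j. A $$ (r, c))"
        if j: "j < m" and c: "c < dim_col A" for j c
      proof -
        have "(\<Sum>r\<in>X j. A $$ (r, c)) = (\<Sum>k\<in>?f ` X j. \<Sum>r\<in>{x \<in> X j. ?f x = k}. A $$ (r, c))"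
          by (rule sum.image_gen[OF fin[OF j]])
        also have "\<dots> = (\<Sum>k\<in>?f ` X j. sum_rows a A $$ (k, c))"
        proof (rule sum.cong[OF refl])
          fix k assume "k \<in> ?f ` X j"
          then obtain x where x: "x \<in> X j" "k = ?f x" by blast
          have k: "k < dim_row A - 1" using fB[OF j x(1)] x(2) by (simp add: sum_rows_def)
          show "(\<Sum>r\<in>{x \<in> X j. ?f x = k}. A $$ (r, c)) = sum_rows a A $$ (k, c)"
          proof (cases "k = a")
            case True
            then have "x = a \<or> x = Suc a" using x(2) by (auto split: if_splits)
            then have "j = i" using block_a[OF j] x(1) by blast
            then have "{x \<in> X j. ?f x = k} = {a, Suc a}"
              using True double(2) Sa by (auto split: if_splits)
            then show ?thesis using True k c by (simp add: sum_rows_def)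
          next
            case False
            then have "{x \<in> X j. ?f x = k} = {x}" using x by (auto split: if_splits)
            moreover have "sum_rows a A $$ (k, c) = A $$ (x, c)"
              using False x(2) k c by (auto simp: sum_rows_def split: if_splits)
            ultimately show ?thesis by simp
          qed
        qed
        finally show ?thesis by simp
      qed
      show "?f x < ?f y" if "j < j'" "j' < m" "x \<in> X j" "y \<in> X j'" "x < y" for j j' x y
      proof -
        have "\<not> (x = a \<and> y = Suc a)" using block_a[of j] block_a[of j'] that by auto
        then show ?thesis using that(5) by auto
      qed
    qed
  next
    case single
    have "\<forall>i. \<exists>x. i < m \<longrightarrow> X i = {x}"
      using single(2) ne by (metis is_singletonI' is_singleton_def)
    from choice[OF this] obtain g where g: "\<forall>i. i < m \<longrightarrow> X i = {g i}" by (elim exE)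
    have g_mono: "g i < g j" if "i < j" "j < m" for i j
      using ordered_blocksD[OF ord that] g that by simp
    have "g ` {..<m} = {..<dim_row A}"
    proof (intro subset_antisym subsetI)
      fix x assume "x \<in> g ` {..<m}"
      then show "x \<in> {..<dim_row A}" using g sub by force
    next
      fix x assume "x \<in> {..<dim_row A}"
      then obtain i where "i < m" "x \<in> X i" using single(1) by auto
      then show "x \<in> g ` {..<m}" using g by auto
    qed
    then have id: "m = dim_row A" "\<forall>i<m. g i = i"
      using strict_mono_enumeration_id[of m g, OF g_mono] by blast+
    have "mat m (dim_col A) (\<lambda>(i, c). \<Sum>r\<in>X i. A $$ (r, c)) = A"
      by (rule eq_matI) (use id g in auto)
    then show ?thesis by (simp add: parity_minor_def)
  qed
qed

text \<open>Row operations come first, then column operations as row operations on the transpose. An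
  empty block would call for a zero line, which deletions and sums need not produce.\<close>

theorem block_sums_imp_parity_minor:
  assumes "block_sums A N x y"
    and "\<And>i. i < dim_row N \<Longrightarrow> x i \<noteq> {}" and "\<And>j. j < dim_col N \<Longrightarrow> y j \<noteq> {}"
  shows "parity_minor N A"
proof -
  have x: "ordered_blocks (dim_row N) x" "\<forall>i<dim_row N. x i \<subseteq> {..<dim_row A}"
    and y: "ordered_blocks (dim_col N) y" "\<forall>j<dim_col N. y j \<subseteq> {..<dim_col A}"
    and N: "\<forall>i<dim_row N. \<forall>j<dim_col N. N $$ (i, j) = (\<Sum>r\<in>x i. \<Sum>c\<in>y j. A $$ (r, c))"
    using assms(1) unfolding block_sums_def by simp_all
  define B where "B = mat (dim_row N) (dim_col A) (\<lambda>(i, c). \<Sum>r\<in>x i. A $$ (r, c))"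
  have "parity_minor B A" unfolding B_def
    by (rule parity_minor_row_sums[OF x(1)]) (use x(2) assms(2) in simp_all)
  moreover have "parity_minor N B"
  proof -
    have "parity_minor (mat (dim_col N) (dim_col (transpose_mat B))
      (\<lambda>(j, c). \<Sum>r\<in>y j. transpose_mat B $$ (r, c))) (transpose_mat B)"
      by (rule parity_minor_row_sums[OF y(1)]) (use y(2) assms(3) in \<open>simp_all add: B_def\<close>)
    moreover have "mat (dim_col N) (dim_col (transpose_mat B))
      (\<lambda>(j, c). \<Sum>r\<in>y j. transpose_mat B $$ (r, c)) = transpose_mat N"
    proof (rule eq_matI)
      fix j i assume "j < dim_row (transpose_mat N)" "i < dim_col (transpose_mat N)"
      then have ij: "j < dim_col N" "i < dim_row N" by simp_all
      have "(\<Sum>r\<in>y j. transpose_mat B $$ (r, i)) = (\<Sum>c\<in>y j. \<Sum>r\<in>x i. A $$ (r, c))"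
        by (rule sum.cong[OF refl]) (use ij y(2) in \<open>auto simp: B_def subset_iff\<close>)
      also have "\<dots> = N $$ (i, j)" using N ij by (simp add: sum.swap[of _ "x i" "y j"])
      finally show "mat (dim_col N) (dim_col (transpose_mat B))
        (\<lambda>(j, c). \<Sum>r\<in>y j. transpose_mat B $$ (r, c)) $$ (j, i) = transpose_mat N $$ (j, i)"
        using ij by (simp add: B_def)
    qed (simp_all add: B_def)
    ultimately have "parity_minor (transpose_mat N) (transpose_mat B)" by simp
    from parity_minor_transpose[OF this] show ?thesis by simp
  qed
  ultimately show ?thesis by (rule parity_minor_trans[rotated])
qed

subsection \<open>Chains of merges\<close>

lemma refines_finite:
  assumes "refines V P Q" and "finite V"
  shows "finite P" and "finite Q"
  using assms finite_elements[OF assms(2)] unfolding refines_def by simp_all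

text \<open>If no two parts of P lay in a common part of Q, every part of Q would be a single part
  of P, and antisymmetry of refinement would give P = Q.\<close>

lemma refines_merge:
  assumes PQ: "refines V P Q" and "finite V" and ne: "P \<noteq> Q"
  shows "\<exists>P'. merges_to P P' \<and> refines V P P' \<and> refines V P' Q \<and> card P' < card P"
proof -
  have fin: "finite P" using refines_finite PQ assms(2) by blast
  have P: "partition_on V P" and Q: "partition_on V Q" and ref: "\<And>X. X \<in> P \<Longrightarrow> \<exists>Y\<in>Q. X \<subseteq> Y"
    using PQ by (auto simp: refines_def)
  have "\<exists>X1\<in>P. \<exists>X2\<in>P. X1 \<noteq> X2 \<and> (\<exists>Y\<in>Q. X1 \<subseteq> Y \<and> X2 \<subseteq> Y)"
  proof (rule ccontr)
    assume no: "\<not> ?thesis"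
    have "\<exists>X\<in>P. Y \<subseteq> X" if Y: "Y \<in> Q" for Y
    proof -
      have "Y = \<Union>{p \<in> P. p \<subseteq> Y}" "Y \<noteq> {}"
        using refines_obtains_subset[OF PQ Y] Y Q by (auto simp: partition_on_def)
      then obtain X where X: "X \<in> P" "X \<subseteq> Y" by blast
      then have "{p \<in> P. p \<subseteq> Y} = {X}" using no Y by blast
      then have "Y = X" using \<open>Y = \<Union>{p \<in> P. p \<subseteq> Y}\<close> by simp
      then show ?thesis using X by blast
    qed
    then have "refines V Q P" using P Q by (simp add: refines_def)
    then show False using refines_asym[OF PQ] ne by blast
  qed
  then obtain X1 X2 Y where X: "X1 \<in> P" "X2 \<in> P" "X1 \<noteq> X2" and Y: "Y \<in> Q" "X1 \<subseteq> Y" "X2 \<subseteq> Y" by blast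
  define P' where "P' = insert (X1 \<union> X2) (P - {X1, X2})"
  have "merges_to P P'" unfolding merges_to_def P'_def using X by blast
  moreover have P': "partition_on V P'"
  proof (rule partition_onI)
    show "\<Union>P' = V" using partition_onD1[OF P] X by (auto simp: P'_def)
    show "{} \<notin> P'" using partition_onD3[OF P] X by (auto simp: P'_def)
    have dis: "disjnt p q" if "p \<in> P" "q \<in> P" "p \<noteq> q" for p q
      using partition_onD2[OF P] that by (simp add: pairwiseD)
    have new: "disjnt (X1 \<union> X2) q" if "q \<in> P - {X1, X2}" for q
      using dis[of X1 q] dis[of X2 q] that X by auto
    show "disjnt p q" if "p \<in> P'" "q \<in> P'" "p \<noteq> q" for p q
    proof -
      have "p = X1 \<union> X2 \<or> p \<in> P - {X1, X2}" "q = X1 \<union> X2 \<or> q \<in> P - {X1, X2}"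
        using that unfolding P'_def by simp_all
      then show ?thesis using new[of p] new[of q] dis[of p q] that(3) disjnt_sym by blast
    qed
  qed
  moreover have "refines V P P'"
    unfolding refines_def
  proof (intro conjI ballI P P')
    fix X assume "X \<in> P"
    show "\<exists>Y\<in>P'. X \<subseteq> Y"
    proof (cases "X \<in> {X1, X2}")
      case True
      then have "X \<subseteq> X1 \<union> X2" by auto
      moreover have "X1 \<union> X2 \<in> P'" by (simp add: P'_def)
      ultimately show ?thesis by (rule bexI)
    next
      case False
      then have "X \<in> P'" using \<open>X \<in> P\<close> by (simp add: P'_def)
      with subset_refl show ?thesis by (rule bexI)
    qed
  qed
  moreover have "refines V P' Q"
    unfolding refines_def
  proof (intro conjI ballI P' Q)
    fix X assume "X \<in> P'"
    then have "X = X1 \<union> X2 \<or> X \<in> P" unfolding P'_def by auto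
    then show "\<exists>Y\<in>Q. X \<subseteq> Y"
    proof
      assume "X = X1 \<union> X2"
      then have "X \<subseteq> Y" using Y by simp
      then show ?thesis using Y(1) by (rule bexI)
    qed (rule ref)
  qed
  moreover have "card P' < card P"
  proof -
    have "card P' \<le> Suc (card (P - {X1, X2}))" unfolding P'_def using fin by (simp add:
        card_insert_if)
    also have "card (P - {X1, X2}) = card P - 2" using X fin by (simp add: card_Diff_subset)
    also have "Suc (card P - 2) < card P"
      using card_mono[of P "{X1, X2}"] X fin by simp
    finally show ?thesis .
  qed
  ultimately show ?thesis by (intro exI conjI)
qed

text \<open>The condition is imposed on every partition that is reached but not on the starting one,
  so paths compose by transitivity.\<close>

abbreviation merge_path :: "('a set set \<Rightarrow> bool) \<Rightarrow> 'a set set \<Rightarrow> 'a set set \<Rightarrow> bool" where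
  "merge_path ok \<equiv> (\<lambda>P Q. merges_to P Q \<and> ok Q)\<^sup>*\<^sup>*"

lemma refines_imp_merge_path:
  assumes "refines V P Q" and "finite V"
    and "\<And>L. \<lbrakk>refines V P L; refines V L Q\<rbrakk> \<Longrightarrow> ok L"
  shows "merge_path ok P Q"
  using assms
proof (induction "card P" arbitrary: P rule: less_induct)
  case less
  show ?case
  proof (cases "P = Q")
    case False
    then obtain P' where P': "merges_to P P'" "refines V P P'" "refines V P' Q" "card P' < card P"
      using refines_merge[OF less.prems(1,2)] by blast
    have "merge_path ok P' Q"
      by (rule less.hyps[OF P'(4,3) less.prems(2)])
        (use less.prems(3) refines_trans[OF P'(2)] in blast)
    then show ?thesis using P' less.prems(3)
      by (intro converse_rtranclp_into_rtranclp[of _ P P']) auto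
  qed simp
qed

lemma merge_path_imp_list:
  assumes "merge_path ok P Q" and "ok P"
  shows "\<exists>Ps. Ps \<noteq> [] \<and> hd Ps = P \<and> last Ps = Q \<and> successively merges_to Ps \<and> (\<forall>L\<in>set Ps. ok L)"
  using assms
proof (induction rule: converse_rtranclp_induct)
  case base
  then show ?case by (intro exI[of _ "[Q]"]) simp
next
  case (step P P')
  then obtain Ps where "Ps \<noteq> []" "hd Ps = P'" "last Ps = Q" "successively merges_to Ps" "\<forall>L\<in>set
      Ps. ok L"
    by blast
  then show ?case using step.hyps(1) step.prems
    by (intro exI[of _ "P # Ps"]) (auto simp: successively_Cons)
qed

lemma partition_on_one_part: "partition_on V ({V} - {{}})"
  by (auto simp: partition_on_def disjoint_def)

lemma singletons_refine: "partition_on V P \<Longrightarrow> refines V ((\<lambda>v. {v}) ` V) P"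
  unfolding refines_def using partition_on_singletons[of V] by (auto simp: partition_on_def)

lemma refines_one_part: "partition_on V P \<Longrightarrow> refines V P ({V} - {{}})"
  unfolding refines_def using partition_on_one_part[of V] by (auto simp: partition_on_def)

section \<open>Twin-width in terms of merge paths\<close>

lemma twin_width_le:
  assumes "merge_path (\<lambda>L. \<forall>X\<in>L. red_degree S L X \<le> d) ((\<lambda>v. {v}) ` points S) ({points S} - {{}})"
    and "\<forall>X\<in>(\<lambda>v. {v}) ` points S. red_degree S ((\<lambda>v. {v}) ` points S) X \<le> d"
  shows "twin_width S \<le> d"
  unfolding twin_width_def
proof (rule Least_le)
  from merge_path_imp_list[OF assms] obtain Ps where
    "Ps \<noteq> []" "hd Ps = (\<lambda>v. {v}) ` points S" "last Ps = {points S} - {{}}"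
    "successively merges_to Ps" and deg: "\<forall>L\<in>set Ps. \<forall>X\<in>L. red_degree S L X \<le> d"
    by (elim exE conjE)
  then have "contraction_sequence (points S) Ps" unfolding contraction_sequence_def by simp
  then show "\<exists>Ps. contraction_sequence (points S) Ps \<and> (\<forall>P\<in>set Ps. \<forall>X\<in>P. red_degree S P X \<le> d)"
    using deg by (intro exI conjI)
qed

text \<open>\<open>LEAST\<close> carries information only if some bound exists. Any contraction
  sequence of a finite structure gives one, with the total number of parts as a crude bound.\<close>

lemma twin_width_witness:
  assumes "finite (points S)"
  shows "\<exists>Ps. contraction_sequence (points S) Ps \<and>
    (\<forall>P\<in>set Ps. \<forall>X\<in>P. red_degree S P X \<le> twin_width S)"
  unfolding twin_width_def
proof (rule LeastI_ex)
  have sing: "refines (points S) ((\<lambda>v. {v}) ` points S) ({points S} - {{}})"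
    by (intro singletons_refine partition_on_one_part)
  have "merge_path finite ((\<lambda>v. {v}) ` points S) ({points S} - {{}})"
    by (rule refines_imp_merge_path[OF sing assms]) (rule refines_finite(2)[OF _ assms])
  from merge_path_imp_list[OF this] obtain Ps where Ps: "Ps \<noteq> []" "hd Ps = (\<lambda>v. {v}) ` points S"
      "last Ps = {points S} - {{}}"
    "successively merges_to Ps" "\<forall>L\<in>set Ps. finite L"
    using assms by auto
  have "red_degree S P X \<le> (\<Sum>P\<in>set Ps. card P)" if "P \<in> set Ps" for P X
  proof -
    have "red_degree S P X \<le> card P" unfolding red_degree_def
      by (rule card_mono) (use Ps that in auto)
    also have "\<dots> \<le> (\<Sum>P\<in>set Ps. card P)" by (rule member_le_sum) (use that in auto)
    finally show ?thesis .
  qed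
  then show "\<exists>d Ps. contraction_sequence (points S) Ps \<and> (\<forall>P\<in>set Ps. \<forall>X\<in>P. red_degree S P X \<le> d)"
    using Ps unfolding contraction_sequence_def
    by (intro exI[of _ "\<Sum>P\<in>set Ps. card P"] exI[of _ Ps]) simp
qed

subsection \<open>Bounded twin-width excludes a parity minor\<close>

lemma successively_invariant:
  assumes "Ps \<noteq> []" and "successively R Ps" and "I (hd Ps)" and "\<And>L L'. R L L' \<Longrightarrow> I L \<Longrightarrow> I L'"
  shows "\<forall>L\<in>set Ps. I L"
  using assms(1-3)
proof (induction Ps)
  case (Cons P Ps)
  show ?case
  proof (cases "Ps = []")
    case False
    then have R: "R P (hd Ps)" "successively R Ps"
      using Cons.prems(2) by (simp_all add: successively_Cons)
    have "I P" using Cons.prems(3) by simp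
    then have "I (hd Ps)" by (rule assms(4)[OF R(1)])
    then have "\<forall>L\<in>set Ps. I L" by (rule Cons.IH[OF False R(2)])
    then show ?thesis using Cons.prems(3) by simp
  qed (use Cons.prems(3) in simp)
qed simp

lemma successively_first:
  assumes "Ps \<noteq> []" and "successively R Ps" and "\<not> Q (hd Ps)" and "Q (last Ps)"
  shows "\<exists>L L'. R L L' \<and> L \<in> set Ps \<and> L' \<in> set Ps \<and> \<not> Q L \<and> Q L'"
  using assms
proof (induction Ps)
  case (Cons P Ps)
  have "Ps \<noteq> []" using Cons.prems(3,4) by (cases Ps) simp_all
  show ?case
  proof (cases "Q (hd Ps)")
    case True
    then show ?thesis using Cons.prems \<open>Ps \<noteq> []\<close>
      by (intro exI[of _ P] exI[of _ "hd Ps"]) (simp add: successively_Cons)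
  next
    case False
    then have "\<exists>L L'. R L L' \<and> L \<in> set Ps \<and> L' \<in> set Ps \<and> \<not> Q L \<and> Q L'"
      using Cons \<open>Ps \<noteq> []\<close> by (simp add: successively_Cons)
    then show ?thesis by auto
  qed
qed simp

text \<open>On J a row sum depends only on which of the at most k traces occur an odd number of
  times in the set, so there are at most 2^k different row sums.\<close>

lemma few_traces_imp_repeated_row_sum:
  fixes e :: "nat \<Rightarrow> nat \<Rightarrow> bit" and s :: nat
  assumes I: "finite I" and x: "\<And>u. u < s \<Longrightarrow> x u \<subseteq> I"
    and few: "card (row_trace e J ` I) \<le> k" and s: "2 ^ k < s"
  shows "\<exists>u<s. \<exists>u'<s. u \<noteq> u' \<and> (\<forall>c\<in>J. row_sum e (x u) c = row_sum e (x u') c)"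
proof -
  define T where "T = row_trace e J ` I"
  define p where "p u = {w \<in> T. odd (card {r \<in> x u. row_trace e J r = w})}" for u
  have finT: "finite T" using I by (simp add: T_def)
  have "card (p ` {..<s}) \<le> card (Pow T)"
    by (intro card_mono) (use finT in \<open>auto simp: p_def\<close>)
  also have "\<dots> \<le> 2 ^ k" using finT few by (simp add: card_Pow T_def power_increasing)
  also have "\<dots> < card {..<s}" using s by simp
  finally have "\<not> inj_on p {..<s}" by (rule pigeonhole)
  then obtain u u' where u: "u < s" "u' < s" "u \<noteq> u'" "p u = p u'" unfolding inj_on_def by blast
  have sum: "row_sum e (x v) c = (\<Sum>w\<in>T. of_bool (c \<in> w \<and> w \<in> p v))" if v: "v < s" and c: "c \<in> J"
      for v c
  proof -
    have finx: "finite (x v)" using x[OF v] I finite_subset by blast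
    have "row_sum e (x v) c = (\<Sum>w\<in>T. \<Sum>r\<in>{r \<in> x v. row_trace e J r = w}. e r c)"
      unfolding row_sum_def
      by (rule sum.group[symmetric]) (use finx finT x[OF v] in \<open>auto simp: T_def\<close>)
    also have "\<dots> = (\<Sum>w\<in>T. of_bool (c \<in> w \<and> w \<in> p v))"
    proof (rule sum.cong[OF refl])
      fix w assume w: "w \<in> T"
      have "(\<Sum>r\<in>{r \<in> x v. row_trace e J r = w}. e r c)
        = (\<Sum>r\<in>{r \<in> x v. row_trace e J r = w}. of_bool (c \<in> w))"
        by (rule sum.cong[OF refl]) (use c in \<open>auto simp: row_trace_def\<close>)
      also have "\<dots> = of_nat (card {r \<in> x v. row_trace e J r = w}) * of_bool (c \<in> w)" by simp
      also have "\<dots> = of_bool (c \<in> w \<and> w \<in> p v)"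
      proof -
        have "(of_nat n :: bit) = of_bool (odd n)" for n by (induction n) simp_all
        then show ?thesis using w by (auto simp: p_def)
      qed
      finally show "(\<Sum>r\<in>{r \<in> x v. row_trace e J r = w}. e r c) = of_bool (c \<in> w \<and> w \<in> p v)" .
    qed
    finally show ?thesis .
  qed
  have "\<forall>c\<in>J. row_sum e (x u) c = row_sum e (x u') c" using sum u by simp
  then show ?thesis using u by blast
qed

text \<open>The pattern is a t by t grid of identity matrices of order s. In each of them the s row
  sums are told apart by adding up the columns in \<open>y (b * s + u)\<close>, whereas k traces
  allow only 2^k row sums.\<close>

lemma block_identity_trace_bound:
  fixes e :: "nat \<Rightarrow> nat \<Rightarrow> bit" and s t :: nat
  assumes sums: "\<And>i j. \<lbrakk>i < t * s; j < t * s\<rbrakk> \<Longrightarrow>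
      (\<Sum>r\<in>x i. \<Sum>c\<in>y j. e r c) = (if i mod s = j mod s then 1 else 0)"
    and ab: "a < t" "b < t" and fin: "finite (\<Union>u<s. x (a * s + u))"
    and few: "card (row_trace e (\<Union>v<s. y (b * s + v)) ` (\<Union>u<s. x (a * s + u))) \<le> k"
  shows "s \<le> 2 ^ k"
proof (rule ccontr)
  assume "\<not> s \<le> 2 ^ k"
  then have "2 ^ k < s" by simp
  then have "\<exists>u<s. \<exists>u'<s. u \<noteq> u' \<and> (\<forall>c\<in>(\<Union>v<s. y (b * s + v)).
      row_sum e (x (a * s + u)) c = row_sum e (x (a * s + u')) c)"
    by (intro few_traces_imp_repeated_row_sum[OF fin _ few]) auto
  then obtain u u' where u: "u < s" "u' < s" "u \<noteq> u'"
    and eq: "\<forall>c\<in>(\<Union>v<s. y (b * s + v)). row_sum e (x (a * s + u)) c = row_sum e (x (a * s + u')) c"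
    by (elim exE conjE)
  have lt: "c * s + w < t * s" if "c < t" "w < s" for c w
  proof -
    have "c * s + w < Suc c * s" using that by simp
    also have "\<dots> \<le> t * s" using that by (intro mult_le_mono1) simp
    finally show ?thesis .
  qed
  have val: "(\<Sum>c\<in>y (b * s + u). row_sum e (x (a * s + w)) c) = (if w = u then 1 else 0)" if "w <
      s" for w
  proof -
    have "(\<Sum>c\<in>y (b * s + u). row_sum e (x (a * s + w)) c)
      = (\<Sum>r\<in>x (a * s + w). \<Sum>c\<in>y (b * s + u). e r c)"
      unfolding row_sum_def by (rule sum.swap)
    also have "\<dots> = (if w = u then 1 else 0)"
      using sums[OF lt[OF ab(1) that] lt[OF ab(2) u(1)]] that u(1) by simp
    finally show ?thesis .
  qed
  have "(\<Sum>c\<in>y (b * s + u). row_sum e (x (a * s + u)) c) = (\<Sum>c\<in>y (b * s + u). row_sum e (x (a * s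
      + u')) c)"
    by (rule sum.cong[OF refl]) (use eq u(1) in blast)
  then show False unfolding val[OF u(1)] val[OF u(2)] using u(3) by simp
qed

text \<open>P may miss I altogether; it only reaches past I on both sides. \<open>\<rho>\<close> is
  the embedding of the rows or of the columns.\<close>

definition spans :: "(nat \<Rightarrow> 'a) \<Rightarrow> 'a set \<Rightarrow> nat set \<Rightarrow> bool" where
  "spans \<rho> P I \<longleftrightarrow> (\<exists>lo hi. \<rho> lo \<in> P \<and> \<rho> hi \<in> P \<and> (\<forall>z\<in>I. lo \<le> z \<and> z \<le> hi))"

text \<open>A block strictly between the first and the last block that Q meets would be spanned by
  Q.\<close>

lemma touched_blocks_card:
  assumes J: "ordered_blocks t J" and no: "\<And>b. b < t \<Longrightarrow> \<not> spans \<kappa> Q (J b)"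
  shows "card {b. b < t \<and> (\<exists>c\<in>J b. \<kappa> c \<in> Q)} \<le> 2"
proof -
  let ?T = "{b. b < t \<and> (\<exists>c\<in>J b. \<kappa> c \<in> Q)}"
  have "?T \<subseteq> {Min ?T, Max ?T}"
  proof
    fix b assume b: "b \<in> ?T"
    then have ne: "?T \<noteq> {}" by blast
    have min: "Min ?T \<in> ?T" and max: "Max ?T \<in> ?T" by (rule Min_in Max_in; use ne in simp)+
    show "b \<in> {Min ?T, Max ?T}"
    proof (rule ccontr)
      assume "b \<notin> {Min ?T, Max ?T}"
      moreover have "Min ?T \<le> b" "b \<le> Max ?T" using b by simp_all
      ultimately have lt: "Min ?T < b" "b < Max ?T" by simp_all
      obtain lo where lo: "lo \<in> J (Min ?T)" "\<kappa> lo \<in> Q" using min by blast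
      obtain hi where hi: "hi \<in> J (Max ?T)" "\<kappa> hi \<in> Q" using max by blast
      have bt: "b < t" "Max ?T < t" using b max by blast+
      have "lo \<le> z \<and> z \<le> hi" if "z \<in> J b" for z
        using ordered_blocksD[OF J lt(1) bt(1) lo(1) that] ordered_blocksD[OF J lt(2) bt(2) that
            hi(1)]
        by simp
      then have "spans \<kappa> Q (J b)" unfolding spans_def using lo hi by blast
      then show False using no bt by blast
    qed
  qed
  then have "card ?T \<le> card {Min ?T, Max ?T}" by (rule card_mono[rotated]) simp
  also have "\<dots> \<le> 2" by (simp add: card_insert_if)
  finally show ?thesis .
qed

text \<open>A line of I outside P lies strictly between two lines of P, to which it is related
  differently by the order, so its part is red-adjacent to P: at most d + 1 parts cover I. Together
  with their red neighbours these are at most (d + 1)^2 parts, each touching at most 4 groups, so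
  some \<open>J b\<close> avoids them all. Each covering part is homogeneous towards every part
  meeting this \<open>J b\<close>, so its lines share one trace.\<close>

lemma few_traces_when_spanning:
  fixes \<rho> \<kappa> :: "nat \<Rightarrow> 'a" and e :: "nat \<Rightarrow> nat \<Rightarrow> bit"
  assumes mono: "\<And>lo z hi. \<lbrakk>lo < z; z < hi\<rbrakk> \<Longrightarrow> atomic_type S (\<rho> lo) (\<rho> z) \<noteq> atomic_type S (\<rho> hi)
      (\<rho> z)"
    and entry: "\<And>z z' c. atomic_type S (\<rho> z) (\<kappa> c) = atomic_type S (\<rho> z') (\<kappa> c) \<Longrightarrow> e z c = e z' c"
    and L: "merges_to L L'" "finite L'"
    and deg: "\<And>X. X \<in> L' \<Longrightarrow> red_degree S L' X \<le> d"
    and I: "\<And>z. z \<in> I \<Longrightarrow> \<rho> z \<in> \<Union>L'" "finite I"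
    and J: "\<And>b c. \<lbrakk>b < t; c \<in> J b\<rbrakk> \<Longrightarrow> \<kappa> c \<in> \<Union>L'" "ordered_blocks t J"
    and P: "P \<in> L'" "spans \<rho> P I"
    and no: "\<And>Q b. \<lbrakk>Q \<in> L; b < t\<rbrakk> \<Longrightarrow> \<not> spans \<kappa> Q (J b)"
    and t: "4 * (d + 1) ^ 2 < t"
  shows "\<exists>b<t. card (row_trace e (J b) ` I) \<le> d + 1"
proof -
  define nbr where "nbr Z = {Y \<in> L'. red_adjacent S Z Y}" for Z
  have nbr: "card (insert Z (nbr Z)) \<le> d + 1" "finite (nbr Z)" if "Z \<in> L'" for Z
    using deg[OF that] L(2) by (simp_all add: nbr_def red_degree_def card_insert_if)
  define B where "B = insert P (nbr P)"
  have B: "card B \<le> d + 1" "finite B" "B \<subseteq> L'" using nbr[OF P(1)] P(1) by (auto simp: B_def nbr_def)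
  define bad where "bad = (\<Union>Z\<in>B. insert Z (nbr Z))"
  have "card bad \<le> (\<Sum>Z\<in>B. card (insert Z (nbr Z)))" unfolding bad_def by (rule card_UN_le[OF B(2)])
  also have "\<dots> \<le> (\<Sum>Z\<in>B. d + 1)" by (intro sum_mono nbr) (use B in blast)
  also have "\<dots> \<le> (d + 1) * (d + 1)" using mult_le_mono1[OF B(1), of "d + 1"] by simp
  finally have bad: "card bad \<le> (d + 1) ^ 2" by (simp add: power2_eq_square)
  have bad_sub: "bad \<subseteq> L'" "finite bad"
    using B L(2) finite_subset[of bad L'] by (auto simp: bad_def nbr_def)
  define touch where "touch Q = {b. b < t \<and> (\<exists>c\<in>J b. \<kappa> c \<in> Q)}" for Q
  have touch2: "card (touch Q) \<le> 2" if "Q \<in> L" for Q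
    unfolding touch_def by (rule touched_blocks_card[OF J(2) no[OF that]])
  \<comment> \<open>The hypothesis about spanning concerns L, before the merge. The only new part of
    L' is a union of two parts of L, hence 4 = 2 + 2.\<close>
  have touch4: "card (touch Q) \<le> 4" if Q: "Q \<in> L'" for Q
  proof -
    obtain X Y where XY: "X \<in> L" "Y \<in> L" "L' = insert (X \<union> Y) (L - {X, Y})"
      using L(1) unfolding merges_to_def by blast
    show ?thesis
    proof (cases "Q \<in> L")
      case True
      then show ?thesis using touch2 by fastforce
    next
      case False
      then have "touch Q = touch X \<union> touch Y" using Q XY(3) by (auto simp: touch_def)
      then show ?thesis using card_Un_le[of "touch X" "touch Y"] touch2[OF XY(1)] touch2[OF
          XY(2)] by simp
    qed
  qed
  have "card (\<Union>Q\<in>bad. touch Q) \<le> (\<Sum>Q\<in>bad. card (touch Q))" by (rule card_UN_le[OF bad_sub(2)])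
  also have "\<dots> \<le> (\<Sum>Q\<in>bad. 4)" by (intro sum_mono touch4) (use bad_sub in blast)
  also have "\<dots> \<le> 4 * (d + 1) ^ 2" using bad by simp
  also have "\<dots> < card {..<t}" using t by simp
  finally have "\<not> {..<t} \<subseteq> (\<Union>Q\<in>bad. touch Q)"
    using card_mono[of "\<Union>Q\<in>bad. touch Q" "{..<t}"] bad_sub(2) by (auto simp: touch_def)
  then obtain b where b: "b < t" "\<And>Q. Q \<in> bad \<Longrightarrow> b \<notin> touch Q" by auto
  have trace: "row_trace e (J b) z = row_trace e (J b) z'"
    if Z: "Z \<in> B" "\<rho> z \<in> Z" "\<rho> z' \<in> Z" for Z z z'
    unfolding row_trace_eq_iff
  proof
    fix c assume c: "c \<in> J b"
    then obtain Q where Q: "Q \<in> L'" "\<kappa> c \<in> Q" using J(1) b(1) by blast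
    have "b \<in> touch Q" using b(1) c Q(2) by (auto simp: touch_def)
    then have "Q \<notin> bad" using b(2) by blast
    then have "Q \<noteq> Z \<and> \<not> red_adjacent S Z Q" using Z(1) Q(1) by (auto simp: bad_def nbr_def)
    then have "atomic_type S (\<rho> z) (\<kappa> c) = atomic_type S (\<rho> z') (\<kappa> c)"
      using Z Q(2) unfolding red_adjacent_def by blast
    then show "e z c = e z' c" by (rule entry)
  qed
  have cover: "\<exists>Z\<in>B. \<rho> z \<in> Z" if z: "z \<in> I" for z
  proof (cases "\<rho> z \<in> P")
    case True
    then show ?thesis by (auto simp: B_def)
  next
    case False
    obtain lo hi where lh: "\<rho> lo \<in> P" "\<rho> hi \<in> P" "lo \<le> z" "z \<le> hi"
      using P(2) z unfolding spans_def by blast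
    then have "lo \<noteq> z" "z \<noteq> hi" using False by auto
    then have "atomic_type S (\<rho> lo) (\<rho> z) \<noteq> atomic_type S (\<rho> hi) (\<rho> z)" using lh mono by simp
    moreover obtain Z where Z: "Z \<in> L'" "\<rho> z \<in> Z" using I(1) z by blast
    moreover have "Z \<noteq> P" using Z False by blast
    ultimately have "red_adjacent S P Z" unfolding red_adjacent_def using lh by blast
    then show ?thesis using Z by (auto simp: B_def nbr_def)
  qed
  have "row_trace e (J b) ` I \<subseteq> (\<Union>Z\<in>B. row_trace e (J b) ` {z \<in> I. \<rho> z \<in> Z})" using cover by blast
  then have "card (row_trace e (J b) ` I) \<le> card (\<Union>Z\<in>B. row_trace e (J b) ` {z \<in> I. \<rho> z \<in> Z})"
    using B(2) I(2) by (intro card_mono) auto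
  also have "\<dots> \<le> (\<Sum>Z\<in>B. card (row_trace e (J b) ` {z \<in> I. \<rho> z \<in> Z}))" by (rule card_UN_le[OF B(2)])
  also have "\<dots> \<le> (\<Sum>Z\<in>B. 1)"
  proof (rule sum_mono)
    fix Z assume Z: "Z \<in> B"
    show "card (row_trace e (J b) ` {z \<in> I. \<rho> z \<in> Z}) \<le> 1"
    proof (cases "{z \<in> I. \<rho> z \<in> Z} = {}")
      case False
      then obtain z0 where z0: "z0 \<in> I" "\<rho> z0 \<in> Z" by blast
      have "row_trace e (J b) ` {z \<in> I. \<rho> z \<in> Z} \<subseteq> {row_trace e (J b) z0}"
        using trace[OF Z _ z0(2)] by blast
      then have "card (row_trace e (J b) ` {z \<in> I. \<rho> z \<in> Z}) \<le> card {row_trace e (J b) z0}"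
        by (rule card_mono[rotated]) simp
      then show ?thesis by simp
    next
      case True
      then show ?thesis by (simp only: image_empty card.empty)
    qed
  qed
  also have "\<dots> \<le> d + 1" using B(1) by simp
  finally show ?thesis using b(1) by blast
qed

text \<open>Zero outside the dimensions, where \<open>A $$\<close> is unspecified. Hence the atomic
  type determines this value for all indices.\<close>

definition entry_bit :: "bit mat \<Rightarrow> nat \<Rightarrow> nat \<Rightarrow> bit" where
  "entry_bit A r c = of_bool (entry_rel A (Inl r) (Inr c))"

lemma entry_bit_eq: "\<lbrakk>r < dim_row A; c < dim_col A\<rbrakk> \<Longrightarrow> entry_bit A r c = A $$ (r, c)"
  by (cases "A $$ (r, c)") (simp_all add: entry_bit_def)

lemma atomic_type_matrix_structure:
  "atomic_type (matrix_structure A) u v = atomic_type (matrix_structure A) u' v' \<longleftrightarrow>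
     isl u = isl u' \<and> isl v = isl v' \<and> row_column_le u v = row_column_le u' v' \<and>
     row_column_le v u = row_column_le v' u' \<and>
     entry_rel A u v = entry_rel A u' v' \<and> entry_rel A v u = entry_rel A v' u'"
proof -
  have un: "{i. unary (matrix_structure A) i w} = (if isl w then {Is_Row} else {})" for w
    by (auto simp: matrix_structure_def split: unary_symbol.splits) (metis unary_symbol.exhaust)
  have bin: "{j. binary (matrix_structure A) j w z} = {j. j = Order \<and> row_column_le w z \<or> j =
      Entry \<and> entry_rel A w z}"
    for w z
  proof (rule Collect_cong)
    fix j
    show "binary (matrix_structure A) j w z \<longleftrightarrow>
      j = Order \<and> row_column_le w z \<or> j = Entry \<and> entry_rel A w z"
      by (cases j) (simp_all add: matrix_structure_def)
  qed
  have coll: "{j. j = Order \<and> a \<or> j = Entry \<and> b} = {j. j = Order \<and> a' \<or> j = Entry \<and> b'} \<longleftrightarrow> a = a'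
      \<and> b = b'"
    for a b a' b' by (auto simp: set_eq_iff)
  show ?thesis unfolding atomic_type_def un bin prod.inject coll by auto
qed

lemma block_sums_identity_trace_bound:
  assumes "block_sums A (mat (t * s) (t * s) (\<lambda>(i, j). if i mod s = j mod s then 1 else 0)) x y"
  shows "\<And>i j. \<lbrakk>i < t * s; j < t * s\<rbrakk> \<Longrightarrow>
      (\<Sum>r\<in>x i. \<Sum>c\<in>y j. entry_bit A r c) = (if i mod s = j mod s then 1 else 0)"
    and "ordered_blocks (t * s) x" and "ordered_blocks (t * s) y"
    and "\<And>i. i < t * s \<Longrightarrow> x i \<subseteq> {..<dim_row A}" and "\<And>j. j < t * s \<Longrightarrow> y j \<subseteq> {..<dim_col A}"
proof -
  show xy: "\<And>i. i < t * s \<Longrightarrow> x i \<subseteq> {..<dim_row A}" "\<And>j. j < t * s \<Longrightarrow> y j \<subseteq> {..<dim_col A}"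
    and "ordered_blocks (t * s) x" "ordered_blocks (t * s) y"
    using assms by (simp_all add: block_sums_def)
  fix i j assume ij: "i < t * s" "j < t * s"
  have "(\<Sum>r\<in>x i. \<Sum>c\<in>y j. entry_bit A r c) = (\<Sum>r\<in>x i. \<Sum>c\<in>y j. A $$ (r, c))"
    by (intro sum.cong refl entry_bit_eq) (use xy(1)[OF ij(1)] xy(2)[OF ij(2)] in auto)
  also have "\<dots> = (if i mod s = j mod s then 1 else 0)"
    using assms ij unfolding block_sums_def by simp
  finally show "(\<Sum>r\<in>x i. \<Sum>c\<in>y j. entry_bit A r c) = (if i mod s = j mod s then 1 else 0)" .
qed

lemma group_index_less:
  fixes s t :: nat
  assumes "a < t" "u < s"
  shows "a * s + u < t * s"
proof -
  have "a * s + u < Suc a * s" using assms by simp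
  also have "\<dots> \<le> t * s" using assms by (intro mult_le_mono1) simp
  finally show ?thesis .
qed

text \<open>For s at least 2 a group contains two different lines, while a singleton reaches from a
  line only to itself.\<close>

lemma singleton_not_spans:
  assumes x: "ordered_blocks (t * s) x" and ne: "\<And>i. i < t * s \<Longrightarrow> x i \<noteq> {}"
    and "a < t" and "2 \<le> s" and "inj \<rho>"
  shows "\<not> spans \<rho> {v} (\<Union>u<s. x (a * s + u))"
proof
  assume "spans \<rho> {v} (\<Union>u<s. x (a * s + u))"
  then obtain lo hi where lh: "\<rho> lo = v" "\<rho> hi = v" "\<forall>z\<in>(\<Union>u<s. x (a * s + u)). lo \<le> z \<and> z \<le> hi"
    unfolding spans_def by (elim exE conjE) simp
  have "lo = hi" using injD[OF \<open>inj \<rho>\<close>, of lo hi] lh(1,2) by simp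
  have s: "0 < s" "1 < s" using \<open>2 \<le> s\<close> by simp_all
  have lt: "a * s + 0 < t * s" "a * s + 1 < t * s"
    by (rule group_index_less[OF \<open>a < t\<close> s(1)], rule group_index_less[OF \<open>a < t\<close> s(2)])
  obtain z where z0: "z \<in> x (a * s + 0)" using ne[OF lt(1)] by (meson ex_in_conv)
  obtain z' where z1: "z' \<in> x (a * s + 1)" using ne[OF lt(2)] by (meson ex_in_conv)
  note z = z0 z1
  have "z \<in> (\<Union>u<s. x (a * s + u))" "z' \<in> (\<Union>u<s. x (a * s + u))"
    using z s by (intro UN_I[of 0] UN_I[of 1]; simp)+
  then have "lo \<le> z \<and> z \<le> hi" "lo \<le> z' \<and> z' \<le> hi" using lh(3) by - (erule bspec, assumption)+
  then have "z = lo" "z' = lo" using \<open>lo = hi\<close> by simp_all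
  moreover have "z < z'" by (rule ordered_blocksD[OF x _ lt(2) z]) simp
  ultimately show False by simp
qed

theorem bounded_twin_width_imp_parity_minor_free:
  assumes "bounded_twin_width \<M>"
  shows "parity_minor_free \<M>"
proof -
  obtain d where d: "\<And>A. A \<in> \<M> \<Longrightarrow> twin_width (matrix_structure A) \<le> d"
    using assms unfolding bounded_twin_width_def by blast
  \<comment> \<open>s is just above the bound of \<open>block_identity_trace_bound\<close> for d + 1
    traces, and t is just large enough for \<open>few_traces_when_spanning\<close>.\<close>
  define s where "s = (2::nat) ^ (d + 1) + 1"
  define t where "t = 4 * (d + 1) ^ 2 + 1"
  have s2: "2 \<le> s" by (simp add: s_def)
  define N :: "bit mat" where "N = mat (t * s) (t * s) (\<lambda>(i, j). if i mod s = j mod s then 1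
      else 0)"
  have "\<not> parity_minor N A" if A: "A \<in> \<M>" for A
  proof
    assume "parity_minor N A"
    then obtain x y where "block_sums A N x y" using parity_minor_imp_block_sums by blast
    note xy = block_sums_identity_trace_bound[OF this[unfolded N_def]]
    let ?S = "matrix_structure A" and ?e = "entry_bit A"
    define I where "I a = (\<Union>u<s. x (a * s + u))" for a
    define J where "J b = (\<Union>v<s. y (b * s + v))" for b
    have IJ: "ordered_blocks t I" "ordered_blocks t J"
      unfolding I_def J_def by (rule ordered_blocks_group[OF xy(2)] ordered_blocks_group[OF
          xy(3)]; simp)+
    have sub: "I a \<subseteq> {..<dim_row A}" "J a \<subseteq> {..<dim_col A}" if "a < t" for a
      using xy(4,5)[OF group_index_less[OF that]] unfolding I_def J_def by blast+
    have fin: "finite (I a)" "finite (J a)" if "a < t" for a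
      by (rule finite_subset[OF sub(1)[OF that]] finite_subset[OF sub(2)[OF that]]; simp)+
    have ne: "x i \<noteq> {} \<and> y i \<noteq> {}" if "i < t * s" for i
    proof (rule ccontr)
      assume "\<not> ?thesis"
      then have "(\<Sum>r\<in>x i. \<Sum>c\<in>y i. ?e r c) = 0" by auto
      then show False using xy(1)[OF that that] by simp
    qed
    have pts: "points ?S = {..<dim_row A} <+> {..<dim_col A}" by (simp add: matrix_structure_def)
    have "finite (points ?S)" by (simp add: pts)
    from twin_width_witness[OF this] obtain Ps where Ps: "contraction_sequence (points ?S) Ps"
      and deg_tw: "\<forall>P\<in>set Ps. \<forall>X\<in>P. red_degree ?S P X \<le> twin_width ?S" by (elim exE conjE)
    have deg: "red_degree ?S P X \<le> d" if "P \<in> set Ps" "X \<in> P" for P X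
      using deg_tw that d[OF A] by (meson le_trans)
    \<comment> \<open>Rows and columns are watched together: whichever side is spanned after the
      merge from L to L', no part of L spans a group of the other side.\<close>
    define hit where "hit L \<longleftrightarrow> (\<exists>P\<in>L. \<exists>a<t. spans Inl P (I a) \<or> spans Inr P (J a))" for L
    have seq: "Ps \<noteq> []" "hd Ps = (\<lambda>v. {v}) ` points ?S" "successively merges_to Ps"
      "last Ps = {points ?S} - {{}}" using Ps by (simp_all add: contraction_sequence_def)
    have "0 < t" by (simp add: t_def)
    have "\<not> spans Inl {v} (I a)" "\<not> spans Inr {v} (J a)" if "a < t" for a and v :: "nat + nat"
      unfolding I_def J_def
      by (rule singleton_not_spans[OF xy(2) _ that s2] singleton_not_spans[OF xy(3) _ that s2];
          simp add: ne)+
    then have "\<not> hit (hd Ps)" unfolding seq(2) hit_def by simp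
    moreover have "hit (last Ps)"
    proof -
      have "0 < t * s" using \<open>0 < t\<close> s2 by simp
      then have "x 0 \<noteq> {}" "x 0 \<subseteq> {..<dim_row A}" using ne xy(4) by simp_all
      then have "0 < dim_row A" by (cases "dim_row A = 0") simp_all
      then have "spans Inl (points ?S) (I 0)" unfolding spans_def pts using sub(1)[OF \<open>0 < t\<close>]
        by (intro exI[of _ 0] exI[of _ "dim_row A - 1"]) auto
      moreover have "points ?S \<noteq> {}" unfolding pts using \<open>0 < dim_row A\<close> by auto
      ultimately show ?thesis unfolding hit_def seq(4) using \<open>0 < t\<close> by auto
    qed
    ultimately obtain L L' where L: "merges_to L L'" "L \<in> set Ps" "L' \<in> set Ps" "\<not> hit L" "hit L'"
      using successively_first[OF seq(1,3)] by blast
    have inv: "\<forall>L\<in>set Ps. finite L \<and> \<Union>L = points ?S"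
    proof (rule successively_invariant[OF seq(1,3)])
      show "finite (hd Ps) \<and> \<Union>(hd Ps) = points ?S" unfolding seq(2) by (simp add: pts)
      show "finite L' \<and> \<Union>L' = points ?S" if "merges_to L L'" "finite L \<and> \<Union>L = points ?S" for L L'
        using that unfolding merges_to_def by auto
    qed
    have L': "finite L'" "\<Union>L' = points ?S" using inv L(3) by blast+
    obtain P a where P: "P \<in> L'" "a < t" "spans Inl P (I a) \<or> spans Inr P (J a)"
      using L(5) unfolding hit_def by blast
    have t: "4 * (d + 1) ^ 2 < t" by (simp add: t_def)
    from P(3) show False
    proof
      assume sp: "spans Inl P (I a)"
      have "\<exists>b<t. card (row_trace ?e (J b) ` I a) \<le> d + 1"
      proof (rule few_traces_when_spanning[OF _ _ L(1) L'(1) deg[OF L(3)] _ fin(1)[OF P(2)] _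
          IJ(2) P(1) sp _ t])
        show "atomic_type ?S (Inl lo) (Inl z) \<noteq> atomic_type ?S (Inl hi) (Inl z)" if "lo < z" "z
            < hi" for lo z hi
          using that by (simp add: atomic_type_matrix_structure)
        show "?e z c = ?e z' c" if "atomic_type ?S (Inl z) (Inr c) = atomic_type ?S (Inl z')
            (Inr c)" for z z' c
          using that by (simp add: atomic_type_matrix_structure entry_bit_def)
        show "Inl z \<in> \<Union>L'" if "z \<in> I a" for z using that sub(1)[OF P(2)] L'(2) pts by auto
        show "Inr c \<in> \<Union>L'" if "b < t" "c \<in> J b" for b c using that sub(2)[OF that(1)] L'(2) pts
            by auto
        show "\<not> spans Inr Q (J b)" if "Q \<in> L" "b < t" for Q b using L(4) that unfolding hit_def
            by blast
      qed
      then obtain b where b: "b < t" "card (row_trace ?e (J b) ` I a) \<le> d + 1" by blast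
      have "s \<le> 2 ^ (d + 1)"
        by (rule block_identity_trace_bound[OF xy(1) P(2) b(1) fin(1)[OF P(2), unfolded I_def]
            b(2)[unfolded I_def J_def]])
      then show False by (simp add: s_def)
    next
      assume sp: "spans Inr P (J a)"
      let ?e' = "\<lambda>c r. ?e r c"
      have "\<exists>b<t. card (row_trace ?e' (I b) ` J a) \<le> d + 1"
      proof (rule few_traces_when_spanning[OF _ _ L(1) L'(1) deg[OF L(3)] _ fin(2)[OF P(2)] _
          IJ(1) P(1) sp _ t])
        show "atomic_type ?S (Inr lo) (Inr z) \<noteq> atomic_type ?S (Inr hi) (Inr z)" if "lo < z" "z
            < hi" for lo z hi
          using that by (simp add: atomic_type_matrix_structure)
        show "?e' z c = ?e' z' c" if "atomic_type ?S (Inr z) (Inl c) = atomic_type ?S (Inr z')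
            (Inl c)" for z z' c
          using that by (simp add: atomic_type_matrix_structure entry_bit_def)
        show "Inr z \<in> \<Union>L'" if "z \<in> J a" for z using that sub(2)[OF P(2)] L'(2) pts by auto
        show "Inl c \<in> \<Union>L'" if "b < t" "c \<in> I b" for b c using that sub(1)[OF that(1)] L'(2) pts
            by auto
        show "\<not> spans Inl Q (I b)" if "Q \<in> L" "b < t" for Q b using L(4) that unfolding hit_def
            by blast
      qed
      then obtain b where b: "b < t" "card (row_trace ?e' (I b) ` J a) \<le> d + 1" by blast
      have sums: "(\<Sum>c\<in>y j. \<Sum>r\<in>x i. ?e' c r) = (if j mod s = i mod s then 1 else 0)"
        if "j < t * s" "i < t * s" for i j
        using xy(1)[OF that(2,1)] by (subst sum.swap) auto
      have "s \<le> 2 ^ (d + 1)"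
        by (rule block_identity_trace_bound[OF sums P(2) b(1) fin(2)[OF P(2), unfolded J_def]
            b(2)[unfolded I_def J_def]])
      then show False by (simp add: s_def)
    qed
  qed
  then show ?thesis unfolding parity_minor_free_def by blast
qed

subsection \<open>Divisions into intervals\<close>

text \<open>A division into intervals is encoded by its set S of cuts, a cut s lying just before
  line s. The value numbers the interval that contains r, and removing one cut merges two
  neighbouring intervals. A cut at 0 leaves interval 0 empty.\<close>

definition cut_index :: "nat set \<Rightarrow> nat \<Rightarrow> nat" where
  "cut_index S r = card {s \<in> S. s \<le> r}"

lemma cut_index_empty [simp]: "cut_index {} r = 0"
  by (simp add: cut_index_def)

lemma cut_index_le_card: "finite S \<Longrightarrow> cut_index S r \<le> card S"
  unfolding cut_index_def by (intro card_mono) auto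

lemma mono_cut_index: "finite S \<Longrightarrow> mono (cut_index S)"
  unfolding cut_index_def by (intro monoI card_mono) auto

lemma cut_index_eqD:
  assumes "finite S" and "cut_index S r = cut_index S r'"
  shows "{s \<in> S. s \<le> r} = {s \<in> S. s \<le> r'}"
proof -
  have *: "{s \<in> S. s \<le> a} = {s \<in> S. s \<le> b}" if "a \<le> b" "cut_index S a = cut_index S b" for a b
    by (rule card_subset_eq) (use that assms(1) in \<open>auto simp: cut_index_def\<close>)
  show ?thesis
  proof (cases "r \<le> r'")
    case True
    then show ?thesis by (rule *[OF _ assms(2)])
  next
    case False
    then have "r' \<le> r" by simp
    from *[OF this assms(2)[symmetric]] show ?thesis by (rule sym)
  qed
qed

lemma cut_index_subset:
  assumes "finite S" and "S' \<subseteq> S" and "cut_index S r = cut_index S r'"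
  shows "cut_index S' r = cut_index S' r'"
proof -
  have "{s \<in> S'. s \<le> a} = {s \<in> S. s \<le> a} \<inter> S'" for a using assms(2) by auto
  then show ?thesis using cut_index_eqD[OF assms(1,3)] by (simp add: cut_index_def)
qed

text \<open>\<open>cut_index S'\<close> factors through \<open>cut_index S\<close>.\<close>

lemma card_cut_index_image_subset:
  assumes "finite S" and "S' \<subseteq> S" and "finite Z"
  shows "card (cut_index S' ` Z) \<le> card (cut_index S ` Z)"
proof -
  define g where "g j = cut_index S' (SOME z. z \<in> Z \<and> cut_index S z = j)" for j
  have "cut_index S' z = g (cut_index S z)" if "z \<in> Z" for z
  proof -
    have "\<exists>z'. z' \<in> Z \<and> cut_index S z' = cut_index S z" using that by blast
    from someI_ex[OF this] show ?thesis
      unfolding g_def by (intro cut_index_subset[OF assms(1,2)]) simp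
  qed
  then have "cut_index S' ` Z = g ` cut_index S ` Z" unfolding image_image by (rule
      image_cong[OF refl])
  moreover have "card (g ` cut_index S ` Z) \<le> card (cut_index S ` Z)"
    by (intro card_image_le finite_imageI assms(3))
  ultimately show ?thesis by (simp only:)
qed

lemma cut_index_remove:
  assumes "finite S" and "s \<in> S"
  shows "cut_index S r = cut_index (S - {s}) r + (if s \<le> r then 1 else 0)"
proof -
  have "{a \<in> S. a \<le> r} = (if s \<le> r then insert s {a \<in> S - {s}. a \<le> r} else {a \<in> S - {s}. a \<le> r})"
    using assms(2) by auto
  then show ?thesis using assms(1) by (simp add: cut_index_def)
qed

text \<open>On the cuts themselves the index is injective with values from 1 to
  \<open>card S\<close>.\<close>

lemma cut_index_surj:
  assumes "finite S" and "1 \<le> i" and "i \<le> card S"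
  shows "\<exists>s\<in>S. cut_index S s = i"
proof -
  have "inj_on (cut_index S) S"
  proof (rule inj_onI)
    fix a b assume ab: "a \<in> S" "b \<in> S" "cut_index S a = cut_index S b"
    have "a \<in> {s \<in> S. s \<le> b}" "b \<in> {s \<in> S. s \<le> a}"
      using cut_index_eqD[OF assms(1) ab(3)] ab(1,2) by auto
    then show "a = b" by simp
  qed
  moreover have "cut_index S ` S \<subseteq> {1..card S}"
  proof
    fix j assume "j \<in> cut_index S ` S"
    then obtain s where s: "s \<in> S" "j = cut_index S s" by blast
    have "s \<in> {a \<in> S. a \<le> s}" using s(1) by simp
    then have "cut_index S s \<noteq> 0" unfolding cut_index_def using assms(1) by auto
    then show "j \<in> {1..card S}" using s(2) cut_index_le_card[OF assms(1), of s] by simp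
  qed
  ultimately have "cut_index S ` S = {1..card S}"
    by (intro card_subset_eq) (simp_all add: card_image)
  then have "i \<in> cut_index S ` S" using assms(2,3) by simp
  then show ?thesis by blast
qed

definition cut_part :: "nat \<Rightarrow> nat set \<Rightarrow> nat \<Rightarrow> nat set" where
  "cut_part p S r = {r'. r' < p \<and> cut_index S r' = cut_index S r}"

lemma finite_cut_part [simp]: "finite (cut_part p S r)"
  by (simp add: cut_part_def)

lemma cut_part_mono: "\<lbrakk>finite S; S' \<subseteq> S\<rbrakk> \<Longrightarrow> cut_part p S r \<subseteq> cut_part p S' r"
  unfolding cut_part_def by (auto intro: cut_index_subset)

lemma cut_part_cong: "cut_index S r = cut_index S r' \<Longrightarrow> cut_part p S r = cut_part p S r'"
  by (simp add: cut_part_def)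

lemma cut_part_remove_other:
  assumes "finite S" and "s \<in> S" and "cut_index (S - {s}) r \<noteq> cut_index (S - {s}) s"
  shows "cut_part p (S - {s}) r \<subseteq> cut_part p S r"
proof
  fix r' assume r': "r' \<in> cut_part p (S - {s}) r"
  then have eq: "cut_index (S - {s}) r' = cut_index (S - {s}) r" by (simp add: cut_part_def)
  have mono: "cut_index (S - {s}) a \<le> cut_index (S - {s}) b" if "a \<le> b" for a b
    using mono_cut_index[of "S - {s}"] assms(1) that by (simp add: monoD)
  have "s \<le> r' \<longleftrightarrow> s \<le> r"
    using mono[of s r] mono[of r s] mono[of s r'] mono[of r' s] eq assms(3) by linarith
  then have "cut_index S r' = cut_index S r"
    unfolding cut_index_remove[OF assms(1,2)] using eq by simp
  then show "r' \<in> cut_part p S r" using r' by (simp add: cut_part_def)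
qed

text \<open>The cut of index 2 * j + 1 is the one between the intervals 2 * j and 2 * j + 1, which
  \<open>div 2\<close> pairs up.\<close>

lemma cut_part_remove_merged:
  assumes "finite S" and "s \<in> S" and "cut_index S s = 2 * j + 1"
    and "cut_index (S - {s}) r = cut_index (S - {s}) s"
  shows "cut_part p (S - {s}) r \<subseteq> {r. r < p \<and> cut_index S r div 2 = j}"
proof
  fix r' assume "r' \<in> cut_part p (S - {s}) r"
  then have "r' < p" "cut_index (S - {s}) r' = cut_index (S - {s}) s"
    using assms(4) by (simp_all add: cut_part_def)
  moreover have "cut_index (S - {s}) s = 2 * j"
    using cut_index_remove[OF assms(1,2), of s] assms(3) by simp
  ultimately show "r' \<in> {r. r < p \<and> cut_index S r div 2 = j}"
    using cut_index_remove[OF assms(1,2), of r'] by simp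
qed

section \<open>Traces, complex zones and poor parts\<close>

abbreviation (input) transposed :: "('a \<Rightarrow> 'b \<Rightarrow> 'c) \<Rightarrow> 'b \<Rightarrow> 'a \<Rightarrow> 'c" where
  "transposed e \<equiv> \<lambda>c r. e r c"

lemma card_row_traces_mono:
  assumes "finite X'" and "X \<subseteq> X'" and "Y \<subseteq> Y'"
  shows "card (row_trace e Y ` X) \<le> card (row_trace e Y' ` X')"
proof -
  have "row_trace e Y r = row_trace e Y' r \<inter> Y" for r using assms(3) by (auto simp: row_trace_def)
  then have "row_trace e Y ` X = (\<lambda>w. w \<inter> Y) ` row_trace e Y' ` X"
    unfolding image_image by (intro image_cong refl)
  moreover have "card ((\<lambda>w. w \<inter> Y) ` row_trace e Y' ` X) \<le> card (row_trace e Y' ` X)"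
    by (intro card_image_le finite_imageI finite_subset[OF assms(2,1)])
  ultimately have "card (row_trace e Y ` X) \<le> card (row_trace e Y' ` X)" by (simp only:)
  also have "\<dots> \<le> card (row_trace e Y' ` X')"
    using assms(1,2) by (intro card_mono finite_imageI image_mono)
  finally show ?thesis .
qed

text \<open>Columns with the same trace on X agree in every row of X, so the trace of a row is a
  union of classes of equal columns.\<close>

lemma card_row_traces_le_power:
  assumes "finite X" and "finite Y"
  shows "card (row_trace e Y ` X) \<le> 2 ^ card (row_trace (transposed e) X ` Y)"
proof -
  let ?col = "row_trace (transposed e) X"
  have "row_trace e Y ` X \<subseteq> (\<lambda>W. {c \<in> Y. ?col c \<in> W}) ` Pow (?col ` Y)"
  proof
    fix w assume "w \<in> row_trace e Y ` X"
    then obtain r where r: "r \<in> X" "w = row_trace e Y r" by blast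
    have "w = {c \<in> Y. ?col c \<in> ?col ` w}"
    proof (intro subset_antisym subsetI)
      fix c assume "c \<in> {c \<in> Y. ?col c \<in> ?col ` w}"
      then obtain c' where c: "c \<in> Y" "c' \<in> w" "?col c = ?col c'" by blast
      have "e r c = e r c'" using c(3) r(1) unfolding row_trace_eq_iff by blast
      then show "c \<in> w" using c(1,2) r(2) by (simp add: row_trace_def)
    qed (use r in \<open>auto simp: row_trace_def\<close>)
    moreover have "?col ` w \<in> Pow (?col ` Y)" using r(2) by (auto simp: row_trace_def)
    ultimately show "w \<in> (\<lambda>W. {c \<in> Y. ?col c \<in> W}) ` Pow (?col ` Y)" by (rule image_eqI)
  qed
  then have "card (row_trace e Y ` X) \<le> card (Pow (?col ` Y))"
    using assms(2) by (intro surj_card_le) auto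
  then show ?thesis using assms(2) by (simp add: card_Pow)
qed

text \<open>Requiring both directions makes the notion symmetric under transposition. A zone that is
  not complex still has few traces either way, because each count is at most exponential in the
  other.\<close>

definition complex_zone :: "nat \<Rightarrow> (nat \<Rightarrow> nat \<Rightarrow> bit) \<Rightarrow> nat set \<Rightarrow> nat set \<Rightarrow> bool" where
  "complex_zone q e X Y \<longleftrightarrow>
     q < card (row_trace e Y ` X) \<and> q < card (row_trace (transposed e) X ` Y)"

lemma complex_zone_transposed: "complex_zone q (transposed e) Y X \<longleftrightarrow> complex_zone q e X Y"
  unfolding complex_zone_def by blast

lemma complex_zone_mono:
  assumes "complex_zone q e X Y" and "X \<subseteq> X'" and "Y \<subseteq> Y'" and "finite X'" and "finite Y'"
  shows "complex_zone q e X' Y'"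
  using assms(1) card_row_traces_mono[OF assms(4,2,3), of e]
    card_row_traces_mono[OF assms(5,3,2), of "transposed e"]
  unfolding complex_zone_def by linarith

lemma not_complex_zone_card:
  assumes "\<not> complex_zone q e X Y" and "finite X" and "finite Y"
  shows "card (row_trace e Y ` X) \<le> 2 ^ q"
proof (cases "q < card (row_trace e Y ` X)")
  case True
  then have "card (row_trace (transposed e) X ` Y) \<le> q" using assms(1) by (simp add:
      complex_zone_def)
  then have "(2::nat) ^ card (row_trace (transposed e) X ` Y) \<le> 2 ^ q" by (rule
      power_increasing) simp
  then show ?thesis using card_row_traces_le_power[OF assms(2,3), of e] by linarith
next
  case False
  then show ?thesis using less_exp[of q] by linarith
qed

text \<open>The negation of the richness that \<open>rich_division_imp_patterns\<close> asks of a
  part: Z is a set of columns to be ignored, measured by the number of intervals it meets.\<close>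

definition poor :: "nat \<Rightarrow> nat \<Rightarrow> (nat \<Rightarrow> nat \<Rightarrow> bit) \<Rightarrow> nat \<Rightarrow> nat set \<Rightarrow> nat set \<Rightarrow> bool" where
  "poor k q e n Sc X \<longleftrightarrow> (\<exists>Z\<subseteq>{..<n}. card (cut_index Sc ` Z) \<le> k \<and> card (row_trace e ({..<n} - Z)
      ` X) \<le> q)"

lemma poor_mono:
  assumes "poor k q e n Sc X" and "X' \<subseteq> X" and "finite X" and "finite Sc" and "Sc' \<subseteq> Sc"
  shows "poor k q e n Sc' X'"
proof -
  obtain Z where Z: "Z \<subseteq> {..<n}" "card (cut_index Sc ` Z) \<le> k" "card (row_trace e ({..<n} - Z) `
      X) \<le> q"
    using assms(1) unfolding poor_def by blast
  have "card (cut_index Sc' ` Z) \<le> k"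
    using card_cut_index_image_subset[OF assms(4,5) finite_subset[OF Z(1)]] Z(2) by simp
  moreover have "card (row_trace e ({..<n} - Z) ` X') \<le> q"
    using card_row_traces_mono[OF assms(3,2) subset_refl, of e "{..<n} - Z"] Z(3) by linarith
  ultimately show ?thesis unfolding poor_def using Z(1) by blast
qed

definition complex_indices :: "nat \<Rightarrow> (nat \<Rightarrow> nat \<Rightarrow> bit) \<Rightarrow> nat \<Rightarrow> nat set \<Rightarrow> nat set \<Rightarrow> nat set" where
  "complex_indices q e n Sc X = cut_index Sc ` {c. c < n \<and> complex_zone q e X (cut_part n Sc c)}"

lemma complex_zone_outside:
  assumes "c < n" and "cut_index Sc c \<notin> cut_index Sc ` Z" and "finite X"
    and "card (row_trace e ({..<n} - Z) ` X) \<le> q"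
  shows "\<not> complex_zone q e X (cut_part n Sc c)"
proof -
  have "cut_part n Sc c \<subseteq> {..<n} - Z"
  proof
    fix c' assume c': "c' \<in> cut_part n Sc c"
    then have "cut_index Sc c' = cut_index Sc c" by (simp add: cut_part_def)
    then have "c' \<notin> Z" using assms(2) by (metis imageI)
    then show "c' \<in> {..<n} - Z" using c' by (simp add: cut_part_def)
  qed
  from card_row_traces_mono[OF assms(3) subset_refl this, of e] assms(4)
  show ?thesis by (simp add: complex_zone_def)
qed

text \<open>On an interval that avoids Z there are at most q row traces, so complex zones occur only
  at the at most k intervals that Z meets.\<close>

lemma card_complex_indices:
  assumes "poor k q e n Sc X" and "finite X"
  shows "card (complex_indices q e n Sc X) \<le> k"
proof -
  obtain Z where Z: "Z \<subseteq> {..<n}" "card (cut_index Sc ` Z) \<le> k" "card (row_trace e ({..<n} - Z) `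
      X) \<le> q"
    using assms(1) unfolding poor_def by blast
  have "complex_indices q e n Sc X \<subseteq> cut_index Sc ` Z"
    unfolding complex_indices_def using complex_zone_outside[OF _ _ assms(2) Z(3)] by blast
  moreover have "finite (cut_index Sc ` Z)" using Z(1) finite_subset by blast
  ultimately show ?thesis using Z(2) card_mono le_trans by blast
qed

section \<open>Labels of lines\<close>

definition simple_trace :: "nat \<Rightarrow> (nat \<Rightarrow> nat \<Rightarrow> bit) \<Rightarrow> nat \<Rightarrow> nat \<Rightarrow> nat set \<Rightarrow> nat set \<Rightarrow> nat \<Rightarrow> nat
    set" where
  "simple_trace q e p n Sr Sc r =
     {c. c < n \<and> \<not> complex_zone q e (cut_part p Sr r) (cut_part n Sc c) \<and> e r c = 1}"

text \<open>Lines with equal labels will form the parts of the partition: the index keeps them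
  within one interval, and the trace makes them agree on all zones that are not complex.\<close>

definition line_label :: "nat \<Rightarrow> (nat \<Rightarrow> nat \<Rightarrow> bit) \<Rightarrow> nat \<Rightarrow> nat \<Rightarrow> nat set \<Rightarrow> nat set \<Rightarrow> nat \<Rightarrow> nat \<times>
    nat set" where
  "line_label q e p n Sr Sc r = (cut_index Sr r, simple_trace q e p n Sr Sc r)"

text \<open>A label is determined by the trace outside Z, with at most q values, and by the traces
  on the simple zones among the at most k intervals meeting Z, with at most 2^q values each.\<close>

lemma card_labels_in_part:
  assumes "poor k q e n Sc (cut_part p Sr r0)"
  shows "card (line_label q e p n Sr Sc ` cut_part p Sr r0) \<le> q * (2 ^ q) ^ k"
proof -
  define X where "X = cut_part p Sr r0"
  have X: "finite X" by (simp add: X_def)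
  obtain Z where Z: "Z \<subseteq> {..<n}" "card (cut_index Sc ` Z) \<le> k" "card (row_trace e ({..<n} - Z) `
      X) \<le> q"
    using assms unfolding poor_def X_def by blast
  define C where "C j = {c. c < n \<and> cut_index Sc c = j}" for j
  have C: "C (cut_index Sc c) = cut_part n Sc c" for c by (simp add: C_def cut_part_def)
  define W where "W = {j \<in> cut_index Sc ` Z. \<not> complex_zone q e X (C j)}"
  have finZ: "finite (cut_index Sc ` Z)" using Z(1) finite_subset by blast
  have W: "finite W" "card W \<le> k"
    using finZ card_mono[OF finZ, of W] Z(2) by (auto simp: W_def)
  \<comment> \<open>Reassembles a simple trace from the trace outside Z and those on the intervals
    in W; the pieces may overlap.\<close>
  define \<Phi> where "\<Phi> = (\<lambda>(A, F). {c \<in> A. \<not> complex_zone q e X (cut_part n Sc c)} \<union> (\<Union>j\<in>W. F j))"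
  define D where "D = row_trace e ({..<n} - Z) ` X \<times> (\<Pi>\<^sub>E j\<in>W. row_trace e (C j) ` X)"
  have finD: "finite D" unfolding D_def using X W(1) by (intro finite_cartesian_product
      finite_PiE) auto
  have "line_label q e p n Sr Sc ` X \<subseteq> (\<lambda>d. (cut_index Sr r0, \<Phi> d)) ` D"
  proof
    fix l assume "l \<in> line_label q e p n Sr Sc ` X"
    then obtain r where r: "r \<in> X" "l = line_label q e p n Sr Sc r" by blast
    have idx: "cut_index Sr r = cut_index Sr r0" using r(1) by (simp add: X_def cut_part_def)
    then have part: "cut_part p Sr r = X" unfolding X_def by (rule cut_part_cong)
    define d where "d = (row_trace e ({..<n} - Z) r, restrict (\<lambda>j. row_trace e (C j) r) W)"
    have "d \<in> D" using r(1) by (auto simp: d_def D_def)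
    moreover have "simple_trace q e p n Sr Sc r = \<Phi> d"
    proof (intro subset_antisym subsetI)
      fix c assume "c \<in> simple_trace q e p n Sr Sc r"
      then have c: "c < n" "\<not> complex_zone q e X (cut_part n Sc c)" "e r c = 1"
        by (simp_all add: simple_trace_def part)
      show "c \<in> \<Phi> d"
      proof (cases "c \<in> Z")
        case True
        then have "cut_index Sc c \<in> W" using c(2) by (simp add: W_def C)
        moreover have "c \<in> row_trace e (C (cut_index Sc c)) r"
          using c by (simp add: row_trace_def C_def)
        ultimately show ?thesis by (auto simp: \<Phi>_def d_def)
      next
        case False
        then show ?thesis using c by (simp add: \<Phi>_def d_def row_trace_def)
      qed
    next
      fix c assume "c \<in> \<Phi> d"
      then consider "c \<in> row_trace e ({..<n} - Z) r" "\<not> complex_zone q e X (cut_part n Sc c)"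
        | j where "j \<in> W" "c \<in> row_trace e (C j) r"
        by (auto simp: \<Phi>_def d_def)
      then show "c \<in> simple_trace q e p n Sr Sc r"
      proof cases
        case 1
        then show ?thesis by (simp add: simple_trace_def part row_trace_def)
      next
        case 2
        then have "c < n" "cut_index Sc c = j" "e r c = 1" by (simp_all add: row_trace_def C_def)
        moreover have "\<not> complex_zone q e X (C j)" using 2(1) by (simp add: W_def)
        ultimately show ?thesis using C[of c] by (simp add: simple_trace_def part)
      qed
    qed
    ultimately show "l \<in> (\<lambda>d. (cut_index Sr r0, \<Phi> d)) ` D"
      unfolding r(2) line_label_def idx by (intro image_eqI[of _ _ d]) simp_all
  qed
  then have "card (line_label q e p n Sr Sc ` X) \<le> card D" by (rule surj_card_le[OF finD])
  also have "\<dots> = card (row_trace e ({..<n} - Z) ` X) * (\<Prod>j\<in>W. card (row_trace e (C j) ` X))"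
    unfolding D_def by (simp add: card_cartesian_product card_PiE[OF W(1)])
  also have "\<dots> \<le> q * (\<Prod>j\<in>W. 2 ^ q)"
  proof (intro mult_le_mono Z(3) prod_mono conjI)
    fix j assume "j \<in> W"
    then show "card (row_trace e (C j) ` X) \<le> 2 ^ q"
      by (intro not_complex_zone_card X) (simp_all add: W_def C_def)
  qed simp
  also have "\<dots> \<le> q * (2 ^ q) ^ k" using W(2) by (simp add: power_increasing)
  finally show ?thesis by (simp add: X_def)
qed

subsection \<open>Partitions associated with a division\<close>

definition label_classes :: "(nat \<Rightarrow> 'a) \<Rightarrow> (nat \<Rightarrow> 'l) \<Rightarrow> nat \<Rightarrow> 'a set set" where
  "label_classes \<rho> f p = (\<lambda>r. \<rho> ` {r'. r' < p \<and> f r' = f r}) ` {..<p}"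

lemma label_classesE:
  assumes "Z \<in> label_classes \<rho> f p"
  obtains r where "r < p" "Z = \<rho> ` {r'. r' < p \<and> f r' = f r}"
  using assms unfolding label_classes_def by auto

lemma partition_on_label_classes:
  assumes "inj \<rho>"
  shows "partition_on (\<rho> ` {..<p}) (label_classes \<rho> f p)"
proof (rule partition_onI)
  show "\<Union>(label_classes \<rho> f p) = \<rho> ` {..<p}" unfolding label_classes_def by auto
  show "{} \<notin> label_classes \<rho> f p" unfolding label_classes_def by auto
  show "disjnt Y Z" if YZ: "Y \<in> label_classes \<rho> f p" "Z \<in> label_classes \<rho> f p" "Y \<noteq> Z" for Y Z
  proof -
    obtain r where r: "Y = \<rho> ` {r'. r' < p \<and> f r' = f r}" using YZ(1) by (rule label_classesE)
    obtain s where s: "Z = \<rho> ` {r'. r' < p \<and> f r' = f s}" using YZ(2) by (rule label_classesE)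
    have "f r \<noteq> f s" using YZ(3) r s by auto
    then show ?thesis unfolding disjnt_def r s image_Int[OF assms, symmetric] by auto
  qed
qed

lemma label_classes_coarsen:
  assumes "\<And>r r'. \<lbrakk>r < p; r' < p; f r = f r'\<rbrakk> \<Longrightarrow> g r = g r'" and "X \<in> label_classes \<rho> f p"
  shows "\<exists>Y\<in>label_classes \<rho> g p. X \<subseteq> Y"
proof -
  obtain r where r: "r < p" "X = \<rho> ` {r'. r' < p \<and> f r' = f r}" using assms(2) by (rule
      label_classesE)
  have "X \<subseteq> \<rho> ` {r'. r' < p \<and> g r' = g r}" unfolding r(2)
  proof (rule image_mono, rule subsetI)
    fix r' assume "r' \<in> {r'. r' < p \<and> f r' = f r}"
    then show "r' \<in> {r'. r' < p \<and> g r' = g r}" using assms(1)[of r' r] r(1) by simp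
  qed
  moreover have "\<rho> ` {r'. r' < p \<and> g r' = g r} \<in> label_classes \<rho> g p"
    unfolding label_classes_def using r(1) by blast
  ultimately show ?thesis by blast
qed

definition matrix_partition ::
    "nat \<Rightarrow> (nat \<Rightarrow> nat \<Rightarrow> bit) \<Rightarrow> nat \<Rightarrow> nat \<Rightarrow> nat set \<Rightarrow> nat set \<Rightarrow> (nat + nat) set set" where
  "matrix_partition q e p n Sr Sc =
     label_classes Inl (line_label q e p n Sr Sc) p \<union>
     label_classes Inr (line_label q (transposed e) n p Sc Sr) n"

lemma partition_on_matrix_partition:
  "partition_on ({..<p} <+> {..<n}) (matrix_partition q e p n Sr Sc)"
proof -
  let ?R = "label_classes Inl (line_label q e p n Sr Sc) p :: (nat + nat) set set"
  let ?C = "label_classes Inr (line_label q (transposed e) n p Sc Sr) n :: (nat + nat) set set"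
  have R: "partition_on (Inl ` {..<p}) ?R" and C: "partition_on (Inr ` {..<n}) ?C"
    by (rule partition_on_label_classes, simp)+
  have cross: "disjnt U V" if "U \<in> ?R" "V \<in> ?C" for U V
    using that by (elim label_classesE) (auto simp: disjnt_def)
  show ?thesis unfolding matrix_partition_def
  proof (rule partition_onI)
    show "\<Union>(?R \<union> ?C) = {..<p} <+> {..<n}"
      by (simp only: Union_Un_distrib Plus_def partition_onD1[OF R, symmetric] partition_onD1[OF
          C, symmetric])
    show "{} \<notin> ?R \<union> ?C" using partition_onD3[OF R] partition_onD3[OF C] by simp
    show "disjnt Y Z" if YZ: "Y \<in> ?R \<union> ?C" "Z \<in> ?R \<union> ?C" "Y \<noteq> Z" for Y Z
      using YZ(1,2)
    proof (elim UnE)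
      assume "Y \<in> ?R" "Z \<in> ?R"
      then show ?thesis using partition_onD2[OF R] YZ(3) by (simp add: pairwiseD)
    next
      assume "Y \<in> ?C" "Z \<in> ?C"
      then show ?thesis using partition_onD2[OF C] YZ(3) by (simp add: pairwiseD)
    next
      assume "Y \<in> ?R" "Z \<in> ?C"
      then show ?thesis by (rule cross)
    next
      assume "Y \<in> ?C" "Z \<in> ?R"
      then show ?thesis by (intro disjnt_sym[OF cross])
    qed
  qed
qed

text \<open>Removing cuts enlarges zones, and enlarging keeps complex zones complex. So a simple
  zone of the coarse division is made up of simple zones of the fine one, on which equal labels give
  equal entries.\<close>

lemma line_label_coarsen:
  assumes "finite Sr" "finite Sc" "Sr' \<subseteq> Sr" "Sc' \<subseteq> Sc" and "line_label q e p n Sr Sc r =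
      line_label q e p n Sr Sc r'"
  shows "line_label q e p n Sr' Sc' r = line_label q e p n Sr' Sc' r'"
proof -
  have idx: "cut_index Sr r = cut_index Sr r'" and tr: "simple_trace q e p n Sr Sc r =
      simple_trace q e p n Sr Sc r'"
    using assms(5) by (simp_all add: line_label_def)
  have idx': "cut_index Sr' r = cut_index Sr' r'" by (rule cut_index_subset[OF assms(1,3) idx])
  have part: "cut_part p Sr r = cut_part p Sr r'" "cut_part p Sr' r = cut_part p Sr' r'"
    by (rule cut_part_cong[OF idx], rule cut_part_cong[OF idx'])
  have "e r c = 1 \<longleftrightarrow> e r' c = 1" if c: "c < n" "\<not> complex_zone q e (cut_part p Sr' r) (cut_part n
      Sc' c)" for c
  proof -
    have "\<not> complex_zone q e (cut_part p Sr r) (cut_part n Sc c)"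
    proof
      assume "complex_zone q e (cut_part p Sr r) (cut_part n Sc c)"
      from complex_zone_mono[OF this cut_part_mono[OF assms(1,3)] cut_part_mono[OF assms(2,4)]]
      show False using c(2) by simp
    qed
    then have "c \<in> simple_trace q e p n Sr Sc r \<longleftrightarrow> e r c = 1" "c \<in> simple_trace q e p n Sr Sc r'
        \<longleftrightarrow> e r' c = 1"
      using c(1) part(1) by (simp_all add: simple_trace_def)
    then show ?thesis using tr by simp
  qed
  then have "simple_trace q e p n Sr' Sc' r = simple_trace q e p n Sr' Sc' r'"
    unfolding simple_trace_def part(2) by auto
  then show ?thesis using idx' by (simp add: line_label_def)
qed

lemma refines_matrix_partition:
  assumes "finite Sr" "finite Sc" "Sr' \<subseteq> Sr" "Sc' \<subseteq> Sc"
  shows "refines ({..<p} <+> {..<n}) (matrix_partition q e p n Sr Sc) (matrix_partition q e p n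
      Sr' Sc')"
  unfolding refines_def
proof (intro conjI ballI partition_on_matrix_partition)
  fix X assume "X \<in> matrix_partition q e p n Sr Sc"
  then consider "X \<in> label_classes Inl (line_label q e p n Sr Sc) p"
    | "X \<in> label_classes Inr (line_label q (transposed e) n p Sc Sr) n"
    unfolding matrix_partition_def by blast
  then show "\<exists>Y\<in>matrix_partition q e p n Sr' Sc'. X \<subseteq> Y"
  proof cases
    case 1
    from label_classes_coarsen[OF line_label_coarsen[OF assms] this]
    show ?thesis unfolding matrix_partition_def bex_Un by (rule disjI1)
  next
    case 2
    from label_classes_coarsen[OF line_label_coarsen[OF assms(2,1,4,3)] this]
    show ?thesis unfolding matrix_partition_def bex_Un by (rule disjI2)
  qed
qed

lemma line_label_eq_entry:
  assumes "line_label q e p n Sr Sc r = line_label q e p n Sr Sc r'"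
    and "c < n" and "\<not> complex_zone q e (cut_part p Sr r) (cut_part n Sc c)"
  shows "e r c = e r' c"
proof -
  have "cut_part p Sr r = cut_part p Sr r'"
    using assms(1) by (intro cut_part_cong) (simp add: line_label_def)
  then have "c \<in> simple_trace q e p n Sr Sc r \<longleftrightarrow> e r c = 1" "c \<in> simple_trace q e p n Sr Sc r' \<longleftrightarrow>
      e r' c = 1"
    using assms(2,3) by (simp_all add: simple_trace_def)
  moreover have "simple_trace q e p n Sr Sc r = simple_trace q e p n Sr Sc r'"
    using assms(1) by (simp add: line_label_def)
  ultimately have "e r c = 1 \<longleftrightarrow> e r' c = 1" by simp
  then show ?thesis by (cases "e r c"; cases "e r' c") simp_all
qed

lemma card_label_classes_of:
  assumes "finite R"
  shows "card ((\<lambda>r. \<rho> ` {r'. r' < p \<and> f r' = f r}) ` R) \<le> card (f ` R)"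
proof -
  have "(\<lambda>r. \<rho> ` {r'. r' < p \<and> f r' = f r}) ` R = (\<lambda>l. \<rho> ` {r'. r' < p \<and> f r' = l}) ` f ` R"
    by (simp add: image_image)
  then show ?thesis using assms by (simp only: card_image_le finite_imageI)
qed

text \<open>Stated for abstract embeddings \<open>\<rho>\<close>, \<open>\<kappa>\<close> of the two index sets, so that it applies to rows and
  to columns.\<close>

lemma card_red_neighbours_le:
  fixes \<rho> \<kappa> :: "nat \<Rightarrow> 'a" and e :: "nat \<Rightarrow> nat \<Rightarrow> bit"
  assumes same: "\<And>r1 r2 s1 s2. \<lbrakk>r1 \<noteq> s1; r2 \<noteq> s2; r1 < s1 \<longleftrightarrow> r2 < s2\<rbrakk> \<Longrightarrow>
      atomic_type S (\<rho> r1) (\<rho> s1) = atomic_type S (\<rho> r2) (\<rho> s2)"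
    and entry: "\<And>r1 r2 c1 c2. \<lbrakk>r1 < p; r2 < p; c1 < n; c2 < n; e r1 c1 = e r2 c2\<rbrakk> \<Longrightarrow>
      atomic_type S (\<rho> r1) (\<kappa> c1) = atomic_type S (\<rho> r2) (\<kappa> c2)"
    and fin: "finite Sr" "finite Sc"
    and poor: "\<And>r. r < p \<Longrightarrow> poor k q e n Sc (cut_part p Sr r)"
      "\<And>c. c < n \<Longrightarrow> poor k q (transposed e) p Sr (cut_part n Sc c)"
    and X: "X \<in> label_classes \<rho> (line_label q e p n Sr Sc) p"
  shows "card {Y \<in> label_classes \<rho> (line_label q e p n Sr Sc) p \<union>
      label_classes \<kappa> (line_label q (transposed e) n p Sc Sr) n. red_adjacent S X Y}
    \<le> q * (2 ^ q) ^ k + k * (q * (2 ^ q) ^ k)"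
proof -
  let ?b = "q * (2 ^ q) ^ k"
  let ?f = "line_label q e p n Sr Sc" and ?g = "line_label q (transposed e) n p Sc Sr"
  obtain r where r: "r < p" "X = \<rho> ` {r'. r' < p \<and> ?f r' = ?f r}" using X by (rule label_classesE)
  define row where "row s = \<rho> ` {r'. r' < p \<and> ?f r' = ?f s}" for s
  define col where "col c = \<kappa> ` {c'. c' < n \<and> ?g c' = ?g c}" for c
  define K where "K = complex_indices q e n Sc (cut_part p Sr r)"
  define C where "C j = {c. c < n \<and> cut_index Sc c = j}" for j
  have idx: "cut_index Sr r' = cut_index Sr r" if "?f r' = ?f r" for r r'
    using that by (simp add: line_label_def)
  have idx': "cut_index Sc c' = cut_index Sc c" if "?g c' = ?g c" for c c'
    using that by (simp add: line_label_def)
  \<comment> \<open>Lines of two different intervals always stand in the same order and so have one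
    atomic type; red neighbours of X on its own side come from its own interval.\<close>
  have row_case: "Y \<in> row ` cut_part p Sr r"
    if Y: "Y \<in> label_classes \<rho> ?f p" "red_adjacent S X Y" for Y
  proof -
    obtain s where s: "s < p" "Y = \<rho> ` {r'. r' < p \<and> ?f r' = ?f s}" using Y(1) by (rule
        label_classesE)
    have "cut_index Sr s = cut_index Sr r"
    proof (rule ccontr)
      assume ne: "cut_index Sr s \<noteq> cut_index Sr r"
      have less: "a < b \<longleftrightarrow> cut_index Sr a < cut_index Sr b"
        if "cut_index Sr a \<noteq> cut_index Sr b" for a b
        using monoD[OF mono_cut_index[OF fin(1)], of a b] monoD[OF mono_cut_index[OF fin(1)], of
            b a] that
        by (metis le_antisym leI less_imp_le)
      have "atomic_type S u v = atomic_type S u' v'" if uv: "u \<in> X" "u' \<in> X" "v \<in> Y" "v' \<in> Y"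
          for u u' v v'
      proof -
        obtain a a' b b' where ab: "u = \<rho> a" "u' = \<rho> a'" "v = \<rho> b" "v' = \<rho> b'"
          "?f a = ?f r" "?f a' = ?f r" "?f b = ?f s" "?f b' = ?f s"
          using uv unfolding r(2) s(2) by blast
        have i: "cut_index Sr a = cut_index Sr r" "cut_index Sr a' = cut_index Sr r"
          "cut_index Sr b = cut_index Sr s" "cut_index Sr b' = cut_index Sr s"
          using ab(5-8) by (simp_all add: line_label_def)
        have "a < b \<longleftrightarrow> a' < b'" using less[of a b] less[of a' b'] i ne by simp
        moreover have "a \<noteq> b" "a' \<noteq> b'" using i ne by auto
        ultimately show ?thesis unfolding ab(1-4) by (intro same)
      qed
      then show False using Y(2) unfolding red_adjacent_def by blast
    qed
    then have "s \<in> cut_part p Sr r" using s(1) by (simp add: cut_part_def)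
    then show ?thesis unfolding s(2) row_def by (rule rev_image_eqI) simp
  qed
  \<comment> \<open>Across a simple zone the two labels fix the entry: move first within X, then
    within Y. Only complex zones give red pairs, and poorness allows at most k of them.\<close>
  have col_case: "Y \<in> (\<Union>j\<in>K. col ` C j)"
    if Y: "Y \<in> label_classes \<kappa> ?g n" "red_adjacent S X Y" for Y
  proof -
    obtain c where c: "c < n" "Y = \<kappa> ` {c'. c' < n \<and> ?g c' = ?g c}" using Y(1) by (rule
        label_classesE)
    have cz: "complex_zone q e (cut_part p Sr r) (cut_part n Sc c)"
    proof (rule ccontr)
      assume ncz: "\<not> complex_zone q e (cut_part p Sr r) (cut_part n Sc c)"
      have ncz': "\<not> complex_zone q (transposed e) (cut_part n Sc c) (cut_part p Sr r)"
        using ncz unfolding complex_zone_transposed[of q e] .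
      have "atomic_type S u v = atomic_type S u' v'" if uv: "u \<in> X" "u' \<in> X" "v \<in> Y" "v' \<in> Y"
          for u u' v v'
      proof -
        obtain a a' b b' where ab: "u = \<rho> a" "u' = \<rho> a'" "v = \<kappa> b" "v' = \<kappa> b'"
          "a < p" "a' < p" "b < n" "b' < n"
          "?f a = ?f r" "?f a' = ?f r" "?g b = ?g c" "?g b' = ?g c"
          using uv unfolding r(2) c(2) by blast
        have part: "cut_part p Sr a = cut_part p Sr r" "cut_part p Sr a' = cut_part p Sr r"
          "cut_part n Sc b = cut_part n Sc c"
          using ab(9-11) by (auto intro!: cut_part_cong simp: line_label_def)
        have "e a b = e a' b"
          by (rule line_label_eq_entry[of q e p n Sr Sc]) (use ab ncz part in simp_all)
        also have "e a' b = e a' b'"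
          by (rule line_label_eq_entry[of q "transposed e" n p Sc Sr])
            (use ab ncz' part in simp_all)
        finally show ?thesis unfolding ab(1-4) by (rule entry[OF ab(5-8)])
      qed
      then show False using Y(2) unfolding red_adjacent_def by blast
    qed
    then have "cut_index Sc c \<in> K" unfolding K_def complex_indices_def using c(1) by blast
    moreover have "Y \<in> col ` C (cut_index Sc c)"
      using c unfolding col_def C_def by blast
    ultimately show ?thesis by blast
  qed
  have cardrow: "card (row ` cut_part p Sr r) \<le> ?b"
    unfolding row_def
    using card_label_classes_of[of "cut_part p Sr r" \<rho> p ?f] card_labels_in_part[OF poor(1)[OF
        r(1)]] by simp
  have cardcol: "card (col ` C j) \<le> ?b" if j: "j \<in> K" for j
  proof -
    obtain c where c: "c < n" "j = cut_index Sc c" using j unfolding K_def complex_indices_def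
        by blast
    have "C j = cut_part n Sc c" unfolding C_def c(2) cut_part_def ..
    then show ?thesis unfolding col_def
      using card_label_classes_of[of "cut_part n Sc c" \<kappa> n ?g] card_labels_in_part[OF poor(2)[OF
          c(1)]] by simp
  qed
  have K: "card K \<le> k" "finite K"
    unfolding K_def by (rule card_complex_indices[OF poor(1)[OF r(1)]], simp)
      (simp add: complex_indices_def)
  have fin_all: "finite (row ` cut_part p Sr r \<union> (\<Union>j\<in>K. col ` C j))"
    using K(2) by (simp add: C_def)
  have "{Y \<in> label_classes \<rho> ?f p \<union> label_classes \<kappa> ?g n. red_adjacent S X Y}
    \<subseteq> row ` cut_part p Sr r \<union> (\<Union>j\<in>K. col ` C j)"
    using row_case col_case by blast
  then have "card {Y \<in> label_classes \<rho> ?f p \<union> label_classes \<kappa> ?g n. red_adjacent S X Y}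
    \<le> card (row ` cut_part p Sr r \<union> (\<Union>j\<in>K. col ` C j))" by (rule card_mono[OF fin_all])
  also have "\<dots> \<le> card (row ` cut_part p Sr r) + card (\<Union>j\<in>K. col ` C j)" by (rule card_Un_le)
  also have "\<dots> \<le> ?b + (\<Sum>j\<in>K. card (col ` C j))"
    by (intro add_mono cardrow card_UN_le K)
  also have "\<dots> \<le> ?b + (\<Sum>j\<in>K. ?b)" by (intro add_mono sum_mono cardcol order_refl)
  also have "\<dots> \<le> ?b + k * ?b" using mult_le_mono1[OF K(1), of ?b] by simp
  finally show ?thesis .
qed

section \<open>Red degrees at a division and between two divisions\<close>

definition poor_division :: "nat \<Rightarrow> nat \<Rightarrow> (nat \<Rightarrow> nat \<Rightarrow> bit) \<Rightarrow> nat \<Rightarrow> nat \<Rightarrow> nat set \<Rightarrow> nat set \<Rightarrow>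
    bool" where
  "poor_division k q e p n Sr Sc \<longleftrightarrow>
     (\<forall>r<p. poor k q e n Sc (cut_part p Sr r)) \<and> (\<forall>c<n. poor k q (transposed e) p Sr (cut_part n
         Sc c))"

lemma poor_division_transposed:
  "poor_division k q (transposed e) n p Sc Sr \<longleftrightarrow> poor_division k q e p n Sr Sc"
  unfolding poor_division_def by blast

lemma red_degree_matrix_partition:
  fixes A :: "bit mat"
  defines "p \<equiv> dim_row A" and "n \<equiv> dim_col A" and "e \<equiv> \<lambda>r c. A $$ (r, c)"
  assumes fin: "finite Sr" "finite Sc" and poor: "poor_division k q e p n Sr Sc"
    and X: "X \<in> matrix_partition q e p n Sr Sc"
  shows "red_degree (matrix_structure A) (matrix_partition q e p n Sr Sc) X
    \<le> q * (2 ^ q) ^ k + k * (q * (2 ^ q) ^ k)"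
proof -
  have poor': "\<And>r. r < p \<Longrightarrow> poor k q e n Sc (cut_part p Sr r)"
    "\<And>c. c < n \<Longrightarrow> poor k q (transposed e) p Sr (cut_part n Sc c)"
    using poor by (simp_all add: poor_division_def)
  have entry: "atomic_type (matrix_structure A) (Inl r1) (Inr c1) = atomic_type
      (matrix_structure A) (Inl r2) (Inr c2)"
    "atomic_type (matrix_structure A) (Inr c1) (Inl r1) = atomic_type (matrix_structure A) (Inr
        c2) (Inl r2)"
    if "r1 < p" "r2 < p" "c1 < n" "c2 < n" "e r1 c1 = e r2 c2" for r1 r2 c1 c2
    using that by (simp_all add: atomic_type_matrix_structure p_def n_def e_def)
  have same: "atomic_type (matrix_structure A) (Inl r1) (Inl s1) = atomic_type (matrix_structure
      A) (Inl r2) (Inl s2)"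
    "atomic_type (matrix_structure A) (Inr r1) (Inr s1) = atomic_type (matrix_structure A) (Inr
        r2) (Inr s2)"
    if "r1 \<noteq> s1" "r2 \<noteq> s2" "r1 < s1 \<longleftrightarrow> r2 < s2" for r1 r2 s1 s2
    using that unfolding atomic_type_matrix_structure by (simp_all, linarith+)
  consider (row) "X \<in> label_classes Inl (line_label q e p n Sr Sc) p"
    | (col) "X \<in> label_classes Inr (line_label q (transposed e) n p Sc Sr) n"
    using X unfolding matrix_partition_def by blast
  then show ?thesis
  proof cases
    case row
    show ?thesis unfolding red_degree_def matrix_partition_def
      by (rule card_red_neighbours_le[OF same(1) entry(1) fin poor' row])
  next
    case col
    have entry': "atomic_type (matrix_structure A) (Inr r1) (Inl c1) = atomic_type
        (matrix_structure A) (Inr r2) (Inl c2)"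
      if "r1 < n" "r2 < n" "c1 < p" "c2 < p" "transposed e r1 c1 = transposed e r2 c2" for r1 r2
          c1 c2
      using entry(2)[OF that(3,4,1,2,5)] .
    show ?thesis unfolding red_degree_def matrix_partition_def
      by (subst Un_commute)
        (rule card_red_neighbours_le[where e = "transposed e", OF same(2) entry' fin(2,1)
            poor'(2,1) col])
  qed
qed

lemma card_classes_inside:
  assumes "{..<p} \<inter> Inl -` Y = R" and "{..<n} \<inter> Inr -` Y = C"
  shows "card {Z \<in> matrix_partition q e p n Sr Sc. Z \<subseteq> Y}
    \<le> card (line_label q e p n Sr Sc ` R) + card (line_label q (transposed e) n p Sc Sr ` C)"
proof -
  let ?f = "line_label q e p n Sr Sc" and ?g = "line_label q (transposed e) n p Sc Sr"
  define row where "row r = (Inl ` {r'. r' < p \<and> ?f r' = ?f r} :: (nat + nat) set)" for r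
  define col where "col c = (Inr ` {c'. c' < n \<and> ?g c' = ?g c} :: (nat + nat) set)" for c
  have fin: "finite R" "finite C" using assms by auto
  have "{Z \<in> matrix_partition q e p n Sr Sc. Z \<subseteq> Y} \<subseteq> row ` R \<union> col ` C"
  proof
    fix Z assume Z: "Z \<in> {Z \<in> matrix_partition q e p n Sr Sc. Z \<subseteq> Y}"
    then consider "Z \<in> label_classes Inl ?f p" | "Z \<in> label_classes Inr ?g n"
      unfolding matrix_partition_def by blast
    then show "Z \<in> row ` R \<union> col ` C"
    proof cases
      case 1
      then obtain r where r: "r < p" "Z = Inl ` {r'. r' < p \<and> ?f r' = ?f r}" by (rule
          label_classesE)
      then have "Inl r \<in> Y" using Z by blast
      then have "r \<in> R" using r(1) assms(1) by blast
      then show ?thesis using r(2) unfolding row_def by blast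
    next
      case 2
      then obtain c where c: "c < n" "Z = Inr ` {c'. c' < n \<and> ?g c' = ?g c}" by (rule
          label_classesE)
      then have "Inr c \<in> Y" using Z by blast
      then have "c \<in> C" using c(1) assms(2) by blast
      then show ?thesis using c(2) unfolding col_def by blast
    qed
  qed
  then have "card {Z \<in> matrix_partition q e p n Sr Sc. Z \<subseteq> Y} \<le> card (row ` R \<union> col ` C)"
    using fin by (intro card_mono) auto
  also have "\<dots> \<le> card (row ` R) + card (col ` C)" by (rule card_Un_le)
  also have "\<dots> \<le> card (?f ` R) + card (?g ` C)"
    unfolding row_def col_def by (intro add_mono card_label_classes_of fin)
  finally show ?thesis .
qed

lemma card_labels_two_parts:
  assumes poor: "\<And>r. r < p \<Longrightarrow> poor k q e n Sc (cut_part p Sr r)"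
    and R: "R \<subseteq> {..<p}" "card (cut_index Sr ` R) \<le> 2"
  shows "card (line_label q e p n Sr Sc ` R) \<le> 2 * (q * (2 ^ q) ^ k)"
proof -
  let ?f = "line_label q e p n Sr Sc"
  let ?part = "\<lambda>j. {r. r < p \<and> cut_index Sr r = j}"
  have finR: "finite R" using R(1) finite_subset by blast
  have "?f ` R \<subseteq> (\<Union>j\<in>cut_index Sr ` R. ?f ` ?part j)" using R(1) by blast
  then have "card (?f ` R) \<le> card (\<Union>j\<in>cut_index Sr ` R. ?f ` ?part j)"
    using finR by (intro card_mono) auto
  also have "\<dots> \<le> (\<Sum>j\<in>cut_index Sr ` R. card (?f ` ?part j))" using finR by (intro card_UN_le) simp
  also have "\<dots> \<le> (\<Sum>j\<in>cut_index Sr ` R. q * (2 ^ q) ^ k)"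
  proof (rule sum_mono)
    fix j assume "j \<in> cut_index Sr ` R"
    then obtain r where r: "r < p" "j = cut_index Sr r" using R(1) by blast
    have "?part j = cut_part p Sr r" unfolding r(2) cut_part_def ..
    then show "card (?f ` ?part j) \<le> q * (2 ^ q) ^ k" using card_labels_in_part[OF poor[OF
        r(1)]] by simp
  qed
  also have "\<dots> \<le> 2 * (q * (2 ^ q) ^ k)" using mult_le_mono1[OF R(2), of "q * (2 ^ q) ^ k"] by simp
  finally show ?thesis .
qed

text \<open>A red neighbour of X lies in the part of Q that contains X or in a red neighbour of that
  part. This leaves d + 1 parts of Q, each with at most m parts of L, because every part of L
  contains one of P.\<close>

lemma red_degree_between:
  assumes PL: "refines V P L" and LQ: "refines V L Q" and V: "finite V"
    and deg: "\<And>Y. Y \<in> Q \<Longrightarrow> red_degree S Q Y \<le> d"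
    and inside: "\<And>Y. Y \<in> Q \<Longrightarrow> card {Z \<in> P. Z \<subseteq> Y} \<le> m"
    and X: "X \<in> L"
  shows "red_degree S L X \<le> (d + 1) * m"
proof -
  have finP: "finite P" and finL: "finite L" and finQ: "finite Q"
    using refines_finite[OF PL V] refines_finite[OF LQ V] by simp_all
  have pP: "partition_on V P" and pL: "partition_on V L" using PL by (simp_all add: refines_def)
  have insideL: "card {Z \<in> L. Z \<subseteq> Y} \<le> m" if Y: "Y \<in> Q" for Y
  proof -
    have "\<exists>W. W \<in> P \<and> W \<subseteq> Z" if Z: "Z \<in> L" for Z
    proof -
      have "Z = \<Union>{W \<in> P. W \<subseteq> Z}" by (rule partition_onD1[OF refines_obtains_subset[OF PL Z]])
      moreover have "Z \<noteq> {}" using partition_onD3[OF pL] Z by auto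
      ultimately have "{W \<in> P. W \<subseteq> Z} \<noteq> {}" by (metis Union_empty)
      then show ?thesis by simp
    qed
    then have "\<forall>Z. \<exists>W. Z \<in> L \<longrightarrow> W \<in> P \<and> W \<subseteq> Z" by simp
    from choice[OF this] obtain w where w: "\<forall>Z. Z \<in> L \<longrightarrow> w Z \<in> P \<and> w Z \<subseteq> Z" by (elim exE)
    have "inj_on w {Z \<in> L. Z \<subseteq> Y}"
    proof (rule inj_onI)
      fix Z Z' assume Z: "Z \<in> {Z \<in> L. Z \<subseteq> Y}" "Z' \<in> {Z \<in> L. Z \<subseteq> Y}" and eq: "w Z = w Z'"
      have "w Z \<in> P" "w Z \<subseteq> Z" "w Z' \<subseteq> Z'" using w Z by simp_all
      moreover have "w Z \<noteq> {}" using \<open>w Z \<in> P\<close> partition_onD3[OF pP] by auto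
      ultimately have "\<not> disjnt Z Z'" using eq unfolding disjnt_def by auto
      then show "Z = Z'" using pairwiseD[OF partition_onD2[OF pL], of Z Z'] Z by auto
    qed
    moreover have "w ` {Z \<in> L. Z \<subseteq> Y} \<subseteq> {Z \<in> P. Z \<subseteq> Y}"
    proof
      fix W assume "W \<in> w ` {Z \<in> L. Z \<subseteq> Y}"
      then obtain Z where Z: "Z \<in> L" "Z \<subseteq> Y" "W = w Z" by blast
      then have "w Z \<in> P" "w Z \<subseteq> Z" using w by simp_all
      then show "W \<in> {Z \<in> P. Z \<subseteq> Y}" using Z by simp
    qed
    ultimately have "card {Z \<in> L. Z \<subseteq> Y} \<le> card {Z \<in> P. Z \<subseteq> Y}"
      using finP by (intro card_inj_on_le[of w]) auto
    then show ?thesis using inside[OF Y] by linarith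
  qed
  have LQ': "\<forall>Z\<in>L. \<exists>Y\<in>Q. Z \<subseteq> Y" using LQ by (simp add: refines_def)
  obtain X' where X': "X' \<in> Q" "X \<subseteq> X'" using LQ' X by blast
  define N where "N = insert X' {Y \<in> Q. red_adjacent S X' Y}"
  have N: "finite N" "card N \<le> d + 1" "N \<subseteq> Q"
    using finQ deg[OF X'(1)] X'(1) by (auto simp: N_def red_degree_def card_insert_if)
  have "{Z \<in> L. red_adjacent S X Z} \<subseteq> (\<Union>Y\<in>N. {Z \<in> L. Z \<subseteq> Y})"
  proof
    fix Z assume "Z \<in> {Z \<in> L. red_adjacent S X Z}"
    then have Z: "Z \<in> L" "red_adjacent S X Z" by simp_all
    obtain Y where Y: "Y \<in> Q" "Z \<subseteq> Y" using LQ' Z(1) by blast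
    have "Y = X' \<or> red_adjacent S X' Y"
      using Z(2) X'(2) Y(2) unfolding red_adjacent_def by blast
    then show "Z \<in> (\<Union>Y\<in>N. {Z \<in> L. Z \<subseteq> Y})" using Y Z(1) by (auto simp: N_def)
  qed
  then have "red_degree S L X \<le> card (\<Union>Y\<in>N. {Z \<in> L. Z \<subseteq> Y})"
    unfolding red_degree_def using N(1) finL by (intro card_mono) auto
  also have "\<dots> \<le> (\<Sum>Y\<in>N. card {Z \<in> L. Z \<subseteq> Y})" by (rule card_UN_le[OF N(1)])
  also have "\<dots> \<le> (\<Sum>Y\<in>N. m)" by (intro sum_mono insideL) (use N(3) in blast)
  also have "\<dots> \<le> (d + 1) * m" using mult_le_mono1[OF N(2), of m] by simp
  finally show ?thesis .
qed

subsection \<open>The main theorem\<close>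

lemma card_cut_indices_of_merged_part:
  assumes "finite S" and "S' = S \<or> (\<exists>s\<in>S. S' = S - {s})"
  shows "card (cut_index S ` cut_part p S' r) \<le> 2"
proof -
  have "cut_index S ` cut_part p S' r \<subseteq> {cut_index S' r, cut_index S' r + 1}"
  proof
    fix j assume "j \<in> cut_index S ` cut_part p S' r"
    then obtain r' where r': "j = cut_index S r'" "cut_index S' r' = cut_index S' r"
      by (auto simp: cut_part_def)
    from assms(2) show "j \<in> {cut_index S' r, cut_index S' r + 1}"
    proof
      assume "\<exists>s\<in>S. S' = S - {s}"
      then obtain s where s: "s \<in> S" "S' = S - {s}" by blast
      show ?thesis using cut_index_remove[OF assms(1) s(1), of r'] r' s(2) by auto
    qed (use r' in simp)
  qed
  then have "card (cut_index S ` cut_part p S' r) \<le> card {cut_index S' r, cut_index S' r + 1}"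
    by (rule card_mono[rotated]) simp
  then show ?thesis by simp
qed

lemma card_cut_indices_of_class:
  assumes "finite Sr" "finite Sc" and "Sr' = Sr \<or> (\<exists>s\<in>Sr. Sr' = Sr - {s})"
    and "Sc' = Sc \<or> (\<exists>s\<in>Sc. Sc' = Sc - {s})" and Y: "Y \<in> matrix_partition q e p n Sr' Sc'"
  shows "card (cut_index Sr ` ({..<p} \<inter> Inl -` Y)) \<le> 2 \<and> card (cut_index Sc ` ({..<n} \<inter> Inr -`
      Y)) \<le> 2"
proof -
  consider "Y \<in> label_classes Inl (line_label q e p n Sr' Sc') p"
    | "Y \<in> label_classes Inr (line_label q (transposed e) n p Sc' Sr') n"
    using Y unfolding matrix_partition_def by blast
  then show ?thesis
  proof cases
    case 1
    then obtain r where r: "Y = Inl ` {r'. r' < p \<and> line_label q e p n Sr' Sc' r' = line_label q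
        e p n Sr' Sc' r}"
      by (rule label_classesE)
    have "{..<p} \<inter> Inl -` Y \<subseteq> cut_part p Sr' r" unfolding r by (auto simp: cut_part_def
        line_label_def)
    then have "card (cut_index Sr ` ({..<p} \<inter> Inl -` Y)) \<le> card (cut_index Sr ` cut_part p Sr' r)"
      by (intro card_mono image_mono) simp_all
    also have "\<dots> \<le> 2" by (rule card_cut_indices_of_merged_part[OF assms(1,3)])
    finally have "card (cut_index Sr ` ({..<p} \<inter> Inl -` Y)) \<le> 2" .
    moreover have "Inr -` Y = {}" unfolding r by auto
    ultimately show ?thesis by (simp only: Int_empty_right image_empty card.empty) simp
  next
    case 2
    then obtain c where c: "Y = Inr ` {c'. c' < n \<and> line_label q (transposed e) n p Sc' Sr' c' =
        line_label q (transposed e) n p Sc' Sr' c}"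
      by (rule label_classesE)
    have "{..<n} \<inter> Inr -` Y \<subseteq> cut_part n Sc' c" unfolding c by (auto simp: cut_part_def
        line_label_def)
    then have "card (cut_index Sc ` ({..<n} \<inter> Inr -` Y)) \<le> card (cut_index Sc ` cut_part n Sc' c)"
      by (intro card_mono image_mono) simp_all
    also have "\<dots> \<le> 2" by (rule card_cut_indices_of_merged_part[OF assms(2,4)])
    finally have "card (cut_index Sc ` ({..<n} \<inter> Inr -` Y)) \<le> 2" .
    moreover have "Inl -` Y = {}" unfolding c by auto
    ultimately show ?thesis by (simp only: Int_empty_right image_empty card.empty) simp
  qed
qed

lemma red_degree_between_matrix_partition:
  assumes poor: "poor_division k q e p n Sr Sc"
    and PL: "refines ({..<p} <+> {..<n}) (matrix_partition q e p n Sr Sc) L"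
    and LQ: "refines ({..<p} <+> {..<n}) L Q"
    and deg: "\<And>Y. Y \<in> Q \<Longrightarrow> red_degree S Q Y \<le> d"
    and idx: "\<And>Y. Y \<in> Q \<Longrightarrow> card (cut_index Sr ` ({..<p} \<inter> Inl -` Y)) \<le> 2 \<and>
      card (cut_index Sc ` ({..<n} \<inter> Inr -` Y)) \<le> 2"
    and X: "X \<in> L"
  shows "red_degree S L X \<le> (d + 1) * (4 * (q * (2 ^ q) ^ k))"
proof (rule red_degree_between[OF PL LQ _ deg _ X])
  fix Y assume Y: "Y \<in> Q"
  have poor': "\<And>r. r < p \<Longrightarrow> poor k q e n Sc (cut_part p Sr r)"
    "\<And>c. c < n \<Longrightarrow> poor k q (transposed e) p Sr (cut_part n Sc c)"
    using poor by (simp_all add: poor_division_def)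
  have "card {Z \<in> matrix_partition q e p n Sr Sc. Z \<subseteq> Y}
    \<le> card (line_label q e p n Sr Sc ` ({..<p} \<inter> Inl -` Y)) +
      card (line_label q (transposed e) n p Sc Sr ` ({..<n} \<inter> Inr -` Y))"
    by (rule card_classes_inside[OF refl refl])
  also have "\<dots> \<le> 2 * (q * (2 ^ q) ^ k) + 2 * (q * (2 ^ q) ^ k)"
    by (intro add_mono card_labels_two_parts poor') (use idx[OF Y] in auto)
  finally show "card {Z \<in> matrix_partition q e p n Sr Sc. Z \<subseteq> Y} \<le> 4 * (q * (2 ^ q) ^ k)" by simp
qed simp

text \<open>The first factor is one more than the bound at a poor division in
  \<open>red_degree_matrix_partition\<close>. The second bounds the classes inside one class of the
  next division: at most two old intervals on each side, with q * (2^q)^k classes in each.\<close>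

definition degree_bound :: "nat \<Rightarrow> nat \<Rightarrow> nat" where
  "degree_bound k q =
     (q * (2 ^ q) ^ k + k * (q * (2 ^ q) ^ k) + 1) * (4 * (q * (2 ^ q) ^ k))"

text \<open>Induction on the number of cuts. \<open>progress\<close> removes one cut and keeps the
  division poor; in between, merges may come in any order, since
  \<open>red_degree_between_matrix_partition\<close> covers all intermediate partitions.\<close>

lemma merge_path_matrix_partition:
  fixes A :: "bit mat" and k q :: nat
  defines "p \<equiv> dim_row A" and "n \<equiv> dim_col A" and "e \<equiv> \<lambda>r c. A $$ (r, c)"
  defines "ok \<equiv> \<lambda>L. \<forall>X\<in>L. red_degree (matrix_structure A) L X \<le> degree_bound k q"
  assumes progress: "\<And>Sr Sc. \<lbrakk>finite Sr; finite Sc; poor_division k q e p n Sr Sc; Sr \<noteq> {} \<or> Sc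
      \<noteq> {}\<rbrakk> \<Longrightarrow>
      (\<exists>s\<in>Sr. poor_division k q e p n (Sr - {s}) Sc) \<or> (\<exists>s\<in>Sc. poor_division k q e p n Sr (Sc -
          {s}))"
    and "finite Sr" "finite Sc" "poor_division k q e p n Sr Sc"
  shows "ok (matrix_partition q e p n Sr Sc) \<and>
    merge_path ok (matrix_partition q e p n Sr Sc) ({{..<p} <+> {..<n}} - {{}})"
  using assms(6-8)
proof (induction "card Sr + card Sc" arbitrary: Sr Sc rule: less_induct)
  case less
  note fin = less.prems(1,2) and poor = less.prems(3)
  let ?V = "{..<p} <+> {..<n}"
  let ?D = "q * (2 ^ q) ^ k + k * (q * (2 ^ q) ^ k)"
  let ?P = "matrix_partition q e p n"
  have step: "ok (?P Sr Sc) \<and> merge_path ok (?P Sr Sc) Q"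
    if ref: "refines ?V (?P Sr Sc) Q"
      and deg: "\<And>Y. Y \<in> Q \<Longrightarrow> red_degree (matrix_structure A) Q Y \<le> ?D"
      and idx: "\<And>Y. Y \<in> Q \<Longrightarrow> card (cut_index Sr ` ({..<p} \<inter> Inl -` Y)) \<le> 2 \<and>
        card (cut_index Sc ` ({..<n} \<inter> Inr -` Y)) \<le> 2" for Q
  proof -
    have between: "ok L" if "refines ?V (?P Sr Sc) L" "refines ?V L Q" for L
      unfolding ok_def degree_bound_def
    proof (rule ballI)
      fix X assume X: "X \<in> L"
      show "red_degree (matrix_structure A) L X \<le> (?D + 1) * (4 * (q * (2 ^ q) ^ k))"
        by (rule red_degree_between_matrix_partition[OF poor that _ _ X]) (erule deg, erule idx)
    qed
    have "ok (?P Sr Sc)" by (rule between[OF refines_refl ref]) (rule partition_on_matrix_partition)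
    moreover have "merge_path ok (?P Sr Sc) Q" by (rule refines_imp_merge_path[OF ref _
        between]) simp
    ultimately show ?thesis ..
  qed
  show ?case
  proof (cases "Sr = {} \<and> Sc = {}")
    \<comment> \<open>Without cuts there is one interval of rows and one of columns; the last
      stretch leads to the one-part partition, whose red degree is 0.\<close>
    case True
    show ?thesis
    proof (rule step)
      show "refines ?V (?P Sr Sc) ({?V} - {{}})" by (rule refines_one_part[OF
          partition_on_matrix_partition])
      show "red_degree (matrix_structure A) ({?V} - {{}}) Y \<le> ?D" if "Y \<in> {?V} - {{}}" for Y
      proof -
        have "{Z \<in> {?V} - {{}}. red_adjacent (matrix_structure A) Y Z} = {}"
          using that by (auto simp: red_adjacent_def)
        then show ?thesis unfolding red_degree_def by (simp only: card.empty le0)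
      qed
      show "card (cut_index Sr ` ({..<p} \<inter> Inl -` Y)) \<le> 2 \<and> card (cut_index Sc ` ({..<n} \<inter> Inr
          -` Y)) \<le> 2"
        for Y :: "(nat + nat) set"
      proof -
        have "card (cut_index {} ` B) \<le> 2" for B
        proof -
          have "card (cut_index {} ` B) \<le> card {0::nat}" by (intro card_mono) auto
          then show ?thesis by simp
        qed
        then show ?thesis using True by blast
      qed
    qed
  next
    case False
    then have "\<exists>Sr' Sc'. card Sr' + card Sc' < card Sr + card Sc \<and> Sr' \<subseteq> Sr \<and> Sc' \<subseteq> Sc \<and>
      (Sr' = Sr \<or> (\<exists>s\<in>Sr. Sr' = Sr - {s})) \<and> (Sc' = Sc \<or> (\<exists>s\<in>Sc. Sc' = Sc - {s})) \<and>
      poor_division k q e p n Sr' Sc'"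
    proof -
      from False have "Sr \<noteq> {} \<or> Sc \<noteq> {}" by blast
      from progress[OF fin poor this] show ?thesis
      proof
        assume "\<exists>s\<in>Sr. poor_division k q e p n (Sr - {s}) Sc"
        then obtain s where s: "s \<in> Sr" "poor_division k q e p n (Sr - {s}) Sc" by blast
        then show ?thesis using card_Diff1_less[OF fin(1) s(1)]
          by (intro exI[of _ "Sr - {s}"] exI[of _ Sc]) auto
      next
        assume "\<exists>s\<in>Sc. poor_division k q e p n Sr (Sc - {s})"
        then obtain s where s: "s \<in> Sc" "poor_division k q e p n Sr (Sc - {s})" by blast
        then show ?thesis using card_Diff1_less[OF fin(2) s(1)]
          by (intro exI[of _ Sr] exI[of _ "Sc - {s}"]) auto
      qed
    qed
    then obtain Sr' Sc' where less': "card Sr' + card Sc' < card Sr + card Sc" and sub: "Sr' \<subseteq>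
        Sr" "Sc' \<subseteq> Sc"
      and one: "Sr' = Sr \<or> (\<exists>s\<in>Sr. Sr' = Sr - {s})" "Sc' = Sc \<or> (\<exists>s\<in>Sc. Sc' = Sc - {s})"
      and poor': "poor_division k q e p n Sr' Sc'" by (elim exE conjE)
    have fin': "finite Sr'" "finite Sc'" using sub fin finite_subset by blast+
    have "ok (?P Sr Sc) \<and> merge_path ok (?P Sr Sc) (?P Sr' Sc')"
    proof (rule step)
      show "refines ?V (?P Sr Sc) (?P Sr' Sc')" by (rule refines_matrix_partition[OF fin sub])
      show "red_degree (matrix_structure A) (?P Sr' Sc') Y \<le> ?D" if "Y \<in> ?P Sr' Sc'" for Y
        using red_degree_matrix_partition[OF fin', of k q A] poor' that unfolding p_def n_def
            e_def by blast
      show "card (cut_index Sr ` ({..<p} \<inter> Inl -` Y)) \<le> 2 \<and> card (cut_index Sc ` ({..<n} \<inter> Inr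
          -` Y)) \<le> 2"
        if "Y \<in> ?P Sr' Sc'" for Y
        by (rule card_cut_indices_of_class[OF fin one that])
    qed
    moreover have "merge_path ok (?P Sr' Sc') ({?V} - {{}})"
      using less.hyps[OF less' fin' poor'] by blast
    ultimately show ?thesis by (meson rtranclp_trans)
  qed
qed

section \<open>The finest division and stuck divisions\<close>

lemma label_classes_inj:
  assumes "\<And>r r'. \<lbrakk>r < p; r' < p; f r = f r'\<rbrakk> \<Longrightarrow> r = r'"
  shows "label_classes \<rho> f p = (\<lambda>r. {\<rho> r}) ` {..<p}"
  unfolding label_classes_def
proof (rule image_cong[OF refl])
  fix r assume "r \<in> {..<p}"
  then have "{r'. r' < p \<and> f r' = f r} = {r}" using assms by auto
  then show "\<rho> ` {r'. r' < p \<and> f r' = f r} = {\<rho> r}" by simp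
qed

lemma cut_index_lessThan: "r < p \<Longrightarrow> cut_index {..<p} r = Suc r"
proof -
  assume "r < p"
  then have "{s \<in> {..<p}. s \<le> r} = {..r}" by auto
  then show ?thesis by (simp add: cut_index_def)
qed

lemma matrix_partition_finest:
  "matrix_partition q e p n {..<p} {..<n} = (\<lambda>v. {v}) ` ({..<p} <+> {..<n})"
proof -
  have inj: "r = r'" if "r < m" "r' < m" "line_label q f m l {..<m} S r = line_label q f m l
      {..<m} S r'"
    for r r' m l f S
    using that by (simp add: line_label_def cut_index_lessThan)
  have "label_classes Inl (line_label q e p n {..<p} {..<n}) p = (\<lambda>r. {Inl r :: nat + nat}) `
      {..<p}"
    "label_classes Inr (line_label q (transposed e) n p {..<n} {..<p}) n = (\<lambda>r. {Inr r :: nat +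
        nat}) ` {..<n}"
    by (rule label_classes_inj, erule (2) inj)+
  then show ?thesis unfolding matrix_partition_def Plus_def by (simp add: image_Un image_image)
qed

lemma poor_division_finest:
  assumes "1 \<le> q"
  shows "poor_division k q e p n {..<p} {..<n}"
proof -
  have "poor k q f l S (cut_part m {..<m} r)" if "r < m" for f l S m r
  proof -
    have "cut_part m {..<m} r = {r}" using that by (auto simp: cut_part_def cut_index_lessThan)
    then show ?thesis unfolding poor_def using assms by (intro exI[of _ "{}"]) simp
  qed
  then show ?thesis unfolding poor_division_def by blast
qed

text \<open>Coarsening the rows keeps the columns poor, and row intervals away from the removed cut
  lie in old ones. So if the cut of index 2 * j + 1 cannot be removed, the merged interval is to
  blame, and it lies in the pair of intervals 2 * j and 2 * j + 1.\<close>

lemma stuck_imp_rich: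
  assumes fin: "finite Sr" "finite Sc" and poor: "poor_division k q e p n Sr Sc"
    and stuck: "\<And>s. s \<in> Sr \<Longrightarrow> \<not> poor_division k q e p n (Sr - {s}) Sc"
    and j: "j < (card Sr + 1) div 2" and Z: "Z \<subseteq> {..<n}" "card (cut_index Sc ` Z) \<le> k"
  shows "q < card (row_trace e ({..<n} - Z) ` {r \<in> {..<p}. cut_index Sr r div 2 = j})"
proof -
  have "1 \<le> 2 * j + 1" "2 * j + 1 \<le> card Sr" using j by simp_all
  then obtain s where s: "s \<in> Sr" "cut_index Sr s = 2 * j + 1" using cut_index_surj[OF fin(1)]
      by blast
  have cols: "poor k q (transposed e) p (Sr - {s}) (cut_part n Sc c)" if "c < n" for c
  proof (rule poor_mono[OF _ subset_refl _ fin(1)])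
    show "poor k q (transposed e) p Sr (cut_part n Sc c)" using poor that by (simp add:
        poor_division_def)
  qed auto
  then obtain r where r: "r < p" "\<not> poor k q e n Sc (cut_part p (Sr - {s}) r)"
    using stuck[OF s(1)] unfolding poor_division_def by blast
  have "cut_index (Sr - {s}) r = cut_index (Sr - {s}) s"
  proof (rule ccontr)
    assume "cut_index (Sr - {s}) r \<noteq> cut_index (Sr - {s}) s"
    then have sub: "cut_part p (Sr - {s}) r \<subseteq> cut_part p Sr r"
      by (rule cut_part_remove_other[OF fin(1) s(1)])
    have "poor k q e n Sc (cut_part p Sr r)" using poor r(1) by (simp add: poor_division_def)
    from poor_mono[OF this sub finite_cut_part fin(2) subset_refl] show False using r(2) by blast
  qed
  then have sub: "cut_part p (Sr - {s}) r \<subseteq> {r. r < p \<and> cut_index Sr r div 2 = j}"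
    by (rule cut_part_remove_merged[OF fin(1) s])
  have "q < card (row_trace e ({..<n} - Z) ` cut_part p (Sr - {s}) r)"
  proof (rule ccontr)
    assume "\<not> ?thesis"
    then have "card (row_trace e ({..<n} - Z) ` cut_part p (Sr - {s}) r) \<le> q" by simp
    then have "poor k q e n Sc (cut_part p (Sr - {s}) r)" unfolding poor_def using Z by blast
    then show False using r(2) by blast
  qed
  also have "\<dots> \<le> card (row_trace e ({..<n} - Z) ` {r \<in> {..<p}. cut_index Sr r div 2 = j})"
    by (rule card_row_traces_mono) (use sub in auto)
  finally show ?thesis .
qed

text \<open>The divisions start with singletons and lose one cut at a time; a poor division from
  which no cut can be removed would yield all T by T patterns, N among them.\<close>

lemma bounded_twin_width_of_parity_minor_free:
  fixes N :: "bit mat"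
  obtains d where "\<And>A. \<not> parity_minor N A \<Longrightarrow> twin_width (matrix_structure A) \<le> d"
proof -
  \<comment> \<open>Larger than both dimensions, so that row \<open>dim_row N\<close> and column
    \<open>dim_col N\<close> of the pattern are spare.\<close>
  define T where "T = dim_row N + dim_col N + 1"
  show ?thesis
  proof (rule rich_division_imp_patterns[of T T])
    fix k q0 :: nat
    assume pat: "\<And>(e :: nat \<Rightarrow> nat \<Rightarrow> bit) R D (h :: nat \<Rightarrow> nat) (g :: nat \<Rightarrow> nat) m N.
        \<lbrakk>finite R; finite D; mono h; mono g; 0 < m; g ` D \<subseteq> {..<3 * m};
         \<And>j Z. \<lbrakk>j < m; Z \<subseteq> D; card (g ` Z) \<le> k\<rbrakk> \<Longrightarrow> q0 < card (row_trace e (D - Z) ` {r \<in> R. h r =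
             j})\<rbrakk>
        \<Longrightarrow> \<exists>x y. ordered_blocks T x \<and> ordered_blocks T y \<and> (\<forall>i<T. x i \<subseteq> R) \<and> (\<forall>j<T. y j \<subseteq> D) \<and>
            (\<forall>i<T. \<forall>j<T. (\<Sum>r\<in>x i. \<Sum>c\<in>y j. e r c) = N i j)"
    \<comment> \<open>Keeps q positive, as the finest division requires: a single line has one
      trace.\<close>
    define q where "q = q0 + 1"
    have stuck: "\<exists>x y. ordered_blocks T x \<and> ordered_blocks T y \<and> (\<forall>i<T. x i \<subseteq> {..<p}) \<and> (\<forall>j<T. y
        j \<subseteq> {..<n}) \<and>
        (\<forall>i<T. \<forall>j<T. (\<Sum>r\<in>x i. \<Sum>c\<in>y j. e r c) = M i j)"
      if fin: "finite Sr" "finite Sc" and poor: "poor_division k q e p n Sr Sc"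
        and st: "\<And>s. s \<in> Sr \<Longrightarrow> \<not> poor_division k q e p n (Sr - {s}) Sc"
        and ne: "Sr \<noteq> {}" and le: "card Sc \<le> card Sr" for e p n Sr Sc M
    proof (rule pat[of "{..<p}" "{..<n}" "\<lambda>r. cut_index Sr r div 2" "cut_index Sc" "(card Sr +
        1) div 2"])
      show "mono (\<lambda>r. cut_index Sr r div 2)"
        using mono_cut_index[OF fin(1)] by (simp add: mono_def div_le_mono)
      show "mono (cut_index Sc)" by (rule mono_cut_index[OF fin(2)])
      have "0 < card Sr" using ne fin(1) by (simp add: card_gt_0_iff)
      then show pos: "0 < (card Sr + 1) div 2" by simp
      \<comment> \<open>The indices go up to \<open>card Sc\<close>, at most \<open>card Sr\<close>.
        Twice the number of pairs can fall one short of \<open>card Sr + 1\<close>, as for two cuts;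
        three times suffices because there is at least one pair.\<close>
      show "cut_index Sc ` {..<n} \<subseteq> {..<3 * ((card Sr + 1) div 2)}"
      proof
        fix j assume "j \<in> cut_index Sc ` {..<n}"
        then have "j \<le> card Sc" using cut_index_le_card[OF fin(2)] by blast
        then have "j \<le> card Sr" using le by simp
        then show "j \<in> {..<3 * ((card Sr + 1) div 2)}" using pos by simp
      qed
      show "q0 < card (row_trace e ({..<n} - Z) ` {r \<in> {..<p}. cut_index Sr r div 2 = j})"
        if "j < (card Sr + 1) div 2" "Z \<subseteq> {..<n}" "card (cut_index Sc ` Z) \<le> k" for j Z
        using stuck_imp_rich[OF fin poor st that] by (simp add: q_def)
    qed simp_all
    show thesis
    proof (rule that)
      fix A :: "bit mat"
      assume no: "\<not> parity_minor N A"
      let ?p = "dim_row A" and ?n = "dim_col A" and ?e = "\<lambda>r c. A $$ (r, c)"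
      \<comment> \<open>N padded with ones. The spare row and column force all blocks of N to be
        nonempty, because empty sums are 0.\<close>
      define M where "M i j = (if i < dim_row N \<and> j < dim_col N then N $$ (i, j) else 1)" for i j
      have found: False
        if xy: "ordered_blocks T x" "ordered_blocks T y" "\<forall>i<T. x i \<subseteq> {..<?p}" "\<forall>j<T. y j \<subseteq> {..<?n}"
          and sums: "\<forall>i<T. \<forall>j<T. (\<Sum>r\<in>x i. \<Sum>c\<in>y j. A $$ (r, c)) = M i j" for x y
      proof -
        have dims: "dim_row N \<le> T" "dim_col N \<le> T" "dim_row N < T" "dim_col N < T" by (simp_all
            add: T_def)
        have "block_sums A N x y"
          unfolding block_sums_def
        proof (intro conjI allI impI)
          show "ordered_blocks (dim_row N) x" "ordered_blocks (dim_col N) y"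
            by (rule ordered_blocks_mono[OF xy(1) dims(1)], rule ordered_blocks_mono[OF xy(2)
                dims(2)])
          show "x i \<subseteq> {..<?p}" if "i < dim_row N" for i using xy(3) that dims by simp
          show "y j \<subseteq> {..<?n}" if "j < dim_col N" for j using xy(4) that dims by simp
          show "N $$ (i, j) = (\<Sum>r\<in>x i. \<Sum>c\<in>y j. A $$ (r, c))" if "i < dim_row N" "j < dim_col N"
              for i j
            using sums that dims by (simp add: M_def)
        qed
        moreover have "x i \<noteq> {}" if "i < dim_row N" for i
        proof
          assume "x i = {}"
          moreover have "(\<Sum>r\<in>x i. \<Sum>c\<in>y (dim_col N). A $$ (r, c)) = 1"
            using sums that dims by (simp add: M_def)
          ultimately show False by simp
        qed
        moreover have "y j \<noteq> {}" if "j < dim_col N" for j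
        proof
          assume "y j = {}"
          moreover have "(\<Sum>r\<in>x (dim_row N). \<Sum>c\<in>y j. A $$ (r, c)) = 1"
            using sums that dims by (simp add: M_def)
          ultimately show False by simp
        qed
        ultimately show False using block_sums_imp_parity_minor no by blast
      qed
      have progress: "(\<exists>s\<in>Sr. poor_division k q ?e ?p ?n (Sr - {s}) Sc) \<or>
          (\<exists>s\<in>Sc. poor_division k q ?e ?p ?n Sr (Sc - {s}))"
        if fin: "finite Sr" "finite Sc" and poor: "poor_division k q ?e ?p ?n Sr Sc"
          and ne: "Sr \<noteq> {} \<or> Sc \<noteq> {}" for Sr Sc
      proof (rule ccontr)
        assume "\<not> ?thesis"
        then have st: "\<And>s. s \<in> Sr \<Longrightarrow> \<not> poor_division k q ?e ?p ?n (Sr - {s}) Sc"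
          "\<And>s. s \<in> Sc \<Longrightarrow> \<not> poor_division k q (transposed ?e) ?n ?p (Sc - {s}) Sr"
          unfolding poor_division_transposed[of k q ?e] by blast+
        show False
        \<comment> \<open>The side with more cuts is the one paired up, so that the intervals of the
          other side fit below three times the number of pairs.\<close>
        proof (cases "card Sc \<le> card Sr")
          case True
          then have "Sr \<noteq> {}" using ne fin(2) by auto
          from stuck[OF fin poor st(1) this True, of M] show False using found by blast
        next
          case False
          then have "Sc \<noteq> {}" "card Sr \<le> card Sc" by auto
          from stuck[OF fin(2,1) _ st(2) this, of "transposed M"] obtain y x
            where xy: "ordered_blocks T y" "ordered_blocks T x" "\<forall>j<T. y j \<subseteq> {..<?n}" "\<forall>i<T. x i
                \<subseteq> {..<?p}"
              and sums: "\<forall>j<T. \<forall>i<T. (\<Sum>c\<in>y j. \<Sum>r\<in>x i. A $$ (r, c)) = M i j"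
            using poor unfolding poor_division_transposed[of k q ?e] by blast
          have "\<forall>i<T. \<forall>j<T. (\<Sum>r\<in>x i. \<Sum>c\<in>y j. A $$ (r, c)) = M i j"
            using sums by (subst sum.swap) blast
          then show False by (rule found[OF xy(2,1,4,3)])
        qed
      qed
      have pts: "points (matrix_structure A) = {..<?p} <+> {..<?n}" by (simp add:
          matrix_structure_def)
      have "1 \<le> q" by (simp add: q_def)
      from merge_path_matrix_partition[OF progress _ _ poor_division_finest[OF this, of k ?e ?p ?n]]
      show "twin_width (matrix_structure A) \<le> degree_bound k q"
        unfolding matrix_partition_finest by (intro twin_width_le) (simp_all add: pts)
    qed
  qed
qed

theorem theorem34:
  fixes \<M> :: "bit mat set"
  assumes "matrix_class \<M>"
  shows "bounded_twin_width \<M> \<longleftrightarrow> parity_minor_free \<M>"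
proof
  assume "parity_minor_free \<M>"
  then obtain N where N: "\<forall>A\<in>\<M>. \<not> parity_minor N A" unfolding parity_minor_free_def by blast
  obtain d where "\<And>A. \<not> parity_minor N A \<Longrightarrow> twin_width (matrix_structure A) \<le> d"
    by (rule bounded_twin_width_of_parity_minor_free[of N]) blast
  then show "bounded_twin_width \<M>" using N unfolding bounded_twin_width_def by blast
qed (rule bounded_twin_width_imp_parity_minor_free)

end
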